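(* There is a full subcategory $\Upsilon\subseteq\mathsf{sList}_{Op}$ of the category of operadic simplicial lists such that there is an equivalence of categories $$\mathsf{sList}_{Op}\simeq\mathsf{Set}^{\Upsilon^{op}}.$$ Moreover, the category $\Upsilon$ admits the following description: - the objects are the rooted simplices of $N(\Delta_+)$; - given rooted simplices $\alpha\in N(\Delta_+)_n$ and $\beta\in N(\Delta_+)_k$, a morphism $\beta\to\alpha$ is a pair $(\theta,a)$ consisting of a morphism $\theta:[k]\to[n]$ in $\Delta$ and an element $a\in\alpha(\theta(k))$ such that $\beta=(\theta^*\alpha)_a$.
   Context: For a set $X$, $\mathcal{L}X=\coprod_{n\ge 0}X^n$. A listing from $A$ to $X$ is a function $u:A\to\mathcal{L}X$; listings compose by concatenation ($(vu)(a)=v(x_1)*\dots*v(x_k)$ if $u(a)=(x_1,\dots,x_k)$), giving the category $\mathsf{List}$ of sets and listings. A function is viewed as a listing with values of length $1$. A simplicial list is a functor $X:\Delta^{op}\to\mathsf{List}$; morphisms of simplicial lists are natural transformations whose components are functions. $X$ is operadic if for every $\theta:[k]\to[n]$ in $\Delta$ with $\theta(k)=n$ the map $\theta^*:X_n\to X_k$ is a function. $\mathsf{sList}_{Op}$ is the category of operadic simplicial lists and these morphisms. $\Delta_+$ is the category of finite (possibly empty) totally ordered sets and order-preserving maps; objects are considered up to their unique isomorphism (so $\Delta_+$ is taken skeletal). An $n$-simplex of $N(\Delta_+)$ is a functor $\alpha:[n]\to\Delta_+$, i.e. a chain $A_0\to A_1\to\dots\to A_n$ with $A_i=\alpha(i)$.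 It is rooted if $A_n$ has exactly one element. For any $\gamma\in N(\Delta_+)_k$ and $a\in\gamma(k)$, $\gamma_a$ denotes the rooted $k$-simplex obtained by pulling the chain $\gamma$ back along $\{a\}\subseteq\gamma(k)$, i.e. by restricting each level to the elements mapping to $a$. In the description of $\Upsilon$, composition is $(\theta,a)\circ(\eta,b)=(\theta\eta,b)$, where for $(\eta,b):\gamma\to\beta$ with $\eta:[l]\to[k]$ and $\beta=(\theta^*\alpha)_a$, the element $b\in\beta(\eta(l))$ is regarded as an element of $\alpha(\theta\eta(l))$; identities are $(1_{[n]},\text{root})$. *)

theory Defs
  imports "HOL-Library.FuncSet" "HOL-Library.Equipollence"
begin

section \<open>Categories, functors, natural transformations\<close>

text \<open>
  Hom-sets of different pairs of objects need not be disjoint, so composition receives the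
  objects: \<open>Comp C x y z g f\<close> is the composite of \<open>f \<in> Hom C x y\<close> and \<open>g \<in> Hom C y z\<close>.
\<close>

record ('o, 'm) cat =
  Obj :: "'o set"
  Hom :: "'o \<Rightarrow> 'o \<Rightarrow> 'm set"
  Id :: "'o \<Rightarrow> 'm"
  Comp :: "'o \<Rightarrow> 'o \<Rightarrow> 'o \<Rightarrow> 'm \<Rightarrow> 'm \<Rightarrow> 'm"

definition category :: "('o, 'm) cat \<Rightarrow> bool" where
  "category C \<longleftrightarrow>
     (\<forall>x\<in>Obj C. Id C x \<in> Hom C x x) \<and>
     (\<forall>x\<in>Obj C. \<forall>y\<in>Obj C. \<forall>z\<in>Obj C. \<forall>f\<in>Hom C x y. \<forall>g\<in>Hom C y z.
        Comp C x y z g f \<in> Hom C x z) \<and>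
     (\<forall>x\<in>Obj C. \<forall>y\<in>Obj C. \<forall>f\<in>Hom C x y.
        Comp C x x y f (Id C x) = f \<and> Comp C x y y (Id C y) f = f) \<and>
     (\<forall>w\<in>Obj C. \<forall>x\<in>Obj C. \<forall>y\<in>Obj C. \<forall>z\<in>Obj C.
        \<forall>f\<in>Hom C w x. \<forall>g\<in>Hom C x y. \<forall>h\<in>Hom C y z.
          Comp C w y z h (Comp C w x y g f) = Comp C w x z (Comp C x y z h g) f)"

definition op_cat :: "('o, 'm) cat \<Rightarrow> ('o, 'm) cat" where
  "op_cat C = \<lparr> Obj = Obj C, Hom = (\<lambda>x y. Hom C y x), Id = Id C,
                Comp = (\<lambda>x y z g f. Comp C z y x f g) \<rparr>"

definition full_subcat :: "('o, 'm) cat \<Rightarrow> 'o set \<Rightarrow> ('o, 'm) cat" where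
  "full_subcat C S = \<lparr> Obj = S, Hom = Hom C, Id = Id C, Comp = Comp C \<rparr>"

definition isomorphic_in :: "('o, 'm) cat \<Rightarrow> 'o \<Rightarrow> 'o \<Rightarrow> bool" where
  "isomorphic_in C x y \<longleftrightarrow>
     (\<exists>f\<in>Hom C x y. \<exists>g\<in>Hom C y x. Comp C x y x g f = Id C x \<and> Comp C y x y f g = Id C y)"

text \<open>
  Functors and natural transformations are required to be \<open>undefined\<close> outside their domain,
  so that HOL equality is equality of functors and of natural transformations.
\<close>

record ('o, 'm, 'p, 'n) ftor =
  on_ob :: "'o \<Rightarrow> 'p"
  on_hom :: "'o \<Rightarrow> 'o \<Rightarrow> 'm \<Rightarrow> 'n"

definition is_ftor ::
  "('o, 'm) cat \<Rightarrow> ('p, 'n) cat \<Rightarrow> ('o, 'm, 'p, 'n) ftor \<Rightarrow> bool" where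
  "is_ftor C D F \<longleftrightarrow>
     on_ob F \<in> Obj C \<rightarrow>\<^sub>E Obj D \<and>
     on_hom F \<in> (\<Pi>\<^sub>E x\<in>Obj C. \<Pi>\<^sub>E y\<in>Obj C. Hom C x y \<rightarrow>\<^sub>E Hom D (on_ob F x) (on_ob F y)) \<and>
     (\<forall>x\<in>Obj C. on_hom F x x (Id C x) = Id D (on_ob F x)) \<and>
     (\<forall>x\<in>Obj C. \<forall>y\<in>Obj C. \<forall>z\<in>Obj C. \<forall>f\<in>Hom C x y. \<forall>g\<in>Hom C y z.
        on_hom F x z (Comp C x y z g f) =
          Comp D (on_ob F x) (on_ob F y) (on_ob F z) (on_hom F y z g) (on_hom F x y f))"

definition id_ftor :: "('o, 'm) cat \<Rightarrow> ('o, 'm, 'o, 'm) ftor" where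
  "id_ftor C = \<lparr> on_ob = (\<lambda>x\<in>Obj C. x),
                 on_hom = (\<lambda>x\<in>Obj C. \<lambda>y\<in>Obj C. \<lambda>f\<in>Hom C x y. f) \<rparr>"

definition comp_ftor ::
  "('o, 'm) cat \<Rightarrow> ('p, 'n, 'q, 'l) ftor \<Rightarrow> ('o, 'm, 'p, 'n) ftor \<Rightarrow> ('o, 'm, 'q, 'l) ftor" where
  "comp_ftor C G F =
     \<lparr> on_ob = (\<lambda>x\<in>Obj C. on_ob G (on_ob F x)),
       on_hom = (\<lambda>x\<in>Obj C. \<lambda>y\<in>Obj C. \<lambda>f\<in>Hom C x y.
                   on_hom G (on_ob F x) (on_ob F y) (on_hom F x y f)) \<rparr>"

definition nat_trans ::
  "('o, 'm) cat \<Rightarrow> ('p, 'n) cat \<Rightarrow> ('o, 'm, 'p, 'n) ftor \<Rightarrow> ('o, 'm, 'p, 'n) ftor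
     \<Rightarrow> ('o \<Rightarrow> 'n) set" where
  "nat_trans C D F G =
     {\<tau> \<in> (\<Pi>\<^sub>E x\<in>Obj C. Hom D (on_ob F x) (on_ob G x)).
        \<forall>x\<in>Obj C. \<forall>y\<in>Obj C. \<forall>f\<in>Hom C x y.
          Comp D (on_ob F x) (on_ob F y) (on_ob G y) (\<tau> y) (on_hom F x y f) =
          Comp D (on_ob F x) (on_ob G x) (on_ob G y) (on_hom G x y f) (\<tau> x)}"

definition ftor_cat ::
  "('o, 'm) cat \<Rightarrow> ('p, 'n) cat \<Rightarrow> (('o, 'm, 'p, 'n) ftor, 'o \<Rightarrow> 'n) cat" where
  "ftor_cat C D =
     \<lparr> Obj = {F. is_ftor C D F},
       Hom = nat_trans C D,
       Id = (\<lambda>F. \<lambda>x\<in>Obj C. Id D (on_ob F x)),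
       Comp = (\<lambda>F G H \<sigma> \<tau>. \<lambda>x\<in>Obj C.
                 Comp D (on_ob F x) (on_ob G x) (on_ob H x) (\<sigma> x) (\<tau> x)) \<rparr>"

definition equivalent_cats :: "('o, 'm) cat \<Rightarrow> ('p, 'n) cat \<Rightarrow> bool" where
  "equivalent_cats C D \<longleftrightarrow>
     category C \<and> category D \<and>
     (\<exists>F G. is_ftor C D F \<and> is_ftor D C G \<and>
        isomorphic_in (ftor_cat C C) (comp_ftor C G F) (id_ftor C) \<and>
        isomorphic_in (ftor_cat D D) (comp_ftor D F G) (id_ftor D))"

definition isomorphic_cats :: "('o, 'm) cat \<Rightarrow> ('p, 'n) cat \<Rightarrow> bool" where
  "isomorphic_cats C D \<longleftrightarrow>
     category C \<and> category D \<and>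
     (\<exists>F G. is_ftor C D F \<and> is_ftor D C G \<and>
        comp_ftor C G F = id_ftor C \<and> comp_ftor D F G = id_ftor D)"


section \<open>Sets and listings\<close>

text \<open>
  Since HOL has no set of all sets, the category of sets is formed relative to a universe
  \<open>U\<close> of small subsets of an arbitrary type. The closure conditions hold for the small sets of
  a Grothendieck universe (with infinity), and also for all subsets of any infinite type.
\<close>

definition set_universe :: "'u set set \<Rightarrow> bool" where
  "set_universe U \<longleftrightarrow>
     (\<exists>A\<in>U. infinite A) \<and>
     (\<forall>A\<in>U. \<forall>B. B \<subseteq> A \<longrightarrow> B \<in> U) \<and>
     (\<forall>I\<in>U. \<forall>A :: 'u \<Rightarrow> 'u set. (\<forall>i\<in>I. A i \<in> U) \<longrightarrow> (\<exists>B\<in>U. B \<approx> Sigma I A))"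

lemma set_universe_UNIV:
  assumes "infinite (UNIV :: 'u set)"
  shows "set_universe (UNIV :: 'u set set)"
proof -
  obtain f :: "'u \<times> 'u \<Rightarrow> 'u" where f: "inj f"
    using card_of_Times_same_infinite[OF assms] by (auto simp flip: card_of_ordIso simp: bij_betw_def)
  have "f ` Sigma I A \<approx> Sigma I A" for I and A :: "'u \<Rightarrow> 'u set"
    by (rule inj_on_image_eqpoll_self) (rule inj_on_subset[OF f], simp)
  then show ?thesis using assms by (auto simp: set_universe_def)
qed

definition set_cat :: "'u set set \<Rightarrow> ('u set, 'u \<Rightarrow> 'u) cat" where
  "set_cat U =
     \<lparr> Obj = U,
       Hom = (\<lambda>A B. A \<rightarrow>\<^sub>E B),
       Id = (\<lambda>A. \<lambda>a\<in>A. a),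
       Comp = (\<lambda>A B C g f. compose A g f) \<rparr>"

definition list_cat :: "'u set set \<Rightarrow> ('u set, 'u \<Rightarrow> 'u list) cat" where
  "list_cat U =
     \<lparr> Obj = U,
       Hom = (\<lambda>A X. A \<rightarrow>\<^sub>E lists X),
       Id = (\<lambda>A. \<lambda>a\<in>A. [a]),
       Comp = (\<lambda>A X Y v u. \<lambda>a\<in>A. concat (map v (u a))) \<rparr>"

definition is_function :: "'a set \<Rightarrow> ('a \<Rightarrow> 'b list) \<Rightarrow> bool" where
  "is_function A u \<longleftrightarrow> (\<forall>a\<in>A. length (u a) = 1)"


section \<open>Operadic simplicial lists\<close>

text \<open>The object \<open>n\<close> of \<open>Delta\<close> is the ordinal \<open>[n] = {0, \<dots>, n}\<close>.\<close>

definition Delta :: "(nat, nat \<Rightarrow> nat) cat" where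
  "Delta =
     \<lparr> Obj = UNIV,
       Hom = (\<lambda>m n. {\<theta> \<in> {..m} \<rightarrow>\<^sub>E {..n}. mono_on {..m} \<theta>}),
       Id = (\<lambda>n. \<lambda>i\<in>{..n}. i),
       Comp = (\<lambda>l m n \<theta> \<eta>. compose {..l} \<theta> \<eta>) \<rparr>"

type_synonym 'u simplicial_list = "(nat, nat \<Rightarrow> nat, 'u set, 'u \<Rightarrow> 'u list) ftor"

text \<open>
  \<open>\<theta>\<^sup>*\<close> for \<open>\<theta> : [k] \<rightarrow> [n]\<close> is \<open>on_hom X n k \<theta>\<close>, since \<open>\<theta>\<close> is a morphism from \<open>n\<close> to \<open>k\<close>
  in the opposite category.
\<close>

definition operadic :: "'u simplicial_list \<Rightarrow> bool" where
  "operadic X \<longleftrightarrow>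
     (\<forall>k n. \<forall>\<theta>\<in>Hom Delta k n. \<theta> k = n \<longrightarrow> is_function (on_ob X n) (on_hom X n k \<theta>))"

definition sList_Op :: "'u set set \<Rightarrow> ('u simplicial_list, nat \<Rightarrow> 'u \<Rightarrow> 'u list) cat" where
  "sList_Op U =
     (let F = ftor_cat (op_cat Delta) (list_cat U) in
      \<lparr> Obj = {X \<in> Obj F. operadic X},
        Hom = (\<lambda>X Y. {\<tau> \<in> Hom F X Y. \<forall>n. is_function (on_ob X n) (\<tau> n)}),
        Id = Id F,
        Comp = Comp F \<rparr>)"


section \<open>Rooted simplices of the nerve of the augmented simplex category\<close>

text \<open>\<open>Delta_plus\<close> is skeletal: the object \<open>n\<close> is the ordered set \<open>{0, \<dots>, n - 1}\<close>.\<close>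

definition Delta_plus :: "(nat, nat \<Rightarrow> nat) cat" where
  "Delta_plus =
     \<lparr> Obj = UNIV,
       Hom = (\<lambda>m n. {f \<in> {..<m} \<rightarrow>\<^sub>E {..<n}. mono_on {..<m} f}),
       Id = (\<lambda>n. \<lambda>i\<in>{..<n}. i),
       Comp = (\<lambda>l m n g f. compose {..<l} g f) \<rparr>"

text \<open>The poset \<open>[n]\<close> as a category: there is one morphism \<open>i \<rightarrow> j\<close> if \<open>i \<le> j\<close>, and none else.\<close>

definition ordinal_cat :: "nat \<Rightarrow> (nat, unit) cat" where
  "ordinal_cat n =
     \<lparr> Obj = {..n},
       Hom = (\<lambda>i j. {u. i \<le> j}),
       Id = (\<lambda>i. ()),
       Comp = (\<lambda>i j k g f. ()) \<rparr>"

type_synonym chain = "(nat, unit, nat, nat \<Rightarrow> nat) ftor"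

definition nerve_Delta_plus :: "nat \<Rightarrow> chain set" where
  "nerve_Delta_plus n = {\<alpha>. is_ftor (ordinal_cat n) Delta_plus \<alpha>}"

definition level :: "chain \<Rightarrow> nat \<Rightarrow> nat set" where
  "level \<alpha> i = {..<on_ob \<alpha> i}"

abbreviation transition :: "chain \<Rightarrow> nat \<Rightarrow> nat \<Rightarrow> nat \<Rightarrow> nat" where
  "transition \<alpha> i j \<equiv> on_hom \<alpha> i j ()"

text \<open>\<open>\<theta>\<^sup>*\<alpha> = \<alpha> \<circ> \<theta>\<close> for \<open>\<theta> : [k] \<rightarrow> [n]\<close>, with \<open>\<theta>\<close> viewed as a functor of posets.\<close>

definition pull_chain :: "nat \<Rightarrow> (nat \<Rightarrow> nat) \<Rightarrow> chain \<Rightarrow> chain" where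
  "pull_chain k \<theta> \<alpha> =
     comp_ftor (ordinal_cat k) \<alpha>
       \<lparr> on_ob = (\<lambda>i\<in>{..k}. \<theta> i),
         on_hom = (\<lambda>i\<in>{..k}. \<lambda>j\<in>{..k}. \<lambda>u\<in>{u. i \<le> j}. ()) \<rparr>"

definition fibre :: "nat \<Rightarrow> chain \<Rightarrow> nat \<Rightarrow> nat \<Rightarrow> nat set" where
  "fibre k \<gamma> a i = {x \<in> level \<gamma> i. transition \<gamma> i k x = a}"

text \<open>
  Since \<open>Delta_plus\<close> is skeletal, level \<open>i\<close> of \<open>\<gamma>\<^sub>a\<close> is not the fibre itself but the
  ordinal order-isomorphic to it; \<open>fibre_incl\<close> is that order isomorphism, read as the inclusion of
  \<open>\<gamma>\<^sub>a(i)\<close> into \<open>\<gamma>(i)\<close>.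
\<close>

definition fibre_incl :: "nat \<Rightarrow> chain \<Rightarrow> nat \<Rightarrow> nat \<Rightarrow> nat \<Rightarrow> nat" where
  "fibre_incl k \<gamma> a i x = sorted_list_of_set (fibre k \<gamma> a i) ! x"

definition restrict_chain :: "nat \<Rightarrow> chain \<Rightarrow> nat \<Rightarrow> chain" where
  "restrict_chain k \<gamma> a =
     \<lparr> on_ob = (\<lambda>i\<in>{..k}. card (fibre k \<gamma> a i)),
       on_hom = (\<lambda>i\<in>{..k}. \<lambda>j\<in>{..k}. \<lambda>u\<in>{u. i \<le> j}. \<lambda>x\<in>{..<card (fibre k \<gamma> a i)}.
          the_inv_into {..<card (fibre k \<gamma> a j)} (fibre_incl k \<gamma> a j)
            (transition \<gamma> i j (fibre_incl k \<gamma> a i x))) \<rparr>"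

definition rooted_simplices :: "(nat \<times> chain) set" where
  "rooted_simplices = {(n, \<alpha>). \<alpha> \<in> nerve_Delta_plus n \<and> card (level \<alpha> n) = 1}"

text \<open>
  The root of a rooted simplex \<open>(n, \<alpha>)\<close> is \<open>0\<close>, the only element of \<open>level \<alpha> n = {..<1}\<close>.
  In a composite, \<open>b\<close> lies in level \<open>\<eta> l\<close> of \<open>\<beta> = (\<theta>\<^sup>*\<alpha>)\<^sub>a\<close> and is carried along the inclusion
  into \<open>(\<theta>\<^sup>*\<alpha>)(\<eta> l) = \<alpha>(\<theta> (\<eta> l))\<close>.
\<close>

definition rooted_simplex_cat :: "(nat \<times> chain, (nat \<Rightarrow> nat) \<times> nat) cat" where
  "rooted_simplex_cat =
     \<lparr> Obj = rooted_simplices,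
       Hom = (\<lambda>(k, \<beta>) (n, \<alpha>).
          {(\<theta>, a). \<theta> \<in> Hom Delta k n \<and> a \<in> level \<alpha> (\<theta> k) \<and>
                   \<beta> = restrict_chain k (pull_chain k \<theta> \<alpha>) a}),
       Id = (\<lambda>(n, \<alpha>). (Id Delta n, 0)),
       Comp = (\<lambda>(l, \<gamma>) (k, \<beta>) (n, \<alpha>) (\<theta>, a) (\<eta>, b).
          (Comp Delta l k n \<theta> \<eta>, fibre_incl k (pull_chain k \<theta> \<alpha>) a (\<eta> l) b)) \<rparr>"

end

theory Submission
  imports Defs "HOL-Library.Countable_Set"
begin

text \<open>
  An element \<open>x\<close> of \<open>X\<^sub>n\<close>, for \<open>X\<close> operadic, has a shape, which is a rooted \<open>n\<close>-simplex: its level \<open>i\<close>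
  indexes the list of \<open>i\<close>-th vertices of \<open>x\<close>, and the transition from level \<open>i\<close> to level \<open>j\<close> comes
  from bracketing the list of \<open>i\<close>-th vertices according to the edges \<open>(i, j)\<close> of \<open>x\<close>, which are in
  bijection with the \<open>j\<close>-th vertices because the last vertex of an edge is a function. The
  \<open>a\<close>-th entry of \<open>\<theta>\<^sup>* x\<close> then has shape \<open>(\<theta>\<^sup>*\<alpha>)\<^sub>a\<close>, where \<open>\<alpha>\<close> is the shape of \<open>x\<close>. So the elements of
  a given shape form a presheaf on rooted simplices, and this presheaf determines \<open>X\<close>, since
  \<open>X\<^sub>n\<close> is the disjoint union of its values and \<open>\<theta>\<^sup>* x\<close> is the list of the restrictions of \<open>x\<close>
  along all \<open>(\<theta>, a)\<close>. The subcategory consists of the operadic simplicial lists corresponding to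
  the representable presheaves.
\<close>

section \<open>Functors and equivalences\<close>

text \<open>The correspondence rests on order. Listings compose by concatenation, and the fibres of
  a monotone map, taken in increasing order and concatenated, list its domain; so lists of
  restrictions compose correctly as soon as single restrictions do. Conversely, a list of lists
  determines a monotone map of positions, called \<open>block\<close>, and operadicity is what
  allows the entries of \<theta>* x to be numbered by the level of the shape at \<theta>(k).

  Two obstacles shape the rest. A morphism of rooted simplices demands an equality of chains, so
  faces of faces and shapes of entries must be computed exactly; this is done by characterising a
  restriction through strictly increasing maps onto the fibres. And all values must lie in
  \<open>U\<close>: hom-sets and disjoint unions over shapes are copied into it, which works because
  there are only countably many morphisms and chains. The subcategory is isomorphic, and not merely
  equivalent, to the category of rooted simplices because isomorphic rooted simplices are
  equal.\<close>

lemma Id_in [simp]: "category C \<Longrightarrow> x \<in> Obj C \<Longrightarrow> Id C x \<in> Hom C x x"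
  unfolding category_def by blast

lemma Comp_in [simp]:
  "category C \<Longrightarrow> x \<in> Obj C \<Longrightarrow> y \<in> Obj C \<Longrightarrow> z \<in> Obj C \<Longrightarrow>
   f \<in> Hom C x y \<Longrightarrow> g \<in> Hom C y z \<Longrightarrow> Comp C x y z g f \<in> Hom C x z"
  unfolding category_def by blast

lemma Comp_Id_right [simp]:
  "category C \<Longrightarrow> x \<in> Obj C \<Longrightarrow> y \<in> Obj C \<Longrightarrow> f \<in> Hom C x y \<Longrightarrow> Comp C x x y f (Id C x) = f"
  unfolding category_def by blast

lemma Comp_Id_left [simp]:
  "category C \<Longrightarrow> x \<in> Obj C \<Longrightarrow> y \<in> Obj C \<Longrightarrow> f \<in> Hom C x y \<Longrightarrow> Comp C x y y (Id C y) f = f"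
  unfolding category_def by blast

lemma Comp_assoc:
  "category C \<Longrightarrow> w \<in> Obj C \<Longrightarrow> x \<in> Obj C \<Longrightarrow> y \<in> Obj C \<Longrightarrow> z \<in> Obj C \<Longrightarrow>
   f \<in> Hom C w x \<Longrightarrow> g \<in> Hom C x y \<Longrightarrow> h \<in> Hom C y z \<Longrightarrow>
   Comp C w x z (Comp C x y z h g) f = Comp C w y z h (Comp C w x y g f)"
  unfolding category_def by metis

lemma op_cat_simps [simp]:
  "Obj (op_cat C) = Obj C" "Hom (op_cat C) x y = Hom C y x" "Id (op_cat C) = Id C"
  "Comp (op_cat C) x y z g f = Comp C z y x f g"
  by (simp_all add: op_cat_def)

lemma category_op_cat: "category C \<Longrightarrow> category (op_cat C)"
  unfolding category_def[of "op_cat C"] by (simp add: Comp_assoc)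

lemma category_full_subcat: "category C \<Longrightarrow> S \<subseteq> Obj C \<Longrightarrow> category (full_subcat C S)"
  unfolding category_def full_subcat_def by simp blast

lemma ftor_ob: "is_ftor C D F \<Longrightarrow> x \<in> Obj C \<Longrightarrow> on_ob F x \<in> Obj D"
  by (auto simp: is_ftor_def)

lemma ftor_hom_PiE:
  assumes "is_ftor C D F" "x \<in> Obj C" "y \<in> Obj C"
  shows "on_hom F x y \<in> Hom C x y \<rightarrow>\<^sub>E Hom D (on_ob F x) (on_ob F y)"
proof -
  have "on_hom F \<in> (\<Pi>\<^sub>E x\<in>Obj C. \<Pi>\<^sub>E y\<in>Obj C. Hom C x y \<rightarrow>\<^sub>E Hom D (on_ob F x) (on_ob F y))"
    using assms(1) by (simp add: is_ftor_def)
  from PiE_mem[OF PiE_mem[OF this assms(2)] assms(3)] show ?thesis .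
qed

lemma ftor_hom:
  "is_ftor C D F \<Longrightarrow> x \<in> Obj C \<Longrightarrow> y \<in> Obj C \<Longrightarrow> f \<in> Hom C x y \<Longrightarrow>
   on_hom F x y f \<in> Hom D (on_ob F x) (on_ob F y)"
  using ftor_hom_PiE[of C D F x y] by auto

lemma ftor_Id: "is_ftor C D F \<Longrightarrow> x \<in> Obj C \<Longrightarrow> on_hom F x x (Id C x) = Id D (on_ob F x)"
  by (auto simp: is_ftor_def)

lemma ftor_Comp:
  "is_ftor C D F \<Longrightarrow> x \<in> Obj C \<Longrightarrow> y \<in> Obj C \<Longrightarrow> z \<in> Obj C \<Longrightarrow>
   f \<in> Hom C x y \<Longrightarrow> g \<in> Hom C y z \<Longrightarrow>
   on_hom F x z (Comp C x y z g f) =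
     Comp D (on_ob F x) (on_ob F y) (on_ob F z) (on_hom F y z g) (on_hom F x y f)"
  by (auto simp: is_ftor_def)

lemma ftor_eqI:
  assumes F: "is_ftor C D F" and G: "is_ftor C D' G"
    and ob: "\<And>x. x \<in> Obj C \<Longrightarrow> on_ob F x = on_ob G x"
    and hom: "\<And>x y f. x \<in> Obj C \<Longrightarrow> y \<in> Obj C \<Longrightarrow> f \<in> Hom C x y \<Longrightarrow> on_hom F x y f = on_hom G x y f"
  shows "F = G"
proof -
  have "on_ob F = on_ob G"
    using F G ob by (intro extensionalityI[of _ "Obj C"]) (auto simp: is_ftor_def PiE_def)
  moreover have "on_hom F = on_hom G"
  proof (rule extensionalityI[of _ "Obj C"])
    show "on_hom F \<in> extensional (Obj C)" "on_hom G \<in> extensional (Obj C)"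
      using F G by (auto simp: is_ftor_def PiE_def)
  next
    fix x assume x: "x \<in> Obj C"
    show "on_hom F x = on_hom G x"
    proof (rule extensionalityI[of _ "Obj C"])
      show "on_hom F x \<in> extensional (Obj C)" "on_hom G x \<in> extensional (Obj C)"
        using F G x by (auto simp: is_ftor_def PiE_def)
    next
      fix y assume y: "y \<in> Obj C"
      show "on_hom F x y = on_hom G x y"
        using ftor_hom_PiE[OF F x y] ftor_hom_PiE[OF G x y]
        by (intro extensionalityI[of _ "Hom C x y"]) (auto simp: PiE_def hom x y)
    qed
  qed
  ultimately show ?thesis by simp
qed

text \<open>The restrictions at all three levels produce the value \<open>undefined\<close> that
  \<open>is_ftor\<close> demands outside the domain.\<close>

definition mk_ftor ::
  "('o, 'm) cat \<Rightarrow> ('o \<Rightarrow> 'p) \<Rightarrow> ('o \<Rightarrow> 'o \<Rightarrow> 'm \<Rightarrow> 'n) \<Rightarrow> ('o, 'm, 'p, 'n) ftor" where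
  "mk_ftor C f h = \<lparr> on_ob = (\<lambda>x\<in>Obj C. f x),
                     on_hom = (\<lambda>x\<in>Obj C. \<lambda>y\<in>Obj C. \<lambda>m\<in>Hom C x y. h x y m) \<rparr>"

lemma mk_ftor_simps [simp]:
  "x \<in> Obj C \<Longrightarrow> on_ob (mk_ftor C f h) x = f x"
  "x \<in> Obj C \<Longrightarrow> y \<in> Obj C \<Longrightarrow> m \<in> Hom C x y \<Longrightarrow> on_hom (mk_ftor C f h) x y m = h x y m"
  by (auto simp: mk_ftor_def)

lemma is_ftor_mk_ftor:
  assumes "category C"
    and "\<And>x. x \<in> Obj C \<Longrightarrow> f x \<in> Obj D"
    and "\<And>x y m. x \<in> Obj C \<Longrightarrow> y \<in> Obj C \<Longrightarrow> m \<in> Hom C x y \<Longrightarrow> h x y m \<in> Hom D (f x) (f y)"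
    and "\<And>x. x \<in> Obj C \<Longrightarrow> h x x (Id C x) = Id D (f x)"
    and "\<And>x y z m n. x \<in> Obj C \<Longrightarrow> y \<in> Obj C \<Longrightarrow> z \<in> Obj C \<Longrightarrow> m \<in> Hom C x y \<Longrightarrow> n \<in> Hom C y z \<Longrightarrow>
       h x z (Comp C x y z n m) = Comp D (f x) (f y) (f z) (h y z n) (h x y m)"
  shows "is_ftor C D (mk_ftor C f h)"
  unfolding is_ftor_def
proof (intro conjI ballI)
  show "on_ob (mk_ftor C f h) \<in> Obj C \<rightarrow>\<^sub>E Obj D"
    using assms(2) by (auto simp: mk_ftor_def)
  show "on_hom (mk_ftor C f h) \<in> (\<Pi>\<^sub>E x\<in>Obj C. \<Pi>\<^sub>E y\<in>Obj C. Hom C x y \<rightarrow>\<^sub>E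
      Hom D (on_ob (mk_ftor C f h) x) (on_ob (mk_ftor C f h) y))"
    using assms(3) by (auto simp: mk_ftor_def)
qed (use assms in simp_all)

lemma comp_ftor_mk: "comp_ftor C G F = mk_ftor C (\<lambda>x. on_ob G (on_ob F x))
    (\<lambda>x y f. on_hom G (on_ob F x) (on_ob F y) (on_hom F x y f))"
  by (simp add: comp_ftor_def mk_ftor_def)

lemma id_ftor_mk: "id_ftor C = mk_ftor C (\<lambda>x. x) (\<lambda>x y f. f)"
  by (simp add: id_ftor_def mk_ftor_def)

lemma comp_ftor_simps [simp]:
  "x \<in> Obj C \<Longrightarrow> on_ob (comp_ftor C G F) x = on_ob G (on_ob F x)"
  "x \<in> Obj C \<Longrightarrow> y \<in> Obj C \<Longrightarrow> m \<in> Hom C x y \<Longrightarrow>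
     on_hom (comp_ftor C G F) x y m = on_hom G (on_ob F x) (on_ob F y) (on_hom F x y m)"
  by (auto simp: comp_ftor_def)

lemma id_ftor_simps [simp]:
  "x \<in> Obj C \<Longrightarrow> on_ob (id_ftor C) x = x"
  "x \<in> Obj C \<Longrightarrow> y \<in> Obj C \<Longrightarrow> m \<in> Hom C x y \<Longrightarrow> on_hom (id_ftor C) x y m = m"
  by (auto simp: id_ftor_def)

lemma is_ftor_comp_ftor:
  assumes C: "category C" and F: "is_ftor C D F" and G: "is_ftor D E G"
  shows "is_ftor C E (comp_ftor C G F)"
  unfolding comp_ftor_mk
  by (rule is_ftor_mk_ftor[OF C])
    (simp_all add: ftor_ob[OF F] ftor_hom[OF F] ftor_Id[OF F] ftor_Comp[OF F]
      ftor_ob[OF G] ftor_hom[OF G] ftor_Id[OF G] ftor_Comp[OF G])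

lemma is_ftor_id_ftor: "category C \<Longrightarrow> is_ftor C C (id_ftor C)"
  unfolding id_ftor_mk by (rule is_ftor_mk_ftor) auto

lemma nat_trans_in: "\<tau> \<in> nat_trans C D F G \<Longrightarrow> x \<in> Obj C \<Longrightarrow> \<tau> x \<in> Hom D (on_ob F x) (on_ob G x)"
  by (auto simp: nat_trans_def)

lemma nat_trans_natural:
  "\<tau> \<in> nat_trans C D F G \<Longrightarrow> x \<in> Obj C \<Longrightarrow> y \<in> Obj C \<Longrightarrow> f \<in> Hom C x y \<Longrightarrow>
   Comp D (on_ob F x) (on_ob F y) (on_ob G y) (\<tau> y) (on_hom F x y f) =
   Comp D (on_ob F x) (on_ob G x) (on_ob G y) (on_hom G x y f) (\<tau> x)"
  by (auto simp: nat_trans_def)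

lemma nat_trans_eqI:
  "\<sigma> \<in> nat_trans C D F G \<Longrightarrow> \<tau> \<in> nat_trans C D F' G' \<Longrightarrow> (\<And>x. x \<in> Obj C \<Longrightarrow> \<sigma> x = \<tau> x) \<Longrightarrow> \<sigma> = \<tau>"
  unfolding nat_trans_def by (rule extensionalityI[of _ "Obj C"]) (auto simp: PiE_def)

lemma restrict_nat_transI:
  assumes "\<And>x. x \<in> Obj C \<Longrightarrow> \<tau> x \<in> Hom D (on_ob F x) (on_ob G x)"
    and "\<And>x y f. x \<in> Obj C \<Longrightarrow> y \<in> Obj C \<Longrightarrow> f \<in> Hom C x y \<Longrightarrow>
      Comp D (on_ob F x) (on_ob F y) (on_ob G y) (\<tau> y) (on_hom F x y f) =
      Comp D (on_ob F x) (on_ob G x) (on_ob G y) (on_hom G x y f) (\<tau> x)"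
  shows "(\<lambda>x\<in>Obj C. \<tau> x) \<in> nat_trans C D F G"
  using assms by (auto simp: nat_trans_def)

lemma ftor_cat_simps [simp]:
  "Obj (ftor_cat C D) = {F. is_ftor C D F}"
  "Hom (ftor_cat C D) = nat_trans C D"
  "Id (ftor_cat C D) F = (\<lambda>x\<in>Obj C. Id D (on_ob F x))"
  "Comp (ftor_cat C D) F G H \<sigma> \<tau> =
     (\<lambda>x\<in>Obj C. Comp D (on_ob F x) (on_ob G x) (on_ob H x) (\<sigma> x) (\<tau> x))"
  by (simp_all add: ftor_cat_def)

lemma nat_trans_Id:
  assumes "category D" "is_ftor C D F"
  shows "(\<lambda>x\<in>Obj C. Id D (on_ob F x)) \<in> nat_trans C D F F"
  by (rule restrict_nat_transI) (simp_all add: assms(1) ftor_ob[OF assms(2)] ftor_hom[OF assms(2)])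

lemma nat_trans_Comp:
  assumes D: "category D" and F: "is_ftor C D F" and G: "is_ftor C D G" and H: "is_ftor C D H"
    and \<tau>: "\<tau> \<in> nat_trans C D F G" and \<sigma>: "\<sigma> \<in> nat_trans C D G H"
  shows "(\<lambda>x\<in>Obj C. Comp D (on_ob F x) (on_ob G x) (on_ob H x) (\<sigma> x) (\<tau> x)) \<in> nat_trans C D F H"
proof (rule restrict_nat_transI)
  note [simp] = D ftor_ob[OF F] ftor_ob[OF G] ftor_ob[OF H] ftor_hom[OF F] ftor_hom[OF G]
    ftor_hom[OF H] nat_trans_in[OF \<tau>] nat_trans_in[OF \<sigma>]
  fix x assume "x \<in> Obj C"
  then show "Comp D (on_ob F x) (on_ob G x) (on_ob H x) (\<sigma> x) (\<tau> x) \<in> Hom D (on_ob F x) (on_ob H x)"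
    by simp
  fix y f assume *: "x \<in> Obj C" "y \<in> Obj C" "f \<in> Hom C x y"
  have "Comp D (on_ob F x) (on_ob F y) (on_ob H y)
      (Comp D (on_ob F y) (on_ob G y) (on_ob H y) (\<sigma> y) (\<tau> y)) (on_hom F x y f) =
    Comp D (on_ob F x) (on_ob G y) (on_ob H y) (\<sigma> y)
      (Comp D (on_ob F x) (on_ob G x) (on_ob G y) (on_hom G x y f) (\<tau> x))"
    using * by (simp add: Comp_assoc nat_trans_natural[OF \<tau>])
  also have "\<dots> = Comp D (on_ob F x) (on_ob G x) (on_ob H y)
      (Comp D (on_ob G x) (on_ob H x) (on_ob H y) (on_hom H x y f) (\<sigma> x)) (\<tau> x)"
    using * by (simp flip: Comp_assoc add: nat_trans_natural[OF \<sigma>])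
  also have "\<dots> = Comp D (on_ob F x) (on_ob H x) (on_ob H y) (on_hom H x y f)
      (Comp D (on_ob F x) (on_ob G x) (on_ob H x) (\<sigma> x) (\<tau> x))"
    using * by (simp add: Comp_assoc)
  finally show "Comp D (on_ob F x) (on_ob F y) (on_ob H y)
      (Comp D (on_ob F y) (on_ob G y) (on_ob H y) (\<sigma> y) (\<tau> y)) (on_hom F x y f) =
    Comp D (on_ob F x) (on_ob H x) (on_ob H y) (on_hom H x y f)
      (Comp D (on_ob F x) (on_ob G x) (on_ob H x) (\<sigma> x) (\<tau> x))" .
qed

lemma category_ftor_cat:
  assumes D: "category D"
  shows "category (ftor_cat C D)"
  unfolding category_def
proof (intro conjI ballI)
  fix F G \<tau> assume "F \<in> Obj (ftor_cat C D)" "G \<in> Obj (ftor_cat C D)" "\<tau> \<in> Hom (ftor_cat C D) F G"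
  then have F: "is_ftor C D F" and G: "is_ftor C D G" and \<tau>: "\<tau> \<in> nat_trans C D F G" by auto
  show "Comp (ftor_cat C D) F F G \<tau> (Id (ftor_cat C D) F) = \<tau>"
    using nat_trans_Comp[OF D F F G nat_trans_Id[OF D F] \<tau>] \<tau> D F G nat_trans_in[OF \<tau>]
    by (intro nat_trans_eqI[of _ C D F G _ F G]) (auto simp: ftor_ob)
  show "Comp (ftor_cat C D) F G G (Id (ftor_cat C D) G) \<tau> = \<tau>"
    using nat_trans_Comp[OF D F G G \<tau> nat_trans_Id[OF D G]] \<tau> D F G nat_trans_in[OF \<tau>]
    by (intro nat_trans_eqI[of _ C D F G _ F G]) (auto simp: ftor_ob)
next
  fix F G H K \<tau> \<sigma> \<rho>
  assume "F \<in> Obj (ftor_cat C D)" "G \<in> Obj (ftor_cat C D)" "H \<in> Obj (ftor_cat C D)"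
    "K \<in> Obj (ftor_cat C D)" "\<tau> \<in> Hom (ftor_cat C D) F G" "\<sigma> \<in> Hom (ftor_cat C D) G H"
    "\<rho> \<in> Hom (ftor_cat C D) H K"
  then show "Comp (ftor_cat C D) F H K \<rho> (Comp (ftor_cat C D) F G H \<sigma> \<tau>) =
    Comp (ftor_cat C D) F G K (Comp (ftor_cat C D) G H K \<rho> \<sigma>) \<tau>"
    using D by (auto simp: Comp_assoc ftor_ob nat_trans_in intro!: restrict_ext)
qed (use D in \<open>auto simp: nat_trans_Id nat_trans_Comp\<close>)

text \<open>The inverse family need not be assumed natural: composing the naturality square of
  \<open>\<tau>\<close> with the inverses on both sides gives the square for
  \<open>\<sigma>\<close>.\<close>

lemma isomorphic_in_ftor_cat:
  assumes D: "category D" and F: "is_ftor C D F" and G: "is_ftor C D G"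
    and \<tau>: "\<tau> \<in> nat_trans C D F G"
    and \<sigma>: "\<And>x. x \<in> Obj C \<Longrightarrow> \<sigma> x \<in> Hom D (on_ob G x) (on_ob F x)"
    and \<sigma>\<tau>: "\<And>x. x \<in> Obj C \<Longrightarrow>
      Comp D (on_ob F x) (on_ob G x) (on_ob F x) (\<sigma> x) (\<tau> x) = Id D (on_ob F x)"
    and \<tau>\<sigma>: "\<And>x. x \<in> Obj C \<Longrightarrow>
      Comp D (on_ob G x) (on_ob F x) (on_ob G x) (\<tau> x) (\<sigma> x) = Id D (on_ob G x)"
  shows "isomorphic_in (ftor_cat C D) F G"
proof -
  note [simp] = D ftor_ob[OF F] ftor_ob[OF G] ftor_hom[OF F] ftor_hom[OF G] nat_trans_in[OF \<tau>] \<sigma>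
  have "(\<lambda>x\<in>Obj C. \<sigma> x) \<in> nat_trans C D G F"
  proof (rule restrict_nat_transI)
    fix x y f assume *: "x \<in> Obj C" "y \<in> Obj C" "f \<in> Hom C x y"
    let ?c = "\<lambda>a b c. Comp D a b c"
    have "?c (on_ob G x) (on_ob G y) (on_ob F y) (\<sigma> y) (on_hom G x y f) =
      ?c (on_ob G x) (on_ob G y) (on_ob F y) (\<sigma> y) (?c (on_ob G x) (on_ob G x) (on_ob G y)
        (on_hom G x y f) (?c (on_ob G x) (on_ob F x) (on_ob G x) (\<tau> x) (\<sigma> x)))"
      using * by (simp add: \<tau>\<sigma>)
    also have "\<dots> = ?c (on_ob G x) (on_ob F x) (on_ob F y) (?c (on_ob F x) (on_ob G y) (on_ob F y) (\<sigma> y)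
        (?c (on_ob F x) (on_ob G x) (on_ob G y) (on_hom G x y f) (\<tau> x))) (\<sigma> x)"
      using * by (simp add: Comp_assoc)
    also have "\<dots> = ?c (on_ob G x) (on_ob F x) (on_ob F y) (?c (on_ob F x) (on_ob F y) (on_ob F y)
        (?c (on_ob F y) (on_ob G y) (on_ob F y) (\<sigma> y) (\<tau> y)) (on_hom F x y f)) (\<sigma> x)"
      unfolding nat_trans_natural[OF \<tau> *, symmetric] using * by (simp add: Comp_assoc del: \<sigma>\<tau>)
    finally show "?c (on_ob G x) (on_ob G y) (on_ob F y) (\<sigma> y) (on_hom G x y f) =
      ?c (on_ob G x) (on_ob F x) (on_ob F y) (on_hom F x y f) (\<sigma> x)"
      using * by (simp add: \<sigma>\<tau>)
  qed simp
  then show ?thesis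
    using \<tau> unfolding isomorphic_in_def
    by (intro bexI[of _ \<tau>] bexI[of _ "\<lambda>x\<in>Obj C. \<sigma> x"]) (auto simp: \<sigma>\<tau> \<tau>\<sigma> intro!: restrict_ext)
qed

lemma isomorphic_in_refl: "category C \<Longrightarrow> x \<in> Obj C \<Longrightarrow> isomorphic_in C x x"
  by (auto simp: isomorphic_in_def intro!: bexI[of _ "Id C x"])

section \<open>Equivalences as fully faithful and essentially surjective functors\<close>

definition fully_faithful :: "('o, 'm) cat \<Rightarrow> ('p, 'n) cat \<Rightarrow> ('o, 'm, 'p, 'n) ftor \<Rightarrow> bool" where
  "fully_faithful C D F \<longleftrightarrow> is_ftor C D F \<and>
     (\<forall>x\<in>Obj C. \<forall>y\<in>Obj C. bij_betw (on_hom F x y) (Hom C x y) (Hom D (on_ob F x) (on_ob F y)))"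

definition ess_surj :: "('o, 'm) cat \<Rightarrow> ('p, 'n) cat \<Rightarrow> ('o, 'm, 'p, 'n) ftor \<Rightarrow> bool" where
  "ess_surj C D F \<longleftrightarrow> (\<forall>d\<in>Obj D. \<exists>c\<in>Obj C. isomorphic_in D (on_ob F c) d)"

lemma fully_faithfulI:
  assumes F: "is_ftor C D F"
    and inj: "\<And>x y f g. x \<in> Obj C \<Longrightarrow> y \<in> Obj C \<Longrightarrow> f \<in> Hom C x y \<Longrightarrow> g \<in> Hom C x y \<Longrightarrow>
      on_hom F x y f = on_hom F x y g \<Longrightarrow> f = g"
    and surj: "\<And>x y g. x \<in> Obj C \<Longrightarrow> y \<in> Obj C \<Longrightarrow> g \<in> Hom D (on_ob F x) (on_ob F y) \<Longrightarrow>
      \<exists>f\<in>Hom C x y. on_hom F x y f = g"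
  shows "fully_faithful C D F"
  unfolding fully_faithful_def bij_betw_def
proof (intro conjI ballI F)
  fix x y assume *: "x \<in> Obj C" "y \<in> Obj C"
  show "inj_on (on_hom F x y) (Hom C x y)" by (rule inj_onI) (rule inj[OF *])
  show "on_hom F x y ` Hom C x y = Hom D (on_ob F x) (on_ob F y)"
    using ftor_hom[OF F *] surj[OF *] by blast
qed

lemma fully_faithful_ftor: "fully_faithful C D F \<Longrightarrow> is_ftor C D F"
  by (simp add: fully_faithful_def)

lemma fully_faithful_inj:
  "fully_faithful C D F \<Longrightarrow> x \<in> Obj C \<Longrightarrow> y \<in> Obj C \<Longrightarrow> f \<in> Hom C x y \<Longrightarrow> g \<in> Hom C x y \<Longrightarrow>
   on_hom F x y f = on_hom F x y g \<Longrightarrow> f = g"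
  unfolding fully_faithful_def bij_betw_def by (blast dest: inj_onD)

definition lift_hom ::
  "('o, 'm) cat \<Rightarrow> ('o, 'm, 'p, 'n) ftor \<Rightarrow> 'o \<Rightarrow> 'o \<Rightarrow> 'n \<Rightarrow> 'm" where
  "lift_hom C F x y = the_inv_into (Hom C x y) (on_hom F x y)"

lemma
  assumes "fully_faithful C D F" "x \<in> Obj C" "y \<in> Obj C" "g \<in> Hom D (on_ob F x) (on_ob F y)"
  shows lift_hom_in: "lift_hom C F x y g \<in> Hom C x y"
    and on_hom_lift_hom: "on_hom F x y (lift_hom C F x y g) = g"
proof -
  have b: "bij_betw (on_hom F x y) (Hom C x y) (Hom D (on_ob F x) (on_ob F y))"
    using assms by (auto simp: fully_faithful_def)
  then show "lift_hom C F x y g \<in> Hom C x y"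
    using assms(4) bij_betwE[OF bij_betw_the_inv_into[OF b]] by (simp add: lift_hom_def)
  show "on_hom F x y (lift_hom C F x y g) = g"
    unfolding lift_hom_def by (rule f_the_inv_into_f_bij_betw[OF b]) (rule assms(4))
qed

lemma fully_faithful_comp_ftor:
  assumes C: "category C" and F: "fully_faithful C D F" and G: "fully_faithful D E G"
  shows "fully_faithful C E (comp_ftor C G F)"
proof (rule fully_faithfulI)
  note F' = fully_faithful_ftor[OF F] and G' = fully_faithful_ftor[OF G]
  show "is_ftor C E (comp_ftor C G F)" by (rule is_ftor_comp_ftor[OF C F' G'])
next
  note F' = fully_faithful_ftor[OF F]
  fix x y f g assume *: "x \<in> Obj C" "y \<in> Obj C" "f \<in> Hom C x y" "g \<in> Hom C x y"
    "on_hom (comp_ftor C G F) x y f = on_hom (comp_ftor C G F) x y g"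
  then have "on_hom F x y f = on_hom F x y g"
    by (intro fully_faithful_inj[OF G, of "on_ob F x" "on_ob F y"])
      (simp_all add: ftor_ob[OF F'] ftor_hom[OF F'])
  then show "f = g" using * fully_faithful_inj[OF F] by blast
next
  note F' = fully_faithful_ftor[OF F]
  fix x y h assume *: "x \<in> Obj C" "y \<in> Obj C"
    "h \<in> Hom E (on_ob (comp_ftor C G F) x) (on_ob (comp_ftor C G F) y)"
  let ?g = "lift_hom D G (on_ob F x) (on_ob F y) h"
  have g: "?g \<in> Hom D (on_ob F x) (on_ob F y)" "on_hom G (on_ob F x) (on_ob F y) ?g = h"
    using * by (simp_all add: lift_hom_in[OF G] on_hom_lift_hom[OF G] ftor_ob[OF F'])
  show "\<exists>f\<in>Hom C x y. on_hom (comp_ftor C G F) x y f = h"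
    using * g by (intro bexI[of _ "lift_hom C F x y ?g"])
      (simp_all add: lift_hom_in[OF F] on_hom_lift_hom[OF F])
qed

lemma ftor_isomorphic_in:
  assumes C: "category C" and F: "is_ftor C D F" and "x \<in> Obj C" "y \<in> Obj C" "isomorphic_in C x y"
  shows "isomorphic_in D (on_ob F x) (on_ob F y)"
proof -
  obtain f g where "f \<in> Hom C x y" "g \<in> Hom C y x" "Comp C x y x g f = Id C x" "Comp C y x y f g = Id C y"
    using assms by (auto simp: isomorphic_in_def)
  then show ?thesis
    using assms unfolding isomorphic_in_def
    by (intro bexI[of _ "on_hom F x y f"] bexI[of _ "on_hom F y x g"])
      (simp_all add: ftor_hom[OF F] ftor_Id[OF F] flip: ftor_Comp[OF F])
qed

lemma isomorphic_in_trans: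
  assumes C: "category C" and "x \<in> Obj C" "y \<in> Obj C" "z \<in> Obj C"
    and xy: "isomorphic_in C x y" and yz: "isomorphic_in C y z"
  shows "isomorphic_in C x z"
proof -
  obtain f f' where f: "f \<in> Hom C x y" "f' \<in> Hom C y x" "Comp C x y x f' f = Id C x" "Comp C y x y f f' = Id C y"
    using xy by (auto simp: isomorphic_in_def)
  obtain g g' where g: "g \<in> Hom C y z" "g' \<in> Hom C z y" "Comp C y z y g' g = Id C y" "Comp C z y z g g' = Id C z"
    using yz by (auto simp: isomorphic_in_def)
  have "Comp C x y y (Comp C y z y g' g) f = f" "Comp C z y y (Comp C y x y f f') g' = g'"
    using assms f g by simp_all
  then have "Comp C x z y g' (Comp C x y z g f) = f" "Comp C z x y f (Comp C z y x f' g') = g'"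
    using assms f(1,2) g(1,2) by (simp_all add: Comp_assoc del: f g)
  then show ?thesis
    using assms f g unfolding isomorphic_in_def
    by (intro bexI[of _ "Comp C x y z g f"] bexI[of _ "Comp C z y x f' g'"])
      (simp_all add: Comp_assoc)
qed

lemma ess_surj_comp_ftor:
  assumes C: "category C" and D: "category D" and E: "category E"
    and F: "is_ftor C D F" "ess_surj C D F" and G: "is_ftor D E G" "ess_surj D E G"
  shows "ess_surj C E (comp_ftor C G F)"
  unfolding ess_surj_def
proof
  fix e assume e: "e \<in> Obj E"
  obtain d where d: "d \<in> Obj D" "isomorphic_in E (on_ob G d) e"
    using G(2) e by (auto simp: ess_surj_def)
  obtain c where c: "c \<in> Obj C" "isomorphic_in D (on_ob F c) d"
    using F(2) d(1) by (auto simp: ess_surj_def)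
  have "isomorphic_in E (on_ob G (on_ob F c)) (on_ob G d)"
    using c d ftor_isomorphic_in[OF D G(1)] by (simp add: ftor_ob[OF F(1)])
  then show "\<exists>c\<in>Obj C. isomorphic_in E (on_ob (comp_ftor C G F) c) e"
    using c d e isomorphic_in_trans[OF E, of "on_ob G (on_ob F c)" "on_ob G d" e]
    by (intro bexI[of _ c]) (simp_all add: ftor_ob[OF F(1)] ftor_ob[OF G(1)])
qed

text \<open>Every object \<open>d\<close> gets a chosen preimage \<open>c d\<close> with an
  isomorphism \<open>u d\<close> from its image to \<open>d\<close> and the inverse
  \<open>v d\<close>. On objects \<open>G\<close> is \<open>c\<close>; on morphisms it lifts the
  conjugate by these isomorphisms. Equations in \<open>C\<close> are checked after applying the
  faithful \<open>F\<close>. That \<open>G\<close> is fully faithful is recorded because the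
  representables are later carried back along it.\<close>

lemma fully_faithful_ess_surj_inverse:
  assumes C: "category C" and D: "category D" and F: "fully_faithful C D F" and es: "ess_surj C D F"
  obtains G where "fully_faithful D C G"
    "isomorphic_in (ftor_cat C C) (comp_ftor C G F) (id_ftor C)"
    "isomorphic_in (ftor_cat D D) (comp_ftor D F G) (id_ftor D)"
proof -
  note F' = fully_faithful_ftor[OF F]
  have "\<forall>d\<in>Obj D. \<exists>c u v. c \<in> Obj C \<and> u \<in> Hom D (on_ob F c) d \<and> v \<in> Hom D d (on_ob F c) \<and>
      Comp D (on_ob F c) d (on_ob F c) v u = Id D (on_ob F c) \<and> Comp D d (on_ob F c) d u v = Id D d"
    using es by (fastforce simp: ess_surj_def isomorphic_in_def)
  then obtain c u v where cuv: "\<And>d. d \<in> Obj D \<Longrightarrow> c d \<in> Obj C \<and> u d \<in> Hom D (on_ob F (c d)) d \<and>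
      v d \<in> Hom D d (on_ob F (c d)) \<and>
      Comp D (on_ob F (c d)) d (on_ob F (c d)) (v d) (u d) = Id D (on_ob F (c d)) \<and>
      Comp D d (on_ob F (c d)) d (u d) (v d) = Id D d"
    by metis
  define p where "p d = on_ob F (c d)" for d
  note [simp] = C D ftor_ob[OF F'] ftor_hom[OF F'] lift_hom_in[OF F] on_hom_lift_hom[OF F]
    ftor_Id[OF F'] ftor_Comp[OF F']
  have [simp]: "on_ob F (c d) = p d" for d by (simp add: p_def)
  have [simp]: "p d \<in> Obj D" if "d \<in> Obj D" for d
    unfolding p_def using cuv[OF that] ftor_ob[OF F'] by blast
  have [simp]: "c d \<in> Obj C" "u d \<in> Hom D (p d) d" "v d \<in> Hom D d (p d)"
    and vu [simp]: "Comp D (p d) d (p d) (v d) (u d) = Id D (p d)"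
    and uv [simp]: "Comp D d (p d) d (u d) (v d) = Id D d" if "d \<in> Obj D" for d
    using cuv[OF that] by simp_all
  \<comment> \<open>With composites nested to the right, this rule and \<open>uvc\<close> cancel
    adjacent inverse pairs inside longer composites, which is all that the functor laws for
    conjugation require.\<close>
  have vuc [simp]: "Comp D x d (p d) (v d) (Comp D x (p d) d (u d) k) = k"
    if "d \<in> Obj D" "x \<in> Obj D" "k \<in> Hom D x (p d)" for d x k
  proof -
    have "Comp D x (p d) (p d) (Comp D (p d) d (p d) (v d) (u d)) k = k" using that by simp
    then show ?thesis using that by (simp add: Comp_assoc del: vu)
  qed
  have uvc [simp]: "Comp D x (p d) d (u d) (Comp D x d (p d) (v d) k) = k"
    if "d \<in> Obj D" "x \<in> Obj D" "k \<in> Hom D x d" for d x k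
  proof -
    have "Comp D x d d (Comp D d (p d) d (u d) (v d)) k = k" using that by simp
    then show ?thesis using that by (simp add: Comp_assoc del: uv)
  qed
  define conj where "conj d d' m = Comp D (p d) d' (p d') (v d') (Comp D (p d) d d' m (u d))" for d d' m
  define h where "h d d' m = lift_hom C F (c d) (c d') (conj d d' m)" for d d' m
  have conj [simp]: "conj d d' m \<in> Hom D (p d) (p d')" if "d \<in> Obj D" "d' \<in> Obj D" "m \<in> Hom D d d'" for d d' m
    using that by (simp add: conj_def)
  have h [simp]: "h d d' m \<in> Hom C (c d) (c d')" "on_hom F (c d) (c d') (h d d' m) = conj d d' m"
    if "d \<in> Obj D" "d' \<in> Obj D" "m \<in> Hom D d d'" for d d' m
    using that by (simp_all add: h_def)
  have inj: "f = g" if "x \<in> Obj C" "y \<in> Obj C" "f \<in> Hom C x y" "g \<in> Hom C x y"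
    "on_hom F x y f = on_hom F x y g" for x y f g
    using fully_faithful_inj[OF F] that by blast
  define G where "G = mk_ftor D c h"
  have G: "is_ftor D C G"
    unfolding G_def
  proof (rule is_ftor_mk_ftor)
    fix x assume "x \<in> Obj D"
    then show "h x x (Id D x) = Id C (c x)"
      by (intro inj[of "c x" "c x"]) (simp_all add: conj_def)
  next
    fix x y z m n assume "x \<in> Obj D" "y \<in> Obj D" "z \<in> Obj D" "m \<in> Hom D x y" "n \<in> Hom D y z"
    then show "h x z (Comp D x y z n m) = Comp C (c x) (c y) (c z) (h y z n) (h x y m)"
      by (intro inj[of "c x" "c z"]) (simp_all add: conj_def Comp_assoc)
  qed simp_all
  have ff: "fully_faithful D C G"
  proof (rule fully_faithfulI[OF G])
    fix x y f g assume *: "x \<in> Obj D" "y \<in> Obj D" "f \<in> Hom D x y" "g \<in> Hom D x y"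
      "on_hom G x y f = on_hom G x y g"
    have "Comp D x (p y) y (u y) (Comp D x (p x) (p y) (conj x y m) (v x)) = m"
      if "m \<in> Hom D x y" for m
      using *(1,2) that by (simp add: conj_def Comp_assoc)
    moreover have "conj x y f = conj x y g" using * h(2) by (metis G_def mk_ftor_simps(2))
    ultimately show "f = g" using * by metis
  next
    fix x y g assume *: "x \<in> Obj D" "y \<in> Obj D" "g \<in> Hom C (on_ob G x) (on_ob G y)"
    then have g: "g \<in> Hom C (c x) (c y)" by (simp add: G_def)
    then have Fg [simp]: "on_hom F (c x) (c y) g \<in> Hom D (p x) (p y)"
      using ftor_hom[OF F', of "c x" "c y" g] * by simp
    \<comment> \<open>Conjugation in the opposite direction: \<open>conj x y ?m\<close> collapses to
      the image of \<open>g\<close> under \<open>F\<close>, so faithfulness gives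
      \<open>h x y ?m = g\<close>.\<close>
    let ?m = "Comp D x (p y) y (u y) (Comp D x (p x) (p y) (on_hom F (c x) (c y) g) (v x))"
    have "h x y ?m = g"
      by (rule inj[of "c x" "c y"]) (use * g in \<open>simp_all add: conj_def Comp_assoc\<close>)
    then show "\<exists>f\<in>Hom D x y. on_hom G x y f = g"
      using * by (intro bexI[of _ ?m]) (simp_all add: G_def)
  qed
  show ?thesis
  proof (rule that[OF ff])
    show "isomorphic_in (ftor_cat C C) (comp_ftor C G F) (id_ftor C)"
    proof (rule isomorphic_in_ftor_cat)
      \<comment> \<open>At \<open>x\<close> the isomorphism \<open>u\<close> for the object
        \<open>on_ob F x\<close> runs between two objects in the image of \<open>F\<close>, so it
        lifts to \<open>C\<close>; its inverse lifts in the same way.\<close>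
      let ?\<tau> = "\<lambda>x. lift_hom C F (c (on_ob F x)) x (u (on_ob F x))"
      show "(\<lambda>x\<in>Obj C. ?\<tau> x) \<in> nat_trans C C (comp_ftor C G F) (id_ftor C)"
      proof (rule restrict_nat_transI)
        fix x y f assume *: "x \<in> Obj C" "y \<in> Obj C" "f \<in> Hom C x y"
        then show "Comp C (on_ob (comp_ftor C G F) x) (on_ob (comp_ftor C G F) y) (on_ob (id_ftor C) y)
            (?\<tau> y) (on_hom (comp_ftor C G F) x y f) =
          Comp C (on_ob (comp_ftor C G F) x) (on_ob (id_ftor C) x) (on_ob (id_ftor C) y)
            (on_hom (id_ftor C) x y f) (?\<tau> x)"
          by (intro inj[of "c (on_ob F x)" y]) (simp_all add: G_def conj_def)
      qed (simp add: G_def)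
      fix x assume x: "x \<in> Obj C"
      let ?s = "lift_hom C F x (c (on_ob F x)) (v (on_ob F x))"
      show "?s \<in> Hom C (on_ob (id_ftor C) x) (on_ob (comp_ftor C G F) x)"
        using x by (simp add: G_def)
      show "Comp C (on_ob (comp_ftor C G F) x) (on_ob (id_ftor C) x) (on_ob (comp_ftor C G F) x)
          ?s ((\<lambda>x\<in>Obj C. ?\<tau> x) x) = Id C (on_ob (comp_ftor C G F) x)"
        using x by (intro inj[of "c (on_ob F x)" "c (on_ob F x)"]) (simp_all add: G_def)
      show "Comp C (on_ob (id_ftor C) x) (on_ob (comp_ftor C G F) x) (on_ob (id_ftor C) x)
          ((\<lambda>x\<in>Obj C. ?\<tau> x) x) ?s = Id C (on_ob (id_ftor C) x)"
        using x by (intro inj[of x x]) (simp_all add: G_def)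
    qed (simp_all add: is_ftor_comp_ftor[OF C F' G] is_ftor_id_ftor)
    show "isomorphic_in (ftor_cat D D) (comp_ftor D F G) (id_ftor D)"
    proof (rule isomorphic_in_ftor_cat[where \<sigma> = v])
      show "(\<lambda>x\<in>Obj D. u x) \<in> nat_trans D D (comp_ftor D F G) (id_ftor D)"
        by (rule restrict_nat_transI) (simp_all add: G_def conj_def)
    qed (simp_all add: is_ftor_comp_ftor[OF D G F'] is_ftor_id_ftor, simp_all add: G_def)
  qed
qed

lemma equivalent_catsI:
  assumes "category C" "category D" "fully_faithful C D F" "ess_surj C D F"
  shows "equivalent_cats C D"
  using fully_faithful_ess_surj_inverse[OF assms] assms
  unfolding equivalent_cats_def by (metis fully_faithful_ftor)

section \<open>Isomorphisms of categories: strict inverses, precomposition, opposites\<close>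

lemma fully_faithful_bij_inverse:
  assumes C: "category C" and F: "fully_faithful C D F" and b: "bij_betw (on_ob F) (Obj C) (Obj D)"
    and D: "category D"
  obtains G where "is_ftor D C G" "comp_ftor C G F = id_ftor C" "comp_ftor D F G = id_ftor D"
proof -
  note F' = fully_faithful_ftor[OF F]
  define g where "g = the_inv_into (Obj C) (on_ob F)"
  have g [simp]: "d \<in> Obj D \<Longrightarrow> g d \<in> Obj C" "d \<in> Obj D \<Longrightarrow> on_ob F (g d) = d"
    "x \<in> Obj C \<Longrightarrow> g (on_ob F x) = x" for d x
    using bij_betwE[OF bij_betw_the_inv_into[OF b]] f_the_inv_into_f_bij_betw[OF b]
      the_inv_into_f_f[OF bij_betw_imp_inj_on[OF b]] unfolding g_def by auto
  note [simp] = C D ftor_ob[OF F'] ftor_hom[OF F'] ftor_Id[OF F'] ftor_Comp[OF F']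
    lift_hom_in[OF F] on_hom_lift_hom[OF F]
  have inj: "f = g" if "x \<in> Obj C" "y \<in> Obj C" "f \<in> Hom C x y" "g \<in> Hom C x y"
    "on_hom F x y f = on_hom F x y g" for x y f g
    using fully_faithful_inj[OF F] that by blast
  define G where "G = mk_ftor D g (\<lambda>d d'. lift_hom C F (g d) (g d'))"
  have G: "is_ftor D C G"
    unfolding G_def
  proof (rule is_ftor_mk_ftor)
    fix x assume "x \<in> Obj D"
    then show "lift_hom C F (g x) (g x) (Id D x) = Id C (g x)"
      by (intro inj[of "g x" "g x"]) simp_all
  next
    fix x y z m n assume "x \<in> Obj D" "y \<in> Obj D" "z \<in> Obj D" "m \<in> Hom D x y" "n \<in> Hom D y z"
    then show "lift_hom C F (g x) (g z) (Comp D x y z n m) =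
        Comp C (g x) (g y) (g z) (lift_hom C F (g y) (g z) n) (lift_hom C F (g x) (g y) m)"
      by (intro inj[of "g x" "g z"]) simp_all
  qed simp_all
  show ?thesis
  proof (rule that[OF G])
    show "comp_ftor C G F = id_ftor C"
    proof (rule ftor_eqI[OF is_ftor_comp_ftor[OF C F' G] is_ftor_id_ftor[OF C]])
      fix x y f assume "x \<in> Obj C" "y \<in> Obj C" "f \<in> Hom C x y"
      then show "on_hom (comp_ftor C G F) x y f = on_hom (id_ftor C) x y f"
        by (intro inj[of x y]) (simp_all add: G_def)
    qed (simp add: G_def)
    show "comp_ftor D F G = id_ftor D"
      by (rule ftor_eqI[OF is_ftor_comp_ftor[OF D G F'] is_ftor_id_ftor[OF D]]) (simp_all add: G_def)
  qed
qed

text \<open>Precomposition with \<open>K\<close> is inverted by precomposition with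
  \<open>L\<close>. It is packaged as a fully faithful and essentially surjective functor so that it
  can be composed with the comparison functor from simplicial lists to presheaves.\<close>

lemma precomp_iso:
  assumes B: "category B" and A: "category A" and E: "category E"
    and K: "is_ftor B A K" and L: "is_ftor A B L" and KL: "comp_ftor A K L = id_ftor A"
    and LK: "comp_ftor B L K = id_ftor B"
  obtains R where "fully_faithful (ftor_cat A E) (ftor_cat B E) R" "ess_surj (ftor_cat A E) (ftor_cat B E) R"
proof -
  have KLo [simp]: "on_ob K (on_ob L a) = a" if "a \<in> Obj A" for a
    using that arg_cong[OF KL, of "\<lambda>F. on_ob F a"] by simp
  have LKo [simp]: "on_ob L (on_ob K a) = a" if "a \<in> Obj B" for a
    using that arg_cong[OF LK, of "\<lambda>F. on_ob F a"] by simp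
  have KLh [simp]: "on_hom K (on_ob L a) (on_ob L a') (on_hom L a a' f) = f"
    if "a \<in> Obj A" "a' \<in> Obj A" "f \<in> Hom A a a'" for a a' f
    using that arg_cong[OF KL, of "\<lambda>F. on_hom F a a' f"] by simp
  have LKh [simp]: "on_hom L (on_ob K a) (on_ob K a') (on_hom K a a' f) = f"
    if "a \<in> Obj B" "a' \<in> Obj B" "f \<in> Hom B a a'" for a a' f
    using that arg_cong[OF LK, of "\<lambda>F. on_hom F a a' f"] by simp
  note [simp] = A B ftor_ob[OF K] ftor_ob[OF L] ftor_hom[OF K] ftor_hom[OF L]
  define R where "R = mk_ftor (ftor_cat A E) (\<lambda>F. comp_ftor B F K) (\<lambda>F G \<tau>. \<lambda>x\<in>Obj B. \<tau> (on_ob K x))"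
  have *: "(\<lambda>x\<in>Obj B. \<tau> (on_ob K x)) \<in> nat_trans B E (comp_ftor B F K) (comp_ftor B G K)"
    if "\<tau> \<in> nat_trans A E F G" for F G \<tau>
    by (rule restrict_nat_transI) (simp_all add: nat_trans_in[OF that] nat_trans_natural[OF that])
  have R: "is_ftor (ftor_cat A E) (ftor_cat B E) R"
    unfolding R_def
    by (rule is_ftor_mk_ftor[OF category_ftor_cat[OF E]])
      (auto simp: is_ftor_comp_ftor[OF B K] * intro!: restrict_ext)
  show ?thesis
  proof (rule that)
    show "fully_faithful (ftor_cat A E) (ftor_cat B E) R"
    proof (rule fully_faithfulI[OF R])
      fix F G \<sigma> \<tau> assume h: "F \<in> Obj (ftor_cat A E)" "G \<in> Obj (ftor_cat A E)" "\<sigma> \<in> Hom (ftor_cat A E) F G"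
        "\<tau> \<in> Hom (ftor_cat A E) F G" "on_hom R F G \<sigma> = on_hom R F G \<tau>"
      have eq: "(\<lambda>x\<in>Obj B. \<sigma> (on_ob K x)) = (\<lambda>x\<in>Obj B. \<tau> (on_ob K x))"
        using h by (simp add: R_def)
      have "\<sigma> a = \<tau> a" if "a \<in> Obj A" for a
        using fun_cong[OF eq, of "on_ob L a"] that by simp
      then show "\<sigma> = \<tau>" using h by (auto intro: nat_trans_eqI)
    next
      fix F G \<sigma> assume h: "F \<in> Obj (ftor_cat A E)" "G \<in> Obj (ftor_cat A E)"
        "\<sigma> \<in> Hom (ftor_cat B E) (on_ob R F) (on_ob R G)"
      then have \<sigma>: "\<sigma> \<in> nat_trans B E (comp_ftor B F K) (comp_ftor B G K)" by (simp add: R_def)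
      let ?\<tau> = "\<lambda>a\<in>Obj A. \<sigma> (on_ob L a)"
      have \<tau>: "?\<tau> \<in> nat_trans A E F G"
      proof (rule restrict_nat_transI)
        fix x assume "x \<in> Obj A"
        then show "\<sigma> (on_ob L x) \<in> Hom E (on_ob F x) (on_ob G x)"
          using nat_trans_in[OF \<sigma>, of "on_ob L x"] by simp
      next
        fix x y f assume "x \<in> Obj A" "y \<in> Obj A" "f \<in> Hom A x y"
        then show "Comp E (on_ob F x) (on_ob F y) (on_ob G y) (\<sigma> (on_ob L y)) (on_hom F x y f) =
          Comp E (on_ob F x) (on_ob G x) (on_ob G y) (on_hom G x y f) (\<sigma> (on_ob L x))"
          using nat_trans_natural[OF \<sigma>, of "on_ob L x" "on_ob L y" "on_hom L x y f"] by simp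
      qed
      moreover have "(\<lambda>x\<in>Obj B. ?\<tau> (on_ob K x)) = \<sigma>"
        by (rule nat_trans_eqI[OF *[OF \<tau>] \<sigma>]) simp
      ultimately show "\<exists>\<tau>\<in>Hom (ftor_cat A E) F G. on_hom R F G \<tau> = \<sigma>"
        using h by (intro bexI[of _ ?\<tau>]) (simp_all add: R_def)
    qed
    show "ess_surj (ftor_cat A E) (ftor_cat B E) R"
      unfolding ess_surj_def
    proof
      fix F assume F: "F \<in> Obj (ftor_cat B E)"
      then have F': "is_ftor B E F" by simp
      have "comp_ftor B (comp_ftor A F L) K = F"
        by (rule ftor_eqI[OF is_ftor_comp_ftor[OF B K is_ftor_comp_ftor[OF A L F']] F']) simp_all
      then show "\<exists>G\<in>Obj (ftor_cat A E). isomorphic_in (ftor_cat B E) (on_ob R G) F"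
        using is_ftor_comp_ftor[OF A L F'] isomorphic_in_refl[OF category_ftor_cat[OF E] F]
        by (intro bexI[of _ "comp_ftor A F L"]) (simp_all add: R_def)
    qed
  qed
qed

definition op_ftor :: "('o, 'm) cat \<Rightarrow> ('o, 'm, 'p, 'n) ftor \<Rightarrow> ('o, 'm, 'p, 'n) ftor" where
  "op_ftor C F = mk_ftor (op_cat C) (on_ob F) (\<lambda>x y. on_hom F y x)"

lemma is_ftor_op_ftor:
  assumes "category C" "is_ftor C D F"
  shows "is_ftor (op_cat C) (op_cat D) (op_ftor C F)"
  unfolding op_ftor_def
  by (rule is_ftor_mk_ftor[OF category_op_cat[OF assms(1)]])
    (use assms(2) in \<open>simp_all add: ftor_ob[OF assms(2)] ftor_hom[OF assms(2)] ftor_Id[OF assms(2)] ftor_Comp[OF assms(2)]\<close>)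

lemma op_ftor_inverse:
  assumes C: "category C" and F: "is_ftor C D F" and G: "is_ftor D C G" and GF: "comp_ftor C G F = id_ftor C"
    and D: "category D"
  shows "comp_ftor (op_cat C) (op_ftor D G) (op_ftor C F) = id_ftor (op_cat C)"
proof (rule ftor_eqI)
  show "is_ftor (op_cat C) (op_cat C) (comp_ftor (op_cat C) (op_ftor D G) (op_ftor C F))"
    by (rule is_ftor_comp_ftor[OF category_op_cat[OF C] is_ftor_op_ftor[OF C F] is_ftor_op_ftor[OF D G]])
  show "is_ftor (op_cat C) (op_cat C) (id_ftor (op_cat C))"
    by (rule is_ftor_id_ftor[OF category_op_cat[OF C]])
next
  fix x assume "x \<in> Obj (op_cat C)"
  then show "on_ob (comp_ftor (op_cat C) (op_ftor D G) (op_ftor C F)) x = on_ob (id_ftor (op_cat C)) x"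
    using arg_cong[OF GF, of "\<lambda>F. on_ob F x"] by (simp add: op_ftor_def ftor_ob[OF F])
next
  fix x y f assume "x \<in> Obj (op_cat C)" "y \<in> Obj (op_cat C)" "f \<in> Hom (op_cat C) x y"
  then show "on_hom (comp_ftor (op_cat C) (op_ftor D G) (op_ftor C F)) x y f = on_hom (id_ftor (op_cat C)) x y f"
    using arg_cong[OF GF, of "\<lambda>F. on_hom F y x f"]
    by (simp add: op_ftor_def ftor_ob[OF F] ftor_hom[OF F])
qed

section \<open>Presheaves and the Yoneda embedding\<close>

lemma set_cat_simps [simp]:
  "Obj (set_cat U) = U" "Hom (set_cat U) A B = (A \<rightarrow>\<^sub>E B)" "Id (set_cat U) A = (\<lambda>a\<in>A. a)"
  "Comp (set_cat U) A B C g f = compose A g f"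
  by (simp_all add: set_cat_def)

lemma category_set_cat: "category (set_cat U)"
  unfolding category_def by (auto simp: compose_def intro!: ext dest: PiE_arb)

lemma full_subcat_simps [simp]:
  "Obj (full_subcat C S) = S" "Hom (full_subcat C S) = Hom C" "Id (full_subcat C S) = Id C"
  "Comp (full_subcat C S) = Comp C"
  by (simp_all add: full_subcat_def)

text \<open>
  Presheaves take values in subsets of \<open>'u\<close>, so a representable presheaf consists of codes of
  morphisms.
\<close>

locale coded_cat =
  fixes A :: "('o, 'm) cat" and U :: "'u set set" and code :: "'m \<Rightarrow> 'u"
  assumes A: "category A"
    and inj_code: "inj_on code (\<Union>x\<in>Obj A. \<Union>y\<in>Obj A. Hom A x y)"
    and code_in: "\<And>x y. x \<in> Obj A \<Longrightarrow> y \<in> Obj A \<Longrightarrow> code ` Hom A x y \<in> U"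
begin

definition decode :: "'u \<Rightarrow> 'm" where
  "decode = the_inv_into (\<Union>x\<in>Obj A. \<Union>y\<in>Obj A. Hom A x y) code"

lemma decode_code [simp]: "x \<in> Obj A \<Longrightarrow> y \<in> Obj A \<Longrightarrow> f \<in> Hom A x y \<Longrightarrow> decode (code f) = f"
  unfolding decode_def by (rule the_inv_into_f_f[OF inj_code]) blast

lemma code_eq:
  "g \<in> Hom A x y \<Longrightarrow> x \<in> Obj A \<Longrightarrow> y \<in> Obj A \<Longrightarrow> f \<in> Hom A x y \<Longrightarrow> code f = code g \<longleftrightarrow> f = g"
  using decode_code by metis

definition representable :: "'o \<Rightarrow> ('o, 'm, 'u set, 'u \<Rightarrow> 'u) ftor" where
  "representable b = mk_ftor (op_cat A) (\<lambda>a. code ` Hom A a b)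
     (\<lambda>a a' f. \<lambda>x\<in>code ` Hom A a b. code (Comp A a' a b (decode x) f))"

lemma is_ftor_representable:
  assumes b: "b \<in> Obj A"
  shows "is_ftor (op_cat A) (set_cat U) (representable b)"
  unfolding representable_def
  by (rule is_ftor_mk_ftor[OF category_op_cat[OF A]])
    (use b in \<open>auto simp: A code_in code_eq Comp_assoc compose_def intro!: ext\<close>)

definition yoneda :: "('o, 'm, ('o, 'm, 'u set, 'u \<Rightarrow> 'u) ftor, 'o \<Rightarrow> 'u \<Rightarrow> 'u) ftor" where
  "yoneda = mk_ftor A representable
     (\<lambda>b b' g. \<lambda>a\<in>Obj A. \<lambda>x\<in>code ` Hom A a b. code (Comp A a b b' g (decode x)))"

lemma is_ftor_yoneda: "is_ftor A (ftor_cat (op_cat A) (set_cat U)) yoneda"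
  unfolding yoneda_def
proof (rule is_ftor_mk_ftor[OF A])
  fix b b' g assume *: "b \<in> Obj A" "b' \<in> Obj A" "g \<in> Hom A b b'"
  have "(\<lambda>a\<in>Obj (op_cat A). \<lambda>x\<in>code ` Hom A a b. code (Comp A a b b' g (decode x)))
    \<in> nat_trans (op_cat A) (set_cat U) (representable b) (representable b')"
    by (rule restrict_nat_transI)
      (use * in \<open>auto simp: A representable_def code_eq Comp_assoc compose_def intro!: ext\<close>)
  then show "(\<lambda>a\<in>Obj A. \<lambda>x\<in>code ` Hom A a b. code (Comp A a b b' g (decode x)))
    \<in> Hom (ftor_cat (op_cat A) (set_cat U)) (representable b) (representable b')"
    by simp
next
  show "representable b \<in> Obj (ftor_cat (op_cat A) (set_cat U))" if "b \<in> Obj A" for b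
    using that by (simp add: is_ftor_representable)
qed (auto simp: A representable_def code_eq Comp_assoc compose_def intro!: ext)

text \<open>The Yoneda argument: a transformation out of \<open>representable b\<close> is
  determined by its value at the identity of \<open>b\<close>, and that value is the code of the
  morphism inducing it.\<close>

lemma fully_faithful_yoneda: "fully_faithful A (ftor_cat (op_cat A) (set_cat U)) yoneda"
proof (rule fully_faithfulI[OF is_ftor_yoneda])
  fix b b' f g assume *: "b \<in> Obj A" "b' \<in> Obj A" "f \<in> Hom A b b'" "g \<in> Hom A b b'"
    "on_hom yoneda b b' f = on_hom yoneda b b' g"
  then have "on_hom yoneda b b' f b (code (Id A b)) = on_hom yoneda b b' g b (code (Id A b))" by simp
  then have "code f = code g" using *(1-4) by (simp add: yoneda_def A)
  then show "f = g" using * decode_code by metis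
next
  fix b b' \<tau> assume b: "b \<in> Obj A" "b' \<in> Obj A"
    and "\<tau> \<in> Hom (ftor_cat (op_cat A) (set_cat U)) (on_ob yoneda b) (on_ob yoneda b')"
  then have \<tau>: "\<tau> \<in> nat_trans (op_cat A) (set_cat U) (representable b) (representable b')"
    by (simp add: yoneda_def)
  have \<tau>in: "\<tau> a \<in> code ` Hom A a b \<rightarrow>\<^sub>E code ` Hom A a b'" if "a \<in> Obj A" for a
    using nat_trans_in[OF \<tau>, of a] that by (simp add: representable_def)
  have "\<tau> b (code (Id A b)) \<in> code ` Hom A b b'"
    by (rule PiE_mem[OF \<tau>in]) (use b A in auto)
  then obtain g where g: "g \<in> Hom A b b'" "\<tau> b (code (Id A b)) = code g" by blast
  have "on_hom yoneda b b' g = \<tau>"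
  proof (rule nat_trans_eqI)
    show "on_hom yoneda b b' g \<in> nat_trans (op_cat A) (set_cat U) (representable b) (representable b')"
      using ftor_hom[OF is_ftor_yoneda b g(1)] b by (simp add: yoneda_def)
    show "\<tau> \<in> nat_trans (op_cat A) (set_cat U) (representable b) (representable b')" by (rule \<tau>)
    fix a assume "a \<in> Obj (op_cat A)"
    then have a: "a \<in> Obj A" by simp
    have "\<tau> a (code f) = code (Comp A a b b' g f)" if f: "f \<in> Hom A a b" for f
    proof -
      have "compose (code ` Hom A b b) (\<tau> a) (\<lambda>x\<in>code ` Hom A b b. code (Comp A a b b (decode x) f)) =
        compose (code ` Hom A b b) (\<lambda>x\<in>code ` Hom A b b'. code (Comp A a b b' (decode x) f)) (\<tau> b)"
        using nat_trans_natural[OF \<tau>, of b a f] a b f by (simp add: representable_def)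
      from fun_cong[OF this, of "code (Id A b)"] show ?thesis
        using a b f g A by (simp add: compose_def)
    qed
    then show "on_hom yoneda b b' g a = \<tau> a"
      using a b g(1) PiE_arb[OF \<tau>in[OF a]] by (auto simp: yoneda_def intro!: ext)
  qed
  then show "\<exists>g\<in>Hom A b b'. on_hom yoneda b b' g = \<tau>" using g by blast
qed

end

text \<open>
  The set \<open>S\<close> consists of chosen preimages of the representables. Since \<open>A\<close> is skeletal, different
  objects of \<open>A\<close> have different preimages.
\<close>

lemma presheaf_category_via_subcat:
  assumes C: "category C" and "coded_cat A U code"
    and \<Phi>: "fully_faithful C (ftor_cat (op_cat A) (set_cat U)) \<Phi>"
      "ess_surj C (ftor_cat (op_cat A) (set_cat U)) \<Phi>"
    and skel: "\<And>a b. a \<in> Obj A \<Longrightarrow> b \<in> Obj A \<Longrightarrow> isomorphic_in A a b \<Longrightarrow> a = b"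
  shows "\<exists>S \<subseteq> Obj C. equivalent_cats C (ftor_cat (op_cat (full_subcat C S)) (set_cat U)) \<and>
           isomorphic_cats (full_subcat C S) A"
proof -
  interpret coded_cat A U code by fact
  let ?P = "ftor_cat (op_cat A) (set_cat U)"
  have P: "category ?P" by (rule category_ftor_cat[OF category_set_cat])
  \<comment> \<open>Following the Yoneda embedding by this inverse embeds \<open>A\<close> fully
    faithfully into \<open>C\<close>.\<close>
  obtain G where G: "fully_faithful ?P C G" by (rule fully_faithful_ess_surj_inverse[OF C P \<Phi>])
  define T where "T = comp_ftor A G yoneda"
  have T: "fully_faithful A C T"
    unfolding T_def by (rule fully_faithful_comp_ftor[OF A fully_faithful_yoneda G])
  note T' = fully_faithful_ftor[OF T]
  define S where "S = on_ob T ` Obj A"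
  have S: "S \<subseteq> Obj C" unfolding S_def using ftor_ob[OF T'] by blast
  \<comment> \<open>If two objects have the same image, the identity of that image lifts in both
    directions, and faithfulness makes the two lifts inverse to each other.\<close>
  have "a = b" if ab: "a \<in> Obj A" "b \<in> Obj A" "on_ob T a = on_ob T b" for a b
  proof (rule skel[OF ab(1,2)])
    let ?i = "Id C (on_ob T a)"
    have i: "?i \<in> Hom C (on_ob T a) (on_ob T b)" "?i \<in> Hom C (on_ob T b) (on_ob T a)"
      using ab C ftor_ob[OF T'] by auto
    note [simp] = A C ftor_ob[OF T'] ftor_Comp[OF T'] ftor_Id[OF T'] lift_hom_in[OF T] on_hom_lift_hom[OF T]
    show "isomorphic_in A a b"
      unfolding isomorphic_in_def
    proof (intro bexI conjI)
      show "Comp A a b a (lift_hom A T b a ?i) (lift_hom A T a b ?i) = Id A a"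
        by (rule fully_faithful_inj[OF T, of a a]) (use ab i in simp_all)
      show "Comp A b a b (lift_hom A T a b ?i) (lift_hom A T b a ?i) = Id A b"
        by (rule fully_faithful_inj[OF T, of b b]) (use ab i in simp_all)
    qed (use ab i in simp_all)
  qed
  then have inj: "inj_on (on_ob T) (Obj A)" by (rule inj_onI)
  let ?B = "full_subcat C S"
  have B: "category ?B" by (rule category_full_subcat[OF C S])
  have TB: "fully_faithful A ?B T"
    using T unfolding fully_faithful_def is_ftor_def by (auto simp: S_def)
  obtain K where K: "is_ftor ?B A K" "comp_ftor A K T = id_ftor A" "comp_ftor ?B T K = id_ftor ?B"
    by (rule fully_faithful_bij_inverse[OF A TB _ B]) (use inj in \<open>simp_all add: bij_betw_def S_def\<close>)
  note T'' = fully_faithful_ftor[OF TB]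
  \<comment> \<open>Precomposition with the opposite of \<open>K\<close>, which runs from
    \<open>?B\<close> to \<open>A\<close>, turns presheaves on \<open>A\<close> into presheaves on
    \<open>?B\<close>.\<close>
  obtain R where R: "fully_faithful ?P (ftor_cat (op_cat ?B) (set_cat U)) R"
    "ess_surj ?P (ftor_cat (op_cat ?B) (set_cat U)) R"
    by (rule precomp_iso[OF category_op_cat[OF B] category_op_cat[OF A] category_set_cat
          is_ftor_op_ftor[OF B K(1)] is_ftor_op_ftor[OF A T''] op_ftor_inverse[OF A T'' K(1,2) B]
          op_ftor_inverse[OF B K(1) T'' K(3) A]])
  have PB: "category (ftor_cat (op_cat ?B) (set_cat U))" by (rule category_ftor_cat[OF category_set_cat])
  have "equivalent_cats C (ftor_cat (op_cat ?B) (set_cat U))"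
    by (rule equivalent_catsI[OF C PB fully_faithful_comp_ftor[OF C \<Phi>(1) R(1)]
          ess_surj_comp_ftor[OF C P PB fully_faithful_ftor[OF \<Phi>(1)] \<Phi>(2) fully_faithful_ftor[OF R(1)] R(2)]])
  moreover have "isomorphic_cats ?B A"
    unfolding isomorphic_cats_def using B A K T'' by blast
  ultimately show ?thesis using S by blast
qed

section \<open>The category of rooted simplices\<close>

lemma Delta_simps [simp]:
  "Obj Delta = UNIV" "Id Delta n = (\<lambda>i\<in>{..n}. i)" "Comp Delta l m n \<theta> \<eta> = compose {..l} \<theta> \<eta>"
  by (simp_all add: Delta_def)

lemma Delta_Hom: "\<theta> \<in> Hom Delta k n \<longleftrightarrow> \<theta> \<in> {..k} \<rightarrow>\<^sub>E {..n} \<and> mono_on {..k} \<theta>"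
  by (simp add: Delta_def)

lemma Delta_HomI:
  assumes "\<And>i. i \<le> k \<Longrightarrow> f i \<le> n" "\<And>i j. i \<le> j \<Longrightarrow> j \<le> k \<Longrightarrow> f i \<le> f j"
  shows "(\<lambda>i\<in>{..k}. f i) \<in> Hom Delta k n"
  using assms by (auto simp: Delta_Hom mono_on_def)

lemma Delta_le: "\<theta> \<in> Hom Delta k n \<Longrightarrow> i \<le> k \<Longrightarrow> \<theta> i \<le> n"
  by (auto simp: Delta_Hom)

lemma Delta_mono: "\<theta> \<in> Hom Delta k n \<Longrightarrow> i \<le> j \<Longrightarrow> j \<le> k \<Longrightarrow> \<theta> i \<le> \<theta> j"
  by (auto simp: Delta_Hom mono_on_def)

lemma Delta_compose: "\<theta> \<in> Hom Delta k n \<Longrightarrow> \<eta> \<in> Hom Delta l k \<Longrightarrow> compose {..l} \<theta> \<eta> \<in> Hom Delta l n"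
  unfolding compose_def by (rule Delta_HomI) (simp_all add: Delta_le Delta_mono)

lemma compose_apply [simp]: "i \<le> l \<Longrightarrow> compose {..l} \<theta> \<eta> i = \<theta> (\<eta> i)"
  by (simp add: compose_def)

lemma compose_compose: "compose {..l} (compose {..k} \<zeta> \<theta>) \<eta> = compose {..l} \<zeta> (compose {..l} \<theta> \<eta>)"
  if "\<eta> \<in> Hom Delta l k"
  by (auto simp: compose_def Delta_le[OF that] intro!: restrict_ext)

lemma Delta_eqI: "\<theta> \<in> Hom Delta k n \<Longrightarrow> \<theta>' \<in> Hom Delta k n' \<Longrightarrow> (\<And>i. i \<le> k \<Longrightarrow> \<theta> i = \<theta>' i) \<Longrightarrow> \<theta> = \<theta>'"
  by (rule extensionalityI[of _ "{..k}"]) (auto simp: Delta_Hom PiE_def)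

lemma Delta_Id: "(\<lambda>i\<in>{..n}. i) \<in> Hom Delta n n"
  by (rule Delta_HomI) simp_all

lemma category_Delta: "category Delta"
  unfolding category_def
proof (intro conjI ballI)
  fix k n \<theta> assume \<theta>: "\<theta> \<in> Hom Delta k n"
  show "Comp Delta k k n \<theta> (Id Delta k) = \<theta>" "Comp Delta k n n (Id Delta n) \<theta> = \<theta>"
    using Delta_compose[OF \<theta> Delta_Id] Delta_compose[OF Delta_Id \<theta>] \<theta>
    by (auto intro!: Delta_eqI[of _ k n _ n] simp: compose_def Delta_le)
qed (simp_all add: Delta_Id Delta_compose compose_compose)

section \<open>Chains, their pullbacks and their restrictions to fibres\<close>

lemma ordinal_cat_simps [simp]:
  "Obj (ordinal_cat n) = {..n}" "Id (ordinal_cat n) i = ()" "Comp (ordinal_cat n) i j k g f = ()"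
  "u \<in> Hom (ordinal_cat n) i j \<longleftrightarrow> i \<le> j"
  by (simp_all add: ordinal_cat_def)

lemma nerve_hom:
  assumes "\<gamma> \<in> nerve_Delta_plus n" "i \<le> j" "j \<le> n"
  shows "transition \<gamma> i j \<in> {..<on_ob \<gamma> i} \<rightarrow>\<^sub>E {..<on_ob \<gamma> j}" "mono_on {..<on_ob \<gamma> i} (transition \<gamma> i j)"
proof -
  have "is_ftor (ordinal_cat n) Delta_plus \<gamma>" using assms(1) by (simp add: nerve_Delta_plus_def)
  from ftor_hom[OF this, of i j "()"] assms(2,3)
  show "transition \<gamma> i j \<in> {..<on_ob \<gamma> i} \<rightarrow>\<^sub>E {..<on_ob \<gamma> j}" "mono_on {..<on_ob \<gamma> i} (transition \<gamma> i j)"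
    by (simp_all add: Delta_plus_def)
qed

lemma nerve_less:
  "\<gamma> \<in> nerve_Delta_plus n \<Longrightarrow> i \<le> j \<Longrightarrow> j \<le> n \<Longrightarrow> x < on_ob \<gamma> i \<Longrightarrow> transition \<gamma> i j x < on_ob \<gamma> j"
  using PiE_mem[OF nerve_hom(1), of \<gamma> n i j x] by simp

lemma nerve_mono:
  "\<gamma> \<in> nerve_Delta_plus n \<Longrightarrow> i \<le> j \<Longrightarrow> j \<le> n \<Longrightarrow> x \<le> y \<Longrightarrow> y < on_ob \<gamma> i \<Longrightarrow>
   transition \<gamma> i j x \<le> transition \<gamma> i j y"
  using nerve_hom(2)[of \<gamma> n i j] by (simp add: mono_on_def)

lemma nerve_refl:
  assumes "\<gamma> \<in> nerve_Delta_plus n" "i \<le> n" "x < on_ob \<gamma> i"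
  shows "transition \<gamma> i i x = x"
proof -
  have "is_ftor (ordinal_cat n) Delta_plus \<gamma>" using assms(1) by (simp add: nerve_Delta_plus_def)
  from ftor_Id[OF this, of i] show ?thesis
    using assms(2,3) by (simp add: Delta_plus_def)
qed

lemma nerve_trans:
  assumes "\<gamma> \<in> nerve_Delta_plus n" "i \<le> j" "j \<le> k" "k \<le> n" "x < on_ob \<gamma> i"
  shows "transition \<gamma> j k (transition \<gamma> i j x) = transition \<gamma> i k x"
proof -
  have "is_ftor (ordinal_cat n) Delta_plus \<gamma>" using assms(1) by (simp add: nerve_Delta_plus_def)
  from ftor_Comp[OF this, of i j k "()" "()"] show ?thesis
    using assms(2-) by (simp add: Delta_plus_def compose_def)
qed

lemma chain_eqI:
  assumes "\<gamma> \<in> nerve_Delta_plus n" "\<delta> \<in> nerve_Delta_plus n"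
    and ob: "\<And>i. i \<le> n \<Longrightarrow> on_ob \<gamma> i = on_ob \<delta> i"
    and tr: "\<And>i j x. i \<le> j \<Longrightarrow> j \<le> n \<Longrightarrow> x < on_ob \<gamma> i \<Longrightarrow> transition \<gamma> i j x = transition \<delta> i j x"
  shows "\<gamma> = \<delta>"
proof (rule ftor_eqI)
  show "is_ftor (ordinal_cat n) Delta_plus \<gamma>" "is_ftor (ordinal_cat n) Delta_plus \<delta>"
    using assms(1,2) by (simp_all add: nerve_Delta_plus_def)
  fix i assume "i \<in> Obj (ordinal_cat n)"
  then show "on_ob \<gamma> i = on_ob \<delta> i" using ob by simp
next
  fix i j u assume "i \<in> Obj (ordinal_cat n)" "j \<in> Obj (ordinal_cat n)" "u \<in> Hom (ordinal_cat n) i j"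
  then have ij: "i \<le> j" "j \<le> n" by auto
  have "transition \<gamma> i j = transition \<delta> i j"
    using nerve_hom(1)[OF assms(1) ij] nerve_hom(1)[OF assms(2) ij] tr[OF ij] ob ij
    by (intro extensionalityI[of _ "{..<on_ob \<gamma> i}"]) (auto simp: PiE_def)
  then show "on_hom \<gamma> i j u = on_hom \<delta> i j u" by simp
qed

definition mk_chain :: "nat \<Rightarrow> (nat \<Rightarrow> nat) \<Rightarrow> (nat \<Rightarrow> nat \<Rightarrow> nat \<Rightarrow> nat) \<Rightarrow> chain" where
  "mk_chain n N f = mk_ftor (ordinal_cat n) N (\<lambda>i j u. \<lambda>x\<in>{..<N i}. f i j x)"

lemma category_ordinal_cat: "category (ordinal_cat n)"
  by (auto simp: category_def ordinal_cat_def)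

lemma mk_chain_simps [simp]:
  "i \<le> n \<Longrightarrow> on_ob (mk_chain n N f) i = N i"
  "i \<le> j \<Longrightarrow> j \<le> n \<Longrightarrow> x < N i \<Longrightarrow> transition (mk_chain n N f) i j x = f i j x"
  by (simp_all add: mk_chain_def mk_ftor_def ordinal_cat_def)

lemma mk_chain_nerve:
  assumes "\<And>i j x. i \<le> j \<Longrightarrow> j \<le> n \<Longrightarrow> x < N i \<Longrightarrow> f i j x < N j"
    and "\<And>i j x y. i \<le> j \<Longrightarrow> j \<le> n \<Longrightarrow> x \<le> y \<Longrightarrow> y < N i \<Longrightarrow> f i j x \<le> f i j y"
    and "\<And>i x. i \<le> n \<Longrightarrow> x < N i \<Longrightarrow> f i i x = x"
    and "\<And>i j k x. i \<le> j \<Longrightarrow> j \<le> k \<Longrightarrow> k \<le> n \<Longrightarrow> x < N i \<Longrightarrow> f j k (f i j x) = f i k x"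
  shows "mk_chain n N f \<in> nerve_Delta_plus n"
  unfolding nerve_Delta_plus_def mk_chain_def mem_Collect_eq
proof (rule is_ftor_mk_ftor[OF category_ordinal_cat])
  fix i j u assume "i \<in> Obj (ordinal_cat n)" "j \<in> Obj (ordinal_cat n)" "u \<in> Hom (ordinal_cat n) i j"
  then show "(\<lambda>x\<in>{..<N i}. f i j x) \<in> Hom Delta_plus (N i) (N j)"
    using assms(1,2) by (auto simp: Delta_plus_def mono_on_def)
next
  fix i j k u v assume "i \<in> Obj (ordinal_cat n)" "j \<in> Obj (ordinal_cat n)" "k \<in> Obj (ordinal_cat n)"
    "u \<in> Hom (ordinal_cat n) i j" "v \<in> Hom (ordinal_cat n) j k"
  then show "(\<lambda>x\<in>{..<N i}. f i k x) = Comp Delta_plus (N i) (N j) (N k)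
      (\<lambda>x\<in>{..<N j}. f j k x) (\<lambda>x\<in>{..<N i}. f i j x)"
    using assms(1,4) by (auto simp: Delta_plus_def compose_def intro!: restrict_ext)
qed (use assms(3) in \<open>auto simp: Delta_plus_def intro!: restrict_ext\<close>)

lemma pull_chain_simps [simp]:
  "i \<le> k \<Longrightarrow> on_ob (pull_chain k \<theta> \<alpha>) i = on_ob \<alpha> (\<theta> i)"
  "i \<le> j \<Longrightarrow> j \<le> k \<Longrightarrow> transition (pull_chain k \<theta> \<alpha>) i j = transition \<alpha> (\<theta> i) (\<theta> j)"
  by (simp_all add: pull_chain_def comp_ftor_def ordinal_cat_def)

lemma pull_chain_nerve:
  assumes "\<alpha> \<in> nerve_Delta_plus n" "\<theta> \<in> Hom Delta k n"
  shows "pull_chain k \<theta> \<alpha> \<in> nerve_Delta_plus k"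
proof -
  have "is_ftor (ordinal_cat k) (ordinal_cat n)
      (mk_ftor (ordinal_cat k) \<theta> (\<lambda>i j u. ()))"
    by (rule is_ftor_mk_ftor[OF category_ordinal_cat])
      (use assms(2) in \<open>auto simp: Delta_le Delta_mono\<close>)
  from is_ftor_comp_ftor[OF category_ordinal_cat this] assms(1) show ?thesis
    by (simp add: nerve_Delta_plus_def pull_chain_def mk_ftor_def ordinal_cat_def)
qed

lemma finite_fibre [simp]: "finite (fibre k \<gamma> a i)"
  by (simp add: fibre_def level_def)

lemma fibre_incl_list: "map (fibre_incl k \<gamma> a i) [0..<card (fibre k \<gamma> a i)] = sorted_list_of_set (fibre k \<gamma> a i)"
  by (rule nth_equalityI) (simp_all add: fibre_incl_def)

lemma fibre_incl_image: "fibre_incl k \<gamma> a i ` {..<card (fibre k \<gamma> a i)} = fibre k \<gamma> a i"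
  using arg_cong[OF fibre_incl_list, of set k \<gamma> a i] by (simp add: lessThan_atLeast0)

lemma fibre_incl_in: "x < card (fibre k \<gamma> a i) \<Longrightarrow> fibre_incl k \<gamma> a i x \<in> fibre k \<gamma> a i"
  using fibre_incl_image by blast

lemma fibre_incl_strict_mono: "strict_mono_on {..<card (fibre k \<gamma> a i)} (fibre_incl k \<gamma> a i)"
proof (rule strict_mono_onI)
  fix x y assume "x \<in> {..<card (fibre k \<gamma> a i)}" "y \<in> {..<card (fibre k \<gamma> a i)}" "x < y"
  then show "fibre_incl k \<gamma> a i x < fibre_incl k \<gamma> a i y"
    using sorted_wrt_nth_less[OF strict_sorted_list_of_set[of "fibre k \<gamma> a i"]]
    by (simp add: fibre_incl_def)
qed

lemma fibre_incl_inj: "inj_on (fibre_incl k \<gamma> a i) {..<card (fibre k \<gamma> a i)}"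
  by (rule strict_mono_on_imp_inj_on[OF fibre_incl_strict_mono])

lemma restrict_chain_ob [simp]: "i \<le> k \<Longrightarrow> on_ob (restrict_chain k \<gamma> a) i = card (fibre k \<gamma> a i)"
  by (simp add: restrict_chain_def)

lemma fibre_transition:
  "\<gamma> \<in> nerve_Delta_plus k \<Longrightarrow> i \<le> j \<Longrightarrow> j \<le> k \<Longrightarrow> x \<in> fibre k \<gamma> a i \<Longrightarrow> transition \<gamma> i j x \<in> fibre k \<gamma> a j"
  by (simp add: fibre_def level_def nerve_less nerve_trans)

lemma restrict_chain_transition:
  assumes "\<gamma> \<in> nerve_Delta_plus k" "i \<le> j" "j \<le> k" "x < card (fibre k \<gamma> a i)"
  shows "transition (restrict_chain k \<gamma> a) i j x < card (fibre k \<gamma> a j)" (is ?A)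
    and "fibre_incl k \<gamma> a j (transition (restrict_chain k \<gamma> a) i j x) =
           transition \<gamma> i j (fibre_incl k \<gamma> a i x)" (is ?B)
proof -
  have *: "transition (restrict_chain k \<gamma> a) i j x = the_inv_into {..<card (fibre k \<gamma> a j)} (fibre_incl k \<gamma> a j)
            (transition \<gamma> i j (fibre_incl k \<gamma> a i x))"
    using assms(2-) by (simp add: restrict_chain_def)
  have in_im: "transition \<gamma> i j (fibre_incl k \<gamma> a i x) \<in> fibre_incl k \<gamma> a j ` {..<card (fibre k \<gamma> a j)}"
    using fibre_transition[OF assms(1-3) fibre_incl_in[OF assms(4)]] by (simp add: fibre_incl_image)
  show ?A unfolding * using the_inv_into_into[OF fibre_incl_inj in_im subset_refl] by simp
  show ?B unfolding * by (rule f_the_inv_into_f[OF fibre_incl_inj in_im])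
qed

text \<open>The inclusions of the fibres are strictly increasing, hence injective and order
  reflecting, and they commute with the transitions; so each law is checked after applying an
  inclusion and is inherited from \<open>\<gamma>\<close>.\<close>

lemma restrict_chain_nerve:
  assumes \<gamma>: "\<gamma> \<in> nerve_Delta_plus k"
  shows "restrict_chain k \<gamma> a \<in> nerve_Delta_plus k"
proof -
  define t where "t i j x = the_inv_into {..<card (fibre k \<gamma> a j)} (fibre_incl k \<gamma> a j)
      (transition \<gamma> i j (fibre_incl k \<gamma> a i x))" for i j x
  have tr: "t i j x < card (fibre k \<gamma> a j)"
    "fibre_incl k \<gamma> a j (t i j x) = transition \<gamma> i j (fibre_incl k \<gamma> a i x)"
    if "i \<le> j" "j \<le> k" "x < card (fibre k \<gamma> a i)" for i j x
    using restrict_chain_transition[OF \<gamma> that] that by (simp_all add: restrict_chain_def t_def)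
  have eqI: "x = y" if "x < card (fibre k \<gamma> a i)" "y < card (fibre k \<gamma> a i)"
    "fibre_incl k \<gamma> a i x = fibre_incl k \<gamma> a i y" for i x y
    using inj_onD[OF fibre_incl_inj that(3)] that by simp
  have fl: "fibre_incl k \<gamma> a i x < on_ob \<gamma> i" if "x < card (fibre k \<gamma> a i)" for i x
    using fibre_incl_in[OF that] by (simp add: fibre_def level_def)
  have "mk_chain k (\<lambda>i. card (fibre k \<gamma> a i)) t \<in> nerve_Delta_plus k"
  proof (rule mk_chain_nerve)
    fix i j x y assume *: "i \<le> j" "j \<le> k" "x \<le> y" "y < card (fibre k \<gamma> a i)"
    then have "fibre_incl k \<gamma> a i x \<le> fibre_incl k \<gamma> a i y"
      using strict_mono_onD[OF fibre_incl_strict_mono, of x k \<gamma> a i y] by (cases "x = y") auto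
    then have "fibre_incl k \<gamma> a j (t i j x) \<le> fibre_incl k \<gamma> a j (t i j y)"
      using * by (simp add: tr fl nerve_mono[OF \<gamma>])
    moreover have "t i j x < card (fibre k \<gamma> a j)" "t i j y < card (fibre k \<gamma> a j)"
      using * tr(1) by simp_all
    ultimately show "t i j x \<le> t i j y"
      using strict_mono_onD[OF fibre_incl_strict_mono, of "t i j y" k \<gamma> a j "t i j x"]
      by (auto simp flip: not_less)
  next
    fix i x assume *: "i \<le> k" "x < card (fibre k \<gamma> a i)"
    show "t i i x = x"
      by (rule eqI[of _ i]) (use * in \<open>simp_all add: tr nerve_refl[OF \<gamma>] fl\<close>)
  next
    fix i j l x assume *: "i \<le> j" "j \<le> l" "l \<le> k" "x < card (fibre k \<gamma> a i)"
    show "t j l (t i j x) = t i l x"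
      by (rule eqI[of _ l]) (use * in \<open>simp_all add: tr nerve_trans[OF \<gamma>] fl\<close>)
  qed (rule tr(1))
  also have "mk_chain k (\<lambda>i. card (fibre k \<gamma> a i)) t = restrict_chain k \<gamma> a"
    by (simp add: mk_chain_def mk_ftor_def restrict_chain_def ordinal_cat_def t_def)
  finally show ?thesis .
qed

text \<open>The universal property by which restrictions are recognised.\<close>

lemma
  assumes \<gamma>: "\<gamma> \<in> nerve_Delta_plus k" and \<delta>: "\<delta> \<in> nerve_Delta_plus k"
    and mono: "\<And>i. i \<le> k \<Longrightarrow> strict_mono_on {..<on_ob \<delta> i} (g i)"
    and img: "\<And>i. i \<le> k \<Longrightarrow> g i ` {..<on_ob \<delta> i} = fibre k \<gamma> a i"
    and sq: "\<And>i j x. i \<le> j \<Longrightarrow> j \<le> k \<Longrightarrow> x < on_ob \<delta> i \<Longrightarrow>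
      g j (transition \<delta> i j x) = transition \<gamma> i j (g i x)"
  shows restrict_chain_unique: "restrict_chain k \<gamma> a = \<delta>"
    and fibre_incl_unique: "\<And>i x. i \<le> k \<Longrightarrow> x < on_ob \<delta> i \<Longrightarrow> fibre_incl k \<gamma> a i x = g i x"
proof -
  have inj: "inj_on (g i) {..<on_ob \<delta> i}" if "i \<le> k" for i
    by (rule strict_mono_on_imp_inj_on[OF mono[OF that]])
  have card: "card (fibre k \<gamma> a i) = on_ob \<delta> i" if "i \<le> k" for i
    using card_image[OF inj[OF that]] img[OF that] by simp
  \<comment> \<open>Two strictly increasing lists with the same elements are equal, so
    \<open>g i\<close> must enumerate the fibre in the same way as
    \<open>fibre_incl\<close>.\<close>
  have lists: "map (g i) [0..<on_ob \<delta> i] = sorted_list_of_set (fibre k \<gamma> a i)" if i: "i \<le> k" for i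
  proof (rule strict_sorted_equal[symmetric])
    show "sorted_wrt (<) (map (g i) [0..<on_ob \<delta> i])"
      unfolding sorted_wrt_map
      by (rule sorted_wrt_mono_rel[OF _ sorted_wrt_upt]) (use strict_mono_onD[OF mono[OF i]] in auto)
    show "set (sorted_list_of_set (fibre k \<gamma> a i)) = set (map (g i) [0..<on_ob \<delta> i])"
      using img[OF i] by (simp add: lessThan_atLeast0)
  qed simp
  have incl: "fibre_incl k \<gamma> a i x = g i x" if "i \<le> k" "x < on_ob \<delta> i" for i x
    using that by (simp add: fibre_incl_def flip: lists)
  then show "\<And>i x. i \<le> k \<Longrightarrow> x < on_ob \<delta> i \<Longrightarrow> fibre_incl k \<gamma> a i x = g i x" .
  show "restrict_chain k \<gamma> a = \<delta>"
  proof (rule chain_eqI[OF restrict_chain_nerve[OF \<gamma>] \<delta>])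
    fix i j x assume *: "i \<le> j" "j \<le> k" "x < on_ob (restrict_chain k \<gamma> a) i"
    then have x: "x < on_ob \<delta> i" by (simp add: card)
    have "g j (transition (restrict_chain k \<gamma> a) i j x) = transition \<gamma> i j (g i x)"
      using restrict_chain_transition[OF \<gamma> *(1,2), of x a] * x by (simp add: card incl)
    then have "g j (transition (restrict_chain k \<gamma> a) i j x) = g j (transition \<delta> i j x)"
      using sq * x by simp
    then show "transition (restrict_chain k \<gamma> a) i j x = transition \<delta> i j x"
      by (rule inj_onD[OF inj[OF *(2)]])
        (use * x restrict_chain_transition(1)[OF \<gamma> *(1,2), of x a] nerve_less[OF \<delta> *(1,2)] in
          \<open>simp_all add: card\<close>)
  qed (simp add: card)
qed

text \<open>The simplex \<open>(\<theta>\<^sup>*\<alpha>)\<^sub>a\<close> and its inclusion into \<open>\<theta>\<^sup>*\<alpha>\<close>.\<close>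

abbreviation face :: "nat \<Rightarrow> (nat \<Rightarrow> nat) \<Rightarrow> chain \<Rightarrow> nat \<Rightarrow> chain" where
  "face k \<theta> \<alpha> a \<equiv> restrict_chain k (pull_chain k \<theta> \<alpha>) a"

abbreviation face_incl :: "nat \<Rightarrow> (nat \<Rightarrow> nat) \<Rightarrow> chain \<Rightarrow> nat \<Rightarrow> nat \<Rightarrow> nat \<Rightarrow> nat" where
  "face_incl k \<theta> \<alpha> a \<equiv> fibre_incl k (pull_chain k \<theta> \<alpha>) a"

lemma fibre_pull_chain: "i \<le> k \<Longrightarrow> fibre k (pull_chain k \<theta> \<alpha>) a i = {x. x < on_ob \<alpha> (\<theta> i) \<and> transition \<alpha> (\<theta> i) (\<theta> k) x = a}"
  by (auto simp: fibre_def level_def)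

lemma rooted_iff: "(n, \<alpha>) \<in> rooted_simplices \<longleftrightarrow> \<alpha> \<in> nerve_Delta_plus n \<and> on_ob \<alpha> n = 1"
  by (auto simp: rooted_simplices_def level_def)

lemma face_nerve: "\<alpha> \<in> nerve_Delta_plus n \<Longrightarrow> \<theta> \<in> Hom Delta k n \<Longrightarrow> face k \<theta> \<alpha> a \<in> nerve_Delta_plus k"
  by (intro restrict_chain_nerve pull_chain_nerve)

lemma fibre_top:
  assumes "\<gamma> \<in> nerve_Delta_plus k" "a < on_ob \<gamma> k"
  shows "fibre k \<gamma> a k = {a}"
  using assms by (auto simp: fibre_def level_def nerve_refl)

lemma face_rooted:
  assumes "\<alpha> \<in> nerve_Delta_plus n" "\<theta> \<in> Hom Delta k n" "a < on_ob \<alpha> (\<theta> k)"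
  shows "(k, face k \<theta> \<alpha> a) \<in> rooted_simplices"
  using assms by (simp add: rooted_iff face_nerve fibre_top[OF pull_chain_nerve])

lemma face_incl_less: "i \<le> k \<Longrightarrow> x < on_ob (face k \<theta> \<alpha> a) i \<Longrightarrow> face_incl k \<theta> \<alpha> a i x < on_ob \<alpha> (\<theta> i)"
  using fibre_incl_in[of x k "pull_chain k \<theta> \<alpha>" a i] by (simp add: fibre_def level_def)

lemma face_incl_transition:
  assumes "\<alpha> \<in> nerve_Delta_plus n" "\<theta> \<in> Hom Delta k n" "i \<le> j" "j \<le> k" "x < on_ob (face k \<theta> \<alpha> a) i"
  shows "face_incl k \<theta> \<alpha> a j (transition (face k \<theta> \<alpha> a) i j x) =
    transition \<alpha> (\<theta> i) (\<theta> j) (face_incl k \<theta> \<alpha> a i x)"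
  using restrict_chain_transition(2)[OF pull_chain_nerve[OF assms(1,2)] assms(3,4), of x a] assms by simp

lemma face_incl_strict_mono:
  "i \<le> k \<Longrightarrow> strict_mono_on {..<on_ob (face k \<theta> \<alpha> a) i} (face_incl k \<theta> \<alpha> a i)"
  using fibre_incl_strict_mono by simp

text \<open>A face of a face is a face: the composite of the two inclusions is strictly increasing
  with image the fibre over \<open>face_incl k \<theta> \<alpha> a (\<eta> l) b\<close>, so the
  universal property applies. The first claim shows that composites of morphisms are morphisms; the
  second is the source of associativity.\<close>

lemma
  assumes \<alpha>: "\<alpha> \<in> nerve_Delta_plus n" and \<theta>: "\<theta> \<in> Hom Delta k n" and \<eta>: "\<eta> \<in> Hom Delta l k"
    and b: "b < on_ob (face k \<theta> \<alpha> a) (\<eta> l)"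
  shows face_compose: "face l (compose {..l} \<theta> \<eta>) \<alpha> (face_incl k \<theta> \<alpha> a (\<eta> l) b) = face l \<eta> (face k \<theta> \<alpha> a) b"
    and face_incl_compose: "\<And>i x. i \<le> l \<Longrightarrow> x < on_ob (face l \<eta> (face k \<theta> \<alpha> a) b) i \<Longrightarrow>
      face_incl l (compose {..l} \<theta> \<eta>) \<alpha> (face_incl k \<theta> \<alpha> a (\<eta> l) b) i x =
        face_incl k \<theta> \<alpha> a (\<eta> i) (face_incl l \<eta> (face k \<theta> \<alpha> a) b i x)"
proof -
  let ?F = "face k \<theta> \<alpha> a" let ?g = "\<lambda>i x. face_incl k \<theta> \<alpha> a (\<eta> i) (face_incl l \<eta> ?F b i x)"
  let ?\<gamma> = "pull_chain l (compose {..l} \<theta> \<eta>) \<alpha>" let ?c = "face_incl k \<theta> \<alpha> a (\<eta> l) b"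
  note F = face_nerve[OF \<alpha> \<theta>, of a]
  note \<gamma> = pull_chain_nerve[OF \<alpha> Delta_compose[OF \<theta> \<eta>]]
  note \<delta> = face_nerve[OF F \<eta>, of b]
  have mono: "strict_mono_on {..<on_ob (face l \<eta> ?F b) i} (?g i)" if i: "i \<le> l" for i
  proof (rule strict_mono_onI)
    fix x y assume *: "x \<in> {..<on_ob (face l \<eta> ?F b) i}" "y \<in> {..<on_ob (face l \<eta> ?F b) i}" "x < y"
    then have "face_incl l \<eta> ?F b i x < face_incl l \<eta> ?F b i y"
      using strict_mono_onD[OF face_incl_strict_mono[OF i]] by blast
    then show "?g i x < ?g i y"
      using strict_mono_onD[OF face_incl_strict_mono[OF Delta_le[OF \<eta> i]]]
        face_incl_less[OF i] * by (meson lessThan_iff)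
  qed
  have img: "?g i ` {..<on_ob (face l \<eta> ?F b) i} = fibre l ?\<gamma> ?c i" if i: "i \<le> l" for i
  proof -
    have inj: "inj_on (face_incl k \<theta> \<alpha> a (\<eta> l)) {..<on_ob ?F (\<eta> l)}"
      using strict_mono_on_imp_inj_on[OF face_incl_strict_mono] Delta_le[OF \<eta>] by simp
    have "?g i ` {..<on_ob (face l \<eta> ?F b) i} = face_incl k \<theta> \<alpha> a (\<eta> i) ` fibre l (pull_chain l \<eta> ?F) b i"
      using fibre_incl_image[of l "pull_chain l \<eta> ?F" b i] i by (simp add: image_image[symmetric])
    also have "\<dots> = fibre l ?\<gamma> ?c i"
    proof (intro equalityI subsetI)
      fix z assume "z \<in> face_incl k \<theta> \<alpha> a (\<eta> i) ` fibre l (pull_chain l \<eta> ?F) b i"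
      then obtain y where y: "z = face_incl k \<theta> \<alpha> a (\<eta> i) y" "y < on_ob ?F (\<eta> i)"
        "transition ?F (\<eta> i) (\<eta> l) y = b"
        using i by (auto simp: fibre_pull_chain)
      then show "z \<in> fibre l ?\<gamma> ?c i"
        using i face_incl_transition[OF \<alpha> \<theta> Delta_mono[OF \<eta> i order_refl] Delta_le[OF \<eta>], of y a]
          face_incl_less[OF Delta_le[OF \<eta> i] y(2)]
        by (simp add: fibre_pull_chain compose_def)
    next
      \<comment> \<open>An element over \<open>?c\<close> also lies over \<open>a\<close>, because
        \<open>?c\<close> does, so it comes from some \<open>y\<close> in the face; injectivity of
        the inclusion at level \<open>\<eta> l\<close> then puts \<open>y\<close> over
        \<open>b\<close>.\<close>
      fix z assume "z \<in> fibre l ?\<gamma> ?c i"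
      then have z: "z < on_ob \<alpha> (\<theta> (\<eta> i))" "transition \<alpha> (\<theta> (\<eta> i)) (\<theta> (\<eta> l)) z = ?c"
        using i by (auto simp: fibre_pull_chain compose_def)
      have le: "\<eta> i \<le> \<eta> l" "\<eta> l \<le> k" "\<eta> i \<le> k" using Delta_mono[OF \<eta> i order_refl] Delta_le[OF \<eta>] i by auto
      have le': "\<theta> (\<eta> i) \<le> \<theta> (\<eta> l)" "\<theta> (\<eta> l) \<le> \<theta> k" "\<theta> k \<le> n"
        using Delta_mono[OF \<theta>] Delta_le[OF \<theta>] le by auto
      have "transition \<alpha> (\<theta> (\<eta> i)) (\<theta> k) z = transition \<alpha> (\<theta> (\<eta> l)) (\<theta> k) ?c"
        using nerve_trans[OF \<alpha> le' z(1)] z(2) by simp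
      also have "\<dots> = a"
        using fibre_incl_in[of b k "pull_chain k \<theta> \<alpha>" a "\<eta> l"] b le by (simp add: fibre_pull_chain)
      finally have "z \<in> fibre k (pull_chain k \<theta> \<alpha>) a (\<eta> i)" using z le by (simp add: fibre_pull_chain)
      then obtain y where y: "z = face_incl k \<theta> \<alpha> a (\<eta> i) y" "y < on_ob ?F (\<eta> i)"
        using fibre_incl_image[of k "pull_chain k \<theta> \<alpha>" a "\<eta> i"] le by auto
      have "face_incl k \<theta> \<alpha> a (\<eta> l) (transition ?F (\<eta> i) (\<eta> l) y) = ?c"
        using face_incl_transition[OF \<alpha> \<theta> le(1,2) y(2)] y(1) z(2) by simp
      then have "transition ?F (\<eta> i) (\<eta> l) y = b"
        by (rule inj_onD[OF inj]) (use nerve_less[OF F le(1,2) y(2)] b in simp_all)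
      then show "z \<in> face_incl k \<theta> \<alpha> a (\<eta> i) ` fibre l (pull_chain l \<eta> ?F) b i"
        using y i by (auto simp: fibre_pull_chain)
    qed
    finally show ?thesis .
  qed
  have sq: "?g j (transition (face l \<eta> ?F b) i j x) = transition ?\<gamma> i j (?g i x)"
    if ij: "i \<le> j" "j \<le> l" and x: "x < on_ob (face l \<eta> ?F b) i" for i j x
  proof -
    have "i \<le> l" using ij by simp
    then show ?thesis
      using face_incl_transition[OF F \<eta> ij x] ij
        face_incl_transition[OF \<alpha> \<theta> Delta_mono[OF \<eta> ij] Delta_le[OF \<eta> ij(2)] face_incl_less[OF _ x]]
      by (simp add: compose_def del: restrict_chain_ob)
  qed
  show "face l (compose {..l} \<theta> \<eta>) \<alpha> ?c = face l \<eta> ?F b"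
    by (rule restrict_chain_unique[OF \<gamma> \<delta> mono img sq])
  show "face_incl l (compose {..l} \<theta> \<eta>) \<alpha> ?c i x = ?g i x"
    if "i \<le> l" "x < on_ob (face l \<eta> ?F b) i" for i x
    by (rule fibre_incl_unique[OF \<gamma> \<delta> mono img sq that])
qed

text \<open>Since the last level of \<open>\<alpha>\<close> is a single point, the fibre over it is
  the whole of every level.\<close>

lemma
  assumes \<alpha>: "(n, \<alpha>) \<in> rooted_simplices"
  shows face_Id: "face n (\<lambda>i\<in>{..n}. i) \<alpha> 0 = \<alpha>"
    and face_incl_Id: "\<And>i x. i \<le> n \<Longrightarrow> x < on_ob \<alpha> i \<Longrightarrow> face_incl n (\<lambda>i\<in>{..n}. i) \<alpha> 0 i x = x"
proof -
  have n: "\<alpha> \<in> nerve_Delta_plus n" "on_ob \<alpha> n = 1" using \<alpha> by (simp_all add: rooted_iff)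
  note \<gamma> = pull_chain_nerve[OF n(1) Delta_Id]
  have img: "(\<lambda>x. x) ` {..<on_ob \<alpha> i} = fibre n (pull_chain n (\<lambda>i\<in>{..n}. i) \<alpha>) 0 i" if "i \<le> n" for i
    using that nerve_less[OF n(1) that order_refl] n(2) by (auto simp: fibre_pull_chain)
  have mono: "strict_mono_on {..<on_ob \<alpha> i} (\<lambda>x. x)" for i by (simp add: strict_mono_on_def)
  show "face n (\<lambda>i\<in>{..n}. i) \<alpha> 0 = \<alpha>"
    by (rule restrict_chain_unique[OF \<gamma> n(1) mono img]) auto
  show "face_incl n (\<lambda>i\<in>{..n}. i) \<alpha> 0 i x = x" if "i \<le> n" "x < on_ob \<alpha> i" for i x
    by (rule fibre_incl_unique[OF \<gamma> n(1) mono img _ that]) auto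
qed

section \<open>The category of rooted simplices and its rigidity\<close>

lemma rooted_simplex_cat_simps [simp]:
  "Obj rooted_simplex_cat = rooted_simplices"
  "Id rooted_simplex_cat (n, \<alpha>) = ((\<lambda>i\<in>{..n}. i), 0)"
  "Comp rooted_simplex_cat (l, \<gamma>) (k, \<beta>) (n, \<alpha>) (\<theta>, a) (\<eta>, b) =
     (compose {..l} \<theta> \<eta>, face_incl k \<theta> \<alpha> a (\<eta> l) b)"
  by (simp_all add: rooted_simplex_cat_def)

lemma rooted_simplex_cat_Hom:
  "(\<theta>, a) \<in> Hom rooted_simplex_cat (k, \<beta>) (n, \<alpha>) \<longleftrightarrow>
     \<theta> \<in> Hom Delta k n \<and> a < on_ob \<alpha> (\<theta> k) \<and> \<beta> = face k \<theta> \<alpha> a"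
  by (simp add: rooted_simplex_cat_def level_def)

text \<open>Needed for the right identity law: the top fibre is the singleton of \<open>a\<close>,
  so composing with the root gives back \<open>a\<close>.\<close>

lemma face_incl_top:
  assumes "\<alpha> \<in> nerve_Delta_plus n" "\<theta> \<in> Hom Delta k n" "a < on_ob \<alpha> (\<theta> k)"
  shows "face_incl k \<theta> \<alpha> a k 0 = a"
  using fibre_incl_in[of 0 k "pull_chain k \<theta> \<alpha>" a k] fibre_top[OF pull_chain_nerve[OF assms(1,2)]] assms(3)
  by simp

lemma category_rooted_simplex_cat: "category rooted_simplex_cat"
  unfolding category_def
proof (intro conjI ballI; clarsimp simp del: restrict_chain_ob)
  fix n \<alpha> assume "(n, \<alpha>) \<in> rooted_simplices"
  then show "((\<lambda>i\<in>{..n}. i), 0) \<in> Hom rooted_simplex_cat (n, \<alpha>) (n, \<alpha>)"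
    by (simp add: rooted_simplex_cat_Hom Delta_Id face_Id) (simp add: rooted_iff)
next
  fix l \<gamma> k \<beta> n \<alpha> \<eta> b \<theta> a
  assume "(n, \<alpha>) \<in> rooted_simplices" "(\<eta>, b) \<in> Hom rooted_simplex_cat (l, \<gamma>) (k, \<beta>)"
    "(\<theta>, a) \<in> Hom rooted_simplex_cat (k, \<beta>) (n, \<alpha>)"
  then show "(compose {..l} \<theta> \<eta>, face_incl k \<theta> \<alpha> a (\<eta> l) b) \<in> Hom rooted_simplex_cat (l, \<gamma>) (n, \<alpha>)"
    by (auto simp: rooted_simplex_cat_Hom rooted_iff Delta_compose face_compose Delta_le face_incl_less
        simp del: restrict_chain_ob)
next
  fix k \<beta> n \<alpha> \<theta> a
  assume *: "(k, \<beta>) \<in> rooted_simplices" "(n, \<alpha>) \<in> rooted_simplices"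
    "(\<theta>, a) \<in> Hom rooted_simplex_cat (k, \<beta>) (n, \<alpha>)"
  then show "compose {..k} \<theta> (\<lambda>i\<in>{..k}. i) = \<theta> \<and> face_incl k \<theta> \<alpha> a k 0 = a"
    "compose {..k} (\<lambda>i\<in>{..n}. i) \<theta> = \<theta> \<and> face_incl n (\<lambda>i\<in>{..n}. i) \<alpha> 0 (\<theta> k) a = a"
    using Comp_Id_right[OF category_Delta, of k n \<theta>] Comp_Id_left[OF category_Delta, of k n \<theta>]
    by (auto simp: rooted_simplex_cat_Hom rooted_iff face_incl_top face_incl_Id Delta_le)
next
  fix p \<epsilon> l \<gamma> k \<beta> n \<alpha> \<zeta> c \<eta> b \<theta> a
  assume *: "(p, \<epsilon>) \<in> rooted_simplices" "(l, \<gamma>) \<in> rooted_simplices" "(k, \<beta>) \<in> rooted_simplices"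
    "(n, \<alpha>) \<in> rooted_simplices" "(\<zeta>, c) \<in> Hom rooted_simplex_cat (p, \<epsilon>) (l, \<gamma>)"
    "(\<eta>, b) \<in> Hom rooted_simplex_cat (l, \<gamma>) (k, \<beta>)" "(\<theta>, a) \<in> Hom rooted_simplex_cat (k, \<beta>) (n, \<alpha>)"
  then have \<alpha>: "\<alpha> \<in> nerve_Delta_plus n" and \<theta>: "\<theta> \<in> Hom Delta k n" and \<eta>: "\<eta> \<in> Hom Delta l k"
    and \<zeta>: "\<zeta> \<in> Hom Delta p l" and b: "b < on_ob (face k \<theta> \<alpha> a) (\<eta> l)"
    and c: "c < on_ob (face l \<eta> (face k \<theta> \<alpha> a) b) (\<zeta> p)" and \<beta>: "\<beta> = face k \<theta> \<alpha> a"
    by (auto simp: rooted_simplex_cat_Hom rooted_iff simp del: restrict_chain_ob)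
  show "compose {..p} \<theta> (compose {..p} \<eta> \<zeta>) = compose {..p} (compose {..l} \<theta> \<eta>) \<zeta> \<and>
      face_incl k \<theta> \<alpha> a (\<eta> (\<zeta> p)) (face_incl l \<eta> \<beta> b (\<zeta> p) c) =
      face_incl l (compose {..l} \<theta> \<eta>) \<alpha> (face_incl k \<theta> \<alpha> a (\<eta> l) b) (\<zeta> p) c"
    using face_incl_compose[OF \<alpha> \<theta> \<eta> b Delta_le[OF \<zeta> order_refl] c]
    by (simp add: \<beta> compose_compose[OF \<zeta>])
qed

lemma Delta_inj_ge:
  assumes \<theta>: "\<theta> \<in> Hom Delta k n" and inj: "inj_on \<theta> {..k}" and "i \<le> k"
  shows "i \<le> \<theta> i"
  using assms(3)
proof (induction i)
  case (Suc i)
  then have "\<theta> i \<le> \<theta> (Suc i)" "\<theta> i \<noteq> \<theta> (Suc i)"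
    using Delta_mono[OF \<theta>, of i "Suc i"] inj_onD[OF inj, of i "Suc i"] by auto
  then show ?case using Suc by simp
qed simp

text \<open>Both maps of an inverse pair are injective and therefore lie above the identity, which
  gives i \<le> \<theta> i \<le> \<eta> (\<theta> i) = i. So \<open>\<theta>\<close> is an identity,
  \<open>a\<close> lies in a one-point level and must be the root, and the face in question is the
  simplex itself.\<close>

lemma rooted_simplex_cat_skeletal:
  assumes "x \<in> rooted_simplices" "y \<in> rooted_simplices" "isomorphic_in rooted_simplex_cat x y"
  shows "x = y"
proof -
  obtain n \<alpha> k \<beta> where xy: "x = (n, \<alpha>)" "y = (k, \<beta>)" by (metis surj_pair)
  obtain \<theta> a \<eta> b where "(\<theta>, a) \<in> Hom rooted_simplex_cat (n, \<alpha>) (k, \<beta>)"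
    "(\<eta>, b) \<in> Hom rooted_simplex_cat (k, \<beta>) (n, \<alpha>)"
    "compose {..n} \<eta> \<theta> = (\<lambda>i\<in>{..n}. i)" "compose {..k} \<theta> \<eta> = (\<lambda>i\<in>{..k}. i)"
    using assms(3) unfolding xy isomorphic_in_def by fastforce
  then have \<theta>: "\<theta> \<in> Hom Delta n k" and \<eta>: "\<eta> \<in> Hom Delta k n" and a: "a < on_ob \<beta> (\<theta> n)"
    and \<alpha>: "\<alpha> = face n \<theta> \<beta> a" and \<eta>\<theta>: "\<And>i. i \<le> n \<Longrightarrow> \<eta> (\<theta> i) = i" and \<theta>\<eta>: "\<And>i. i \<le> k \<Longrightarrow> \<theta> (\<eta> i) = i"
    by (auto simp: rooted_simplex_cat_Hom compose_def fun_eq_iff split: if_splits)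
  have inj: "inj_on \<theta> {..n}" "inj_on \<eta> {..k}"
    by (rule inj_on_inverseI[where g = \<eta>], simp add: \<eta>\<theta>) (rule inj_on_inverseI[where g = \<theta>], simp add: \<theta>\<eta>)
  have id: "\<theta> i = i" if "i \<le> n" for i
    using Delta_inj_ge[OF \<theta> inj(1) that] Delta_inj_ge[OF \<eta> inj(2) Delta_le[OF \<theta> that]] \<eta>\<theta>[OF that] by simp
  have "n = k"
    using Delta_inj_ge[OF \<eta> inj(2) order_refl] Delta_le[OF \<eta>, of k] Delta_le[OF \<theta>, of n] id[of n] by simp
  moreover have "\<theta> = (\<lambda>i\<in>{..n}. i)" by (rule Delta_eqI[OF \<theta> Delta_Id]) (simp add: id)
  ultimately show ?thesis
    using \<alpha> a assms(2) face_Id[of k \<beta>] by (simp add: xy rooted_iff)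
qed

section \<open>Size: coding countable sets into the universe\<close>

lemma set_universe_subset: "set_universe U \<Longrightarrow> A \<in> U \<Longrightarrow> B \<subseteq> A \<Longrightarrow> B \<in> U"
  by (auto simp: set_universe_def)

text \<open>An infinite member of \<open>U\<close> contains a copy of the natural numbers, hence of
  every countable set, and \<open>U\<close> is closed under subsets.\<close>

lemma set_universe_code:
  fixes U :: "'u set set"
  assumes U: "set_universe U" and X: "countable X"
  obtains code :: "'a \<Rightarrow> 'u" where "inj_on code X" "\<And>Y. Y \<subseteq> X \<Longrightarrow> code ` Y \<in> U"
proof -
  obtain W where W: "W \<in> U" "infinite W" using U by (auto simp: set_universe_def)
  obtain f :: "nat \<Rightarrow> 'u" where f: "inj f" "range f \<subseteq> W" using infinite_countable_subset[OF W(2)] by blast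
  show ?thesis
  proof (rule that[of "f \<circ> to_nat_on X"])
    show "inj_on (f \<circ> to_nat_on X) X"
      using f(1) X by (intro comp_inj_on) (auto intro: inj_on_subset)
    show "(f \<circ> to_nat_on X) ` Y \<in> U" for Y
      by (rule set_universe_subset[OF U W(1)]) (use f(2) in auto)
  qed
qed

text \<open>A morphism is a monotone map between finite ordinals together with a number, so only
  countably many pairs occur. Different hom-sets may share a pair; the code tells pairs apart, not
  their sources and targets.\<close>

lemma coded_cat_rooted_simplex_cat:
  fixes U :: "'u set set"
  assumes U: "set_universe U"
  obtains code where "coded_cat rooted_simplex_cat U code"
proof -
  let ?X = "\<Union>x\<in>rooted_simplices. \<Union>y\<in>rooted_simplices. Hom rooted_simplex_cat x y"
  have "countable (Hom Delta k n)" for k n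
    by (rule countable_subset[of _ "{..k} \<rightarrow>\<^sub>E {..n}"]) (auto simp: Delta_Hom intro!: countable_finite finite_PiE)
  then have "countable ((\<Union>k n. Hom Delta k n) \<times> (UNIV :: nat set))" by blast
  moreover have "?X \<subseteq> (\<Union>k n. Hom Delta k n) \<times> (UNIV :: nat set)" by (force simp: rooted_simplex_cat_Hom)
  ultimately have "countable ?X" by (rule countable_subset[rotated])
  from set_universe_code[OF U this] obtain code :: "_ \<Rightarrow> 'u"
    where "inj_on code ?X" "\<And>Y. Y \<subseteq> ?X \<Longrightarrow> code ` Y \<in> U" by metis
  then have "coded_cat rooted_simplex_cat U code"
    by unfold_locales (auto simp: category_rooted_simplex_cat)
  then show ?thesis by (rule that)
qed

text \<open>A chain can be recovered from finite tables of natural numbers. Countability is what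
  keeps the disjoint union over all shapes of dimension \<open>n\<close> inside the
  universe.\<close>

lemma countable_nerve: "countable (nerve_Delta_plus n)"
proof (rule countableI')
  let ?c = "\<lambda>\<gamma>. (map (on_ob \<gamma>) [0..<Suc n],
    map (\<lambda>i. map (\<lambda>j. map (transition \<gamma> i j) [0..<on_ob \<gamma> i]) [0..<Suc n]) [0..<Suc n])"
  show "inj_on ?c (nerve_Delta_plus n)"
  proof (rule inj_onI)
    fix \<gamma> \<delta> assume *: "\<gamma> \<in> nerve_Delta_plus n" "\<delta> \<in> nerve_Delta_plus n" "?c \<gamma> = ?c \<delta>"
    then have ob: "\<And>i. i \<le> n \<Longrightarrow> on_ob \<gamma> i = on_ob \<delta> i" and
      tr: "\<And>i j. i \<le> n \<Longrightarrow> j \<le> n \<Longrightarrow> map (transition \<gamma> i j) [0..<on_ob \<gamma> i] = map (transition \<delta> i j) [0..<on_ob \<delta> i]"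
      by (auto simp del: upt_Suc simp: less_Suc_eq_le)
    show "\<gamma> = \<delta>"
    proof (rule chain_eqI[OF *(1,2) ob])
      fix i j x assume "i \<le> j" "j \<le> n" "x < on_ob \<gamma> i"
      then show "transition \<gamma> i j x = transition \<delta> i j x" using tr[of i j] ob[of i] by simp
    qed
  qed
qed

section \<open>The shape of an element of an operadic simplicial list\<close>

text \<open>
  \<open>block ls p\<close> is the index of the block containing \<open>p\<close> when consecutive blocks of lengths \<open>ls\<close>
  are laid out from \<open>0\<close>. Every monotone map between finite ordinals is of this form, with \<open>ls\<close> the
  sizes of its fibres.
\<close>

fun block :: "nat list \<Rightarrow> nat \<Rightarrow> nat" where
  "block [] p = 0"
| "block (l # ls) p = (if p < l then 0 else Suc (block ls (p - l)))"

lemma block_less: "p < sum_list ls \<Longrightarrow> block ls p < length ls"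
  by (induction ls p rule: block.induct) auto

lemma block_mono: "p \<le> q \<Longrightarrow> block ls p \<le> block ls q"
  by (induction ls p arbitrary: q rule: block.induct) (auto simp: diff_le_mono)

lemma block_replicate_1: "p < n \<Longrightarrow> block (replicate n (Suc 0)) p = p"
  by (induction n arbitrary: p) auto

lemma block_append: "block (xs @ ys) p = (if p < sum_list xs then block xs p else length xs + block ys (p - sum_list xs))"
  by (induction xs p rule: block.induct) auto

text \<open>When consecutive blocks are themselves collected into groups, the group of the block of
  a position is the group of that position. This becomes the composition law for the transitions of
  a shape.\<close>

lemma block_block: "block (map length LL) (block (concat LL) p) = block (map sum_list LL) p"
  if "p < sum_list (concat LL)"
  using that
proof (induction LL arbitrary: p)
  case (Cons L LL)
  show ?case
  proof (cases "p < sum_list L")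
    case True
    then show ?thesis using block_less[OF True] by (simp add: block_append)
  next
    case False
    then show ?thesis using Cons by (simp add: block_append)
  qed
qed simp

text \<open>A position inside group \<open>a\<close> is shifted by the total size of the earlier
  groups, and its block by the number of blocks in them. This is how the inclusion of a face
  commutes with the transitions of shapes.\<close>

lemma block_offset:
  "a < length LL \<Longrightarrow> p < sum_list (LL ! a) \<Longrightarrow>
   block (concat LL) (sum_list (map sum_list (take a LL)) + p) = sum_list (map length (take a LL)) + block (LL ! a) p"
  by (induction LL arbitrary: a) (auto simp: block_append nth_Cons take_Cons split: nat.splits)

lemma block_fibre:
  "a < length ls \<Longrightarrow> {p. p < sum_list ls \<and> block ls p = a} = (\<lambda>q. sum_list (take a ls) + q) ` {..<ls ! a}"
proof (induction ls arbitrary: a)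
  case (Cons l ls)
  show ?case
  proof (cases a)
    case 0
    then show ?thesis by (auto split: if_splits)
  next
    case (Suc b)
    have "{p. p < sum_list (l # ls) \<and> block (l # ls) p = a} = (\<lambda>q. l + q) ` {p. p < sum_list ls \<and> block ls p = b}"
    proof (intro equalityI subsetI)
      fix p assume "p \<in> {p. p < sum_list (l # ls) \<and> block (l # ls) p = a}"
      then have "p = l + (p - l)" "p - l \<in> {p. p < sum_list ls \<and> block ls p = b}"
        using Suc by (auto split: if_splits)
      then show "p \<in> (\<lambda>q. l + q) ` {p. p < sum_list ls \<and> block ls p = b}" by (rule image_eqI)
    qed (use Suc in auto)
    also have "\<dots> = (\<lambda>q. sum_list (take a (l # ls)) + q) ` {..<(l # ls) ! a}"
      using Cons Suc by (simp add: image_image add.assoc)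
    finally show ?thesis .
  qed
qed simp

lemma sum_list_fibres:
  assumes "a \<le> n"
  shows "sum_list (take a (map (\<lambda>a. card {p. p < m \<and> f p = a}) [0..<n])) = card {p::nat. p < m \<and> f p < a}"
  using assms
proof (induction a)
  case (Suc a)
  have "{p. p < m \<and> f p < Suc a} = {p. p < m \<and> f p < a} \<union> {p. p < m \<and> f p = a}" by auto
  moreover have "card ({p. p < m \<and> f p < a} \<union> {p. p < m \<and> f p = a}) =
      card {p. p < m \<and> f p < a} + card {p. p < m \<and> f p = a}"
    by (rule card_Un_disjoint) auto
  ultimately show ?case using Suc by (simp add: take_Suc_conv_app_nth)
qed simp

text \<open>Monotonicity makes the set downward closed, and a finite downward closed set of natural
  numbers is an initial segment.\<close>

lemma mono_initial_segment:
  fixes f :: "nat \<Rightarrow> nat"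
  assumes mono: "\<And>p q. p \<le> q \<Longrightarrow> q < m \<Longrightarrow> f p \<le> f q"
  shows "{p. p < m \<and> f p < a} = {..<card {p. p < m \<and> f p < a}}"
proof -
  let ?S = "{p. p < m \<and> f p < a}"
  have dc: "p \<in> ?S" if "q \<in> ?S" "p \<le> q" for p q
    using that mono[of p q] by auto
  show ?thesis
  proof (intro equalityI subsetI)
    fix p assume p: "p \<in> ?S"
    then have "{..p} \<subseteq> ?S" using dc by blast
    then have "card {..p} \<le> card ?S" by (intro card_mono) auto
    then show "p \<in> {..<card ?S}" by simp
  next
    fix p assume p: "p \<in> {..<card ?S}"
    show "p \<in> ?S"
    proof (rule ccontr)
      assume "p \<notin> ?S"
      then have "?S \<subseteq> {..<p}" using dc by (meson lessThan_iff not_less subsetI)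
      then have "card ?S \<le> card {..<p}" by (intro card_mono) auto
      then show False using p by simp
    qed
  qed
qed

text \<open>By \<open>mono_initial_segment\<close>, \<open>p\<close> lies at or after the number of
  positions with value below \<open>f p\<close> and before the number with value at most
  \<open>f p\<close>; these two numbers delimit the block of index \<open>f p\<close>.\<close>

lemma block_fibre_sizes:
  fixes f :: "nat \<Rightarrow> nat"
  assumes mono: "\<And>p q. p \<le> q \<Longrightarrow> q < m \<Longrightarrow> f p \<le> f q" and p: "p < m" "f p < n"
  shows "block (map (\<lambda>a. card {p. p < m \<and> f p = a}) [0..<n]) p = f p"
proof -
  let ?ls = "map (\<lambda>a. card {p. p < m \<and> f p = a}) [0..<n]" and ?s = "\<lambda>a. card {p. p < m \<and> f p < a}"
  have seg: "{p. p < m \<and> f p < a} = {..<?s a}" for a by (rule mono_initial_segment[OF mono])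
  have "p \<notin> {..<?s (f p)}" "p \<in> {..<?s (Suc (f p))}" using seg[of "f p"] seg[of "Suc (f p)"] p by blast+
  moreover have "?s (Suc (f p)) = ?s (f p) + ?ls ! f p"
    using sum_list_fibres[of "f p" n m f] sum_list_fibres[of "Suc (f p)" n m f] p
    by (simp add: take_Suc_conv_app_nth)
  ultimately have "p = ?s (f p) + (p - ?s (f p))" "p - ?s (f p) < ?ls ! f p" by auto
  then have "p \<in> (\<lambda>q. sum_list (take (f p) ?ls) + q) ` {..<?ls ! f p}"
    using sum_list_fibres[of "f p" n m f] p by auto
  also have "\<dots> = {q. q < sum_list ?ls \<and> block ?ls q = f p}" by (rule block_fibre[symmetric]) (use p in simp)
  finally show ?thesis by blast
qed

text \<open>Monotonicity puts each fibre entirely before the next one, so concatenation needs no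
  reordering. This gives functoriality of the simplicial list that is rebuilt from a
  presheaf.\<close>

lemma concat_fibres:
  fixes f :: "nat \<Rightarrow> nat"
  assumes mono: "\<And>p q. p \<le> q \<Longrightarrow> q < m \<Longrightarrow> f p \<le> f q" and less: "\<And>p. p < m \<Longrightarrow> f p < n"
  shows "concat (map (\<lambda>a. sorted_list_of_set {p. p < m \<and> f p = a}) [0..<n]) = [0..<m]"
proof -
  have "concat (map (\<lambda>a. sorted_list_of_set {p. p < m \<and> f p = a}) [0..<b]) = sorted_list_of_set {p. p < m \<and> f p < b}" for b
  proof (induction b)
    case (Suc b)
    let ?A = "{p. p < m \<and> f p < b}" and ?B = "{p. p < m \<and> f p = b}"
    have fin: "finite ?A" "finite ?B" by simp_all
    have "sorted_list_of_set ?A @ sorted_list_of_set ?B = sorted_list_of_set {p. p < m \<and> f p < Suc b}"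
    proof (rule strict_sorted_equal)
      have "p < q" if "p \<in> ?A" "q \<in> ?B" for p q
        using that mono[of q p] by (metis (mono_tags, lifting) leD leI mem_Collect_eq)
      then have "\<forall>p\<in>?A. \<forall>q\<in>?B. p < q" by blast
      then show "sorted_wrt (<) (sorted_list_of_set ?A @ sorted_list_of_set ?B)"
        unfolding sorted_wrt_append set_sorted_list_of_set[OF fin(1)] set_sorted_list_of_set[OF fin(2)]
        by (intro conjI strict_sorted_list_of_set)
      show "set (sorted_list_of_set ?A @ sorted_list_of_set ?B) = set (sorted_list_of_set {p. p < m \<and> f p < Suc b})"
        by auto
    qed simp_all
    then show ?case by (simp add: Suc)
  qed simp
  moreover have "{p. p < m \<and> f p < n} = {0..<m}" using less by fastforce
  ultimately show ?thesis by simp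
qed

text \<open>The offset is the one in \<open>face_incl_shape\<close>, so an inclusion of faces can be
  read as an index into a concatenated list.\<close>

lemma concat_map_nth:
  "a < length ys \<Longrightarrow> b < length (v (ys ! a)) \<Longrightarrow>
   concat (map v ys) ! (sum_list (map (\<lambda>y. length (v y)) (take a ys)) + b) = v (ys ! a) ! b"
  by (induction ys arbitrary: a) (auto simp: nth_append nth_Cons take_Cons split: nat.splits)

section \<open>Listings and the category of operadic simplicial lists\<close>

lemma list_cat_simps [simp]:
  "Obj (list_cat U) = U" "Hom (list_cat U) A X = (A \<rightarrow>\<^sub>E lists X)" "Id (list_cat U) A = (\<lambda>a\<in>A. [a])"
  "Comp (list_cat U) A X Y v u = (\<lambda>a\<in>A. concat (map v (u a)))"
  by (simp_all add: list_cat_def)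

lemma PiE_lists_subset: "u \<in> A \<rightarrow>\<^sub>E lists X \<Longrightarrow> a \<in> A \<Longrightarrow> set (u a) \<subseteq> X"
  by (drule (1) PiE_mem) (simp add: lists_eq_set)

lemma category_list_cat: "category (list_cat U)"
  unfolding category_def
proof (intro conjI ballI)
  fix A X Y u v assume *: "u \<in> Hom (list_cat U) A X" "v \<in> Hom (list_cat U) X Y"
  have "set (concat (map v (u a))) \<subseteq> Y" if "a \<in> A" for a
    using PiE_lists_subset[of u A X a] PiE_lists_subset[of v X Y] that * by fastforce
  then show "Comp (list_cat U) A X Y v u \<in> Hom (list_cat U) A Y" by (simp add: lists_eq_set)
next
  fix A X u assume u: "u \<in> Hom (list_cat U) A X"
  then have set: "set (u a) \<subseteq> X" if "a \<in> A" for a using that PiE_lists_subset[of u A X a] by simp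
  show "Comp (list_cat U) A A X u (Id (list_cat U) A) = u"
    using u by (auto intro!: ext dest: PiE_arb)
  have "concat (map (\<lambda>a\<in>X. [a]) xs) = xs" if "set xs \<subseteq> X" for xs
    using that by (induction xs) auto
  then show "Comp (list_cat U) A X X (Id (list_cat U) X) u = u"
    using u set by (auto intro!: ext dest: PiE_arb)
next
  fix A X Y Z u v w assume u: "u \<in> Hom (list_cat U) A X"
    and "v \<in> Hom (list_cat U) X Y" "w \<in> Hom (list_cat U) Y Z"
  have *: "concat (map w (concat (map v xs))) = concat (map (\<lambda>a\<in>X. concat (map w (v a))) xs)" if "set xs \<subseteq> X" for xs
    using that by (induction xs) auto
  have "set (u a) \<subseteq> X" if "a \<in> A" for a using u that PiE_lists_subset[of u A X a] by simp
  then show "Comp (list_cat U) A Y Z w (Comp (list_cat U) A X Y v u) =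
      Comp (list_cat U) A X Z (Comp (list_cat U) X Y Z w v) u"
    by (auto simp: * intro!: restrict_ext)
qed auto

lemma sList_Op_simps:
  "X \<in> Obj (sList_Op U) \<longleftrightarrow> is_ftor (op_cat Delta) (list_cat U) X \<and> operadic X"
  "\<sigma> \<in> Hom (sList_Op U) X Y \<longleftrightarrow> \<sigma> \<in> nat_trans (op_cat Delta) (list_cat U) X Y \<and>
     (\<forall>n. is_function (on_ob X n) (\<sigma> n))"
  "Id (sList_Op U) = Id (ftor_cat (op_cat Delta) (list_cat U))"
  "Comp (sList_Op U) = Comp (ftor_cat (op_cat Delta) (list_cat U))"
  by (simp_all add: sList_Op_def Let_def)

lemma is_functionD: "is_function A u \<Longrightarrow> a \<in> A \<Longrightarrow> u a = [hd (u a)]"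
  by (auto simp: is_function_def length_Suc_conv)

lemma sList_Op_hom_apply:
  assumes "\<sigma> \<in> Hom (sList_Op U) X Y" "x \<in> on_ob X n"
  shows "\<sigma> n x = [hd (\<sigma> n x)]" "hd (\<sigma> n x) \<in> on_ob Y n"
proof -
  show eq: "\<sigma> n x = [hd (\<sigma> n x)]"
    using assms is_functionD[of "on_ob X n" "\<sigma> n" x] by (simp add: sList_Op_simps)
  have "set (\<sigma> n x) \<subseteq> on_ob Y n"
    using assms nat_trans_in[of \<sigma> "op_cat Delta" "list_cat U" X Y n] PiE_lists_subset[of "\<sigma> n" "on_ob X n" "on_ob Y n" x]
    by (simp add: sList_Op_simps)
  then show "hd (\<sigma> n x) \<in> on_ob Y n" by (subst (asm) eq) simp
qed

text \<open>The laws are inherited from the functor category; what needs an argument is that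
  components which are functions are closed under composition of listings.\<close>

lemma category_sList_Op: "category (sList_Op U)"
proof -
  have cat: "category (ftor_cat (op_cat Delta) (list_cat U))" by (rule category_ftor_cat[OF category_list_cat])
  have fn: "is_function (on_ob X n) (Comp (sList_Op U) X Y Z \<sigma> \<tau> n)"
    if \<tau>: "\<tau> \<in> Hom (sList_Op U) X Y" and \<sigma>: "\<sigma> \<in> Hom (sList_Op U) Y Z" for X Y Z \<sigma> \<tau> n
    unfolding is_function_def
  proof
    fix x assume x: "x \<in> on_ob X n"
    obtain y where "\<tau> n x = [y]" "y \<in> on_ob Y n"
      using sList_Op_hom_apply[OF \<tau> x] by metis
    moreover from this have "length (\<sigma> n y) = 1"
      using \<sigma> by (simp add: sList_Op_simps is_function_def)
    ultimately show "length (Comp (sList_Op U) X Y Z \<sigma> \<tau> n x) = 1"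
      using x by (simp add: sList_Op_simps(4))
  qed
  have sub: "Obj (sList_Op U) \<subseteq> Obj (ftor_cat (op_cat Delta) (list_cat U))"
    "\<And>X Y. Hom (sList_Op U) X Y \<subseteq> Hom (ftor_cat (op_cat Delta) (list_cat U)) X Y"
    by (auto simp: sList_Op_simps)
  show ?thesis
    unfolding category_def
  proof (intro conjI ballI)
    fix X assume "X \<in> Obj (sList_Op U)"
    then show "Id (sList_Op U) X \<in> Hom (sList_Op U) X X"
      using nat_trans_Id[OF category_list_cat, of "op_cat Delta" U X]
      by (simp add: sList_Op_simps is_function_def)
  next
    fix X Y Z \<tau> \<sigma> assume *: "X \<in> Obj (sList_Op U)" "Y \<in> Obj (sList_Op U)" "Z \<in> Obj (sList_Op U)"
      "\<tau> \<in> Hom (sList_Op U) X Y" "\<sigma> \<in> Hom (sList_Op U) Y Z"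
    then have "Comp (sList_Op U) X Y Z \<sigma> \<tau> \<in> Hom (ftor_cat (op_cat Delta) (list_cat U)) X Z"
      unfolding sList_Op_simps(4) using sub by (intro Comp_in[OF cat]) auto
    then show "Comp (sList_Op U) X Y Z \<sigma> \<tau> \<in> Hom (sList_Op U) X Z"
      using fn[OF *(4,5)] by (simp add: sList_Op_simps(2))
  next
    fix X Y \<tau> assume *: "X \<in> Obj (sList_Op U)" "Y \<in> Obj (sList_Op U)" "\<tau> \<in> Hom (sList_Op U) X Y"
    show "Comp (sList_Op U) X X Y \<tau> (Id (sList_Op U) X) = \<tau>"
      "Comp (sList_Op U) X Y Y (Id (sList_Op U) Y) \<tau> = \<tau>"
      unfolding sList_Op_simps(3,4) using * sub
      by (blast intro: Comp_Id_right[OF cat], blast intro: Comp_Id_left[OF cat])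
  next
    fix W X Y Z \<rho> \<tau> \<sigma> assume *: "W \<in> Obj (sList_Op U)" "X \<in> Obj (sList_Op U)" "Y \<in> Obj (sList_Op U)"
      "Z \<in> Obj (sList_Op U)" "\<rho> \<in> Hom (sList_Op U) W X" "\<tau> \<in> Hom (sList_Op U) X Y" "\<sigma> \<in> Hom (sList_Op U) Y Z"
    show "Comp (sList_Op U) W Y Z \<sigma> (Comp (sList_Op U) W X Y \<tau> \<rho>) =
        Comp (sList_Op U) W X Z (Comp (sList_Op U) X Y Z \<sigma> \<tau>) \<rho>"
      unfolding sList_Op_simps(4)
      by (rule Comp_assoc[OF cat, symmetric]) (use * sub in blast)+
  qed
qed

section \<open>Vertices, edges and the shape of an element\<close>

definition vertex :: "nat \<Rightarrow> nat \<Rightarrow> nat" where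
  "vertex i = (\<lambda>_\<in>{..0}. i)"

definition edge :: "nat \<Rightarrow> nat \<Rightarrow> nat \<Rightarrow> nat" where
  "edge i j = (\<lambda>x\<in>{..1}. if x = 0 then i else j)"

text \<open>Vertices provide the levels of a shape and edges its transitions; triangles are what
  shows that the transitions compose.\<close>

definition triangle :: "nat \<Rightarrow> nat \<Rightarrow> nat \<Rightarrow> nat \<Rightarrow> nat" where
  "triangle i j k = (\<lambda>x\<in>{..2}. if x = 0 then i else if x = 1 then j else k)"

lemma vertex_Hom: "i \<le> n \<Longrightarrow> vertex i \<in> Hom Delta 0 n"
  unfolding vertex_def by (rule Delta_HomI) auto

lemma edge_Hom: "i \<le> j \<Longrightarrow> j \<le> n \<Longrightarrow> edge i j \<in> Hom Delta 1 n"
  unfolding edge_def by (rule Delta_HomI) auto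

lemma triangle_Hom: "i \<le> j \<Longrightarrow> j \<le> k \<Longrightarrow> k \<le> n \<Longrightarrow> triangle i j k \<in> Hom Delta 2 n"
  unfolding triangle_def by (rule Delta_HomI) auto

lemma vertex_simps [simp]: "vertex i 0 = i"
  by (simp add: vertex_def)

lemma edge_simps [simp]: "edge i j 0 = i" "edge i j (Suc 0) = j"
  by (simp_all add: edge_def)

lemma triangle_simps [simp]: "triangle i j k 0 = i" "triangle i j k (Suc 0) = j" "triangle i j k 2 = k"
  by (simp_all add: triangle_def)

lemma compose_vertex: "compose {..0} \<theta> (vertex i) = vertex (\<theta> i)"
  by (auto simp: compose_def vertex_def)

lemma compose_edge: "compose {..1} \<theta> (edge i j) = edge (\<theta> i) (\<theta> j)"
  by (auto simp: compose_def edge_def)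

definition vlen :: "'u simplicial_list \<Rightarrow> nat \<Rightarrow> 'u \<Rightarrow> nat \<Rightarrow> nat" where
  "vlen X n x i = length (on_hom X n 0 (vertex i) x)"

text \<open>Each edge of type (i, j) contributes one bracket, the list of its own 0-th vertices, so
  these numbers are the sizes of the brackets around the i-th vertices of \<open>x\<close>.\<close>

definition lens :: "'u simplicial_list \<Rightarrow> nat \<Rightarrow> 'u \<Rightarrow> nat \<Rightarrow> nat \<Rightarrow> nat list" where
  "lens X n x i j = map (\<lambda>y. vlen X 1 y 0) (on_hom X n 1 (edge i j) x)"

definition shape :: "'u simplicial_list \<Rightarrow> nat \<Rightarrow> 'u \<Rightarrow> chain" where
  "shape X n x = mk_chain n (vlen X n x) (\<lambda>i j. block (lens X n x i j))"

context
  fixes U :: "'u set set" and X :: "'u simplicial_list"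
  assumes X: "X \<in> Obj (sList_Op U)"
begin

lemma act_in: "\<theta> \<in> Hom Delta k n \<Longrightarrow> x \<in> on_ob X n \<Longrightarrow> set (on_hom X n k \<theta> x) \<subseteq> on_ob X k"
  using ftor_hom[of "op_cat Delta" "list_cat U" X n k \<theta>] X
  by (auto simp: sList_Op_simps)

lemma act_Id: "x \<in> on_ob X n \<Longrightarrow> on_hom X n n (\<lambda>i\<in>{..n}. i) x = [x]"
  using ftor_Id[of "op_cat Delta" "list_cat U" X n] X by (simp add: sList_Op_simps)

lemma act_compose:
  "\<theta> \<in> Hom Delta k n \<Longrightarrow> \<eta> \<in> Hom Delta l k \<Longrightarrow> x \<in> on_ob X n \<Longrightarrow>
   on_hom X n l (compose {..l} \<theta> \<eta>) x = concat (map (on_hom X k l \<eta>) (on_hom X n k \<theta> x))"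
  using ftor_Comp[of "op_cat Delta" "list_cat U" X n k l \<theta> \<eta>] X by (simp add: sList_Op_simps)

lemma length_act_top: "\<theta> \<in> Hom Delta k n \<Longrightarrow> \<theta> k = n \<Longrightarrow> x \<in> on_ob X n \<Longrightarrow> length (on_hom X n k \<theta> x) = 1"
  using X by (auto simp: sList_Op_simps operadic_def is_function_def)

lemma vlen_top: "x \<in> on_ob X n \<Longrightarrow> vlen X n x n = 1"
  by (simp add: vlen_def length_act_top vertex_Hom)

text \<open>The vertices of \<open>x\<close> of index \<open>\<theta> k\<close> are the last
  vertices of the entries of \<theta>* x, concatenated, and operadicity gives each entry exactly one
  last vertex.\<close>

lemma length_act:
  assumes \<theta>: "\<theta> \<in> Hom Delta k n" and x: "x \<in> on_ob X n"
  shows "length (on_hom X n k \<theta> x) = vlen X n x (\<theta> k)"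
proof -
  have "vlen X n x (\<theta> k) = sum_list (map (\<lambda>y. vlen X k y k) (on_hom X n k \<theta> x))"
    unfolding vlen_def compose_vertex[symmetric] act_compose[OF \<theta> vertex_Hom[OF order_refl] x]
    by (simp add: length_concat o_def)
  also have "map (\<lambda>y. vlen X k y k) (on_hom X n k \<theta> x) = map (\<lambda>y. 1) (on_hom X n k \<theta> x)"
    using act_in[OF \<theta> x] by (auto simp: vlen_top)
  finally show ?thesis by (simp add: sum_list_triv)
qed

lemma length_lens:
  assumes "i \<le> j" "j \<le> n" "x \<in> on_ob X n"
  shows "length (lens X n x i j) = vlen X n x j"
  using length_act[OF edge_Hom[OF assms(1,2)] assms(3)] by (simp add: lens_def)

text \<open>The vertex i is the 0-th vertex of the edge (i, j), so the brackets exhaust the list of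
  i-th vertices.\<close>

lemma sum_lens:
  assumes "i \<le> j" "j \<le> n" "x \<in> on_ob X n"
  shows "sum_list (lens X n x i j) = vlen X n x i"
proof -
  have "on_hom X n 0 (vertex i) x = concat (map (on_hom X 1 0 (vertex 0)) (on_hom X n 1 (edge i j) x))"
    using act_compose[OF edge_Hom[OF assms(1,2)] vertex_Hom[of 0 1] assms(3)] by (simp add: compose_vertex del: atMost_0)
  then show ?thesis by (simp add: lens_def vlen_def length_concat o_def)
qed

lemma lens_act:
  assumes \<theta>: "\<theta> \<in> Hom Delta k n" and x: "x \<in> on_ob X n" and ij: "i \<le> j" "j \<le> k"
  shows "lens X n x (\<theta> i) (\<theta> j) = concat (map (\<lambda>y. lens X k y i j) (on_hom X n k \<theta> x))"
  unfolding lens_def compose_edge[symmetric] act_compose[OF \<theta> edge_Hom[OF ij] x]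
  by (simp add: map_concat o_def)

lemma lens_top:
  assumes "i \<le> n" "x \<in> on_ob X n"
  shows "lens X n x i n = [vlen X n x i]"
  using length_lens[OF assms(1) order_refl assms(2)] sum_lens[OF assms(1) order_refl assms(2)]
  by (auto simp: vlen_top assms(2) length_Suc_conv)

text \<open>A k-simplex has a single last vertex, so each entry of \<theta>* x contributes a single
  bracket that contains all its i-th vertices. Hence the fibre over position a has the size of level
  i of the shape of entry a.\<close>

lemma lens_act_top:
  assumes \<theta>: "\<theta> \<in> Hom Delta k n" and x: "x \<in> on_ob X n" and i: "i \<le> k"
  shows "lens X n x (\<theta> i) (\<theta> k) = map (\<lambda>y. vlen X k y i) (on_hom X n k \<theta> x)"
proof -
  have "map (\<lambda>y. lens X k y i k) (on_hom X n k \<theta> x) = map (\<lambda>y. [vlen X k y i]) (on_hom X n k \<theta> x)"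
    using act_in[OF \<theta> x] by (auto simp: lens_top i)
  then show ?thesis
    unfolding lens_act[OF \<theta> x i order_refl] by (simp only: concat_map_singleton)
qed

text \<open>The edge (i, i) factors through a 0-simplex, whose only vertex is its last one. So every
  bracket has length 1, and the transition from a level to itself is the identity.\<close>

lemma lens_refl:
  assumes "i \<le> n" "x \<in> on_ob X n"
  shows "lens X n x i i = replicate (vlen X n x i) 1"
proof -
  have "map (\<lambda>y. vlen X 0 y 0) (on_hom X n 0 (vertex i) x) = map (\<lambda>y. 1) (on_hom X n 0 (vertex i) x)"
    using act_in[OF vertex_Hom[OF assms(1)] assms(2)] by (auto simp: vlen_top)
  then show ?thesis
    using lens_act_top[OF vertex_Hom[OF assms(1)] assms(2), of 0] by (simp add: map_replicate_const vlen_def)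
qed

lemma shape_ob [simp]: "i \<le> n \<Longrightarrow> on_ob (shape X n x) i = vlen X n x i"
  by (simp add: shape_def)

lemma shape_transition [simp]:
  "i \<le> j \<Longrightarrow> j \<le> n \<Longrightarrow> p < vlen X n x i \<Longrightarrow> transition (shape X n x) i j p = block (lens X n x i j) p"
  by (simp add: shape_def)

lemma shape_nerve:
  assumes x: "x \<in> on_ob X n"
  shows "shape X n x \<in> nerve_Delta_plus n"
  unfolding shape_def
proof (rule mk_chain_nerve)
  fix i j p assume "i \<le> j" "j \<le> n" "p < vlen X n x i"
  then show "block (lens X n x i j) p < vlen X n x j"
    using block_less[of p "lens X n x i j"] by (simp add: length_lens sum_lens x)
next
  fix i p assume "i \<le> n" "p < vlen X n x i"
  then show "block (lens X n x i i) p = p" by (simp add: lens_refl x block_replicate_1)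
next
  fix i j k p assume *: "i \<le> j" "j \<le> k" "k \<le> n" "p < vlen X n x i"
  note T = triangle_Hom[OF *(1-3)]
  \<comment> \<open>Grouping the edges (i, j) of \<open>x\<close> by the triangles (i, j, k)
    produces one list of lists: its concatenation gives the sizes for (i, j), its lengths those for
    (j, k), and its sums those for (i, k). This is the situation of
    \<open>block_block\<close>.\<close>
  let ?zs = "on_hom X n 2 (triangle i j k) x"
  let ?LL = "map (\<lambda>z. lens X 2 z 0 1) ?zs"
  have "lens X n x i j = concat ?LL" using lens_act[OF T x, of 0 1] by simp
  moreover have "lens X n x j k = map length ?LL"
    using lens_act_top[OF T x, of 1] act_in[OF T x] by (auto simp: length_lens)
  moreover have "lens X n x i k = map sum_list ?LL"
    using lens_act_top[OF T x, of 0] act_in[OF T x] by (auto simp: sum_lens)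
  moreover have "p < sum_list (lens X n x i j)" using * x by (simp add: sum_lens)
  ultimately show "block (lens X n x j k) (block (lens X n x i j) p) = block (lens X n x i k) p"
    using block_block[of p ?LL] by simp
qed (rule block_mono)

lemma shape_rooted: "x \<in> on_ob X n \<Longrightarrow> (n, shape X n x) \<in> rooted_simplices"
  by (simp add: rooted_iff shape_nerve vlen_top)

text \<open>If the vertices of \<open>x\<close> of index \<open>\<theta> i\<close> are listed entry
  by entry of \<theta>* x, those of entry \<open>a\<close> form an interval following those of the
  earlier entries. The resulting shifts are strictly increasing onto the fibre over \<open>a\<close>
  and respect the transitions, so the universal property of restrictions yields both claims.\<close>

lemma
  assumes \<theta>: "\<theta> \<in> Hom Delta k n" and x: "x \<in> on_ob X n" and a: "a < vlen X n x (\<theta> k)"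
  shows face_shape: "face k \<theta> (shape X n x) a = shape X k (on_hom X n k \<theta> x ! a)"
    and face_incl_shape: "\<And>i p. i \<le> k \<Longrightarrow> p < vlen X k (on_hom X n k \<theta> x ! a) i \<Longrightarrow>
      face_incl k \<theta> (shape X n x) a i p = sum_list (map (\<lambda>y. vlen X k y i) (take a (on_hom X n k \<theta> x))) + p"
proof -
  let ?ys = "on_hom X n k \<theta> x" let ?y = "?ys ! a"
  let ?g = "\<lambda>i p. sum_list (map (\<lambda>y. vlen X k y i) (take a ?ys)) + p"
  have a': "a < length ?ys" using a by (simp add: length_act[OF \<theta> x])
  have y: "?y \<in> on_ob X k" using act_in[OF \<theta> x] a' by auto
  have ys: "\<And>y. y \<in> set ?ys \<Longrightarrow> y \<in> on_ob X k" using act_in[OF \<theta> x] by auto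
  note \<gamma> = pull_chain_nerve[OF shape_nerve[OF x] \<theta>]
  note \<delta> = shape_nerve[OF y]
  have mono: "strict_mono_on {..<on_ob (shape X k ?y) i} (?g i)" for i by (simp add: strict_mono_on_def)
  have img: "?g i ` {..<on_ob (shape X k ?y) i} = fibre k (pull_chain k \<theta> (shape X n x)) a i" if i: "i \<le> k" for i
  proof -
    have ti: "\<theta> i \<le> \<theta> k" "\<theta> k \<le> n" "\<theta> i \<le> n"
      using Delta_mono[OF \<theta> i order_refl] Delta_le[OF \<theta>] i by auto
    have "fibre k (pull_chain k \<theta> (shape X n x)) a i =
        {p. p < sum_list (lens X n x (\<theta> i) (\<theta> k)) \<and> block (lens X n x (\<theta> i) (\<theta> k)) p = a}"
      using ti by (auto simp: fibre_pull_chain[OF i] sum_lens x)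
    also have "\<dots> = (\<lambda>q. sum_list (take a (lens X n x (\<theta> i) (\<theta> k))) + q) ` {..<lens X n x (\<theta> i) (\<theta> k) ! a}"
      by (rule block_fibre) (use ti a in \<open>simp add: length_lens x\<close>)
    also have "\<dots> = ?g i ` {..<on_ob (shape X k ?y) i}"
      using a' i by (simp add: lens_act_top[OF \<theta> x i] take_map)
    finally show ?thesis by simp
  qed
  have sq: "?g j (transition (shape X k ?y) i j p) = transition (pull_chain k \<theta> (shape X n x)) i j (?g i p)"
    if ij: "i \<le> j" "j \<le> k" and p: "p < on_ob (shape X k ?y) i" for i j p
  proof -
    have i: "i \<le> k" using ij by simp
    have ti: "\<theta> i \<le> \<theta> j" "\<theta> j \<le> n" "\<theta> i \<le> n"
      using Delta_mono[OF \<theta> ij] Delta_le[OF \<theta>] ij by auto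
    have p': "p < vlen X k ?y i" using p i by simp
    have "?g i p \<in> fibre k (pull_chain k \<theta> (shape X n x)) a i" using img[OF i] p by blast
    then have g: "?g i p < vlen X n x (\<theta> i)" using i ti by (simp add: fibre_pull_chain)
    let ?LL = "map (\<lambda>y. lens X k y i j) ?ys"
    have tk: "\<And>y. y \<in> set (take a ?ys) \<Longrightarrow> y \<in> on_ob X k" using ys by (meson in_set_takeD)
    have 1: "map sum_list (take a ?LL) = map (\<lambda>y. vlen X k y i) (take a ?ys)"
      using tk by (auto simp: take_map sum_lens[OF ij])
    have 2: "map length (take a ?LL) = map (\<lambda>y. vlen X k y j) (take a ?ys)"
      using tk by (auto simp: take_map length_lens[OF ij])
    have "block (concat ?LL) (?g i p) = ?g j (block (?LL ! a) p)"
      using block_offset[of a ?LL p] a' p' y unfolding 1 2 by (simp add: sum_lens[OF ij])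
    then show ?thesis
      using ij ti g p' a' by (simp add: lens_act[OF \<theta> x ij])
  qed
  show "face k \<theta> (shape X n x) a = shape X k ?y"
    by (rule restrict_chain_unique[OF \<gamma> \<delta> mono img sq])
  show "face_incl k \<theta> (shape X n x) a i p = ?g i p" if "i \<le> k" "p < vlen X k ?y i" for i p
    by (rule fibre_incl_unique[OF \<gamma> \<delta> mono img sq]) (use that in simp_all)
qed

text \<open>Functoriality, entry by entry: the inclusion of the face computes the index at which
  entry \<open>b\<close> of the \<open>a\<close>-th list lands after concatenation. This is the
  composition law of the presheaf.\<close>

lemma act_compose_nth:
  assumes \<theta>: "\<theta> \<in> Hom Delta k n" and x: "x \<in> on_ob X n" and a: "a < vlen X n x (\<theta> k)"
    and \<eta>: "\<eta> \<in> Hom Delta l k" and b: "b < vlen X k (on_hom X n k \<theta> x ! a) (\<eta> l)"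
  shows "on_hom X n l (compose {..l} \<theta> \<eta>) x ! face_incl k \<theta> (shape X n x) a (\<eta> l) b =
    on_hom X k l \<eta> (on_hom X n k \<theta> x ! a) ! b"
proof -
  let ?ys = "on_hom X n k \<theta> x"
  have a': "a < length ?ys" using a by (simp add: length_act[OF \<theta> x])
  have y: "?ys ! a \<in> on_ob X k" using act_in[OF \<theta> x] a' by auto
  have off: "map (\<lambda>y. vlen X k y (\<eta> l)) (take a ?ys) = map (\<lambda>y. length (on_hom X k l \<eta> y)) (take a ?ys)"
    using act_in[OF \<theta> x] by (auto simp: length_act[OF \<eta>] dest!: in_set_takeD)
  show ?thesis
    unfolding face_incl_shape[OF \<theta> x a Delta_le[OF \<eta> order_refl] b] act_compose[OF \<theta> \<eta> x] off
    by (rule concat_map_nth[OF a']) (use b y in \<open>simp add: length_act[OF \<eta>]\<close>)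
qed

end

section \<open>Operadic simplicial lists as presheaves\<close>

definition elems :: "'u simplicial_list \<Rightarrow> nat \<Rightarrow> chain \<Rightarrow> 'u set" where
  "elems X n \<alpha> = {x \<in> on_ob X n. shape X n x = \<alpha>}"

definition presheaf_of ::
  "'u simplicial_list \<Rightarrow> (nat \<times> chain, (nat \<Rightarrow> nat) \<times> nat, 'u set, 'u \<Rightarrow> 'u) ftor" where
  "presheaf_of X = mk_ftor (op_cat rooted_simplex_cat) (\<lambda>(n, \<alpha>). elems X n \<alpha>)
     (\<lambda>(n, \<alpha>) (k, \<beta>) (\<theta>, a). \<lambda>x\<in>elems X n \<alpha>. on_hom X n k \<theta> x ! a)"

lemma presheaf_of_ob [simp]: "(n, \<alpha>) \<in> rooted_simplices \<Longrightarrow> on_ob (presheaf_of X) (n, \<alpha>) = elems X n \<alpha>"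
  by (simp add: presheaf_of_def)

lemma presheaf_of_hom [simp]:
  "(n, \<alpha>) \<in> rooted_simplices \<Longrightarrow> (k, \<beta>) \<in> rooted_simplices \<Longrightarrow>
   (\<theta>, a) \<in> Hom rooted_simplex_cat (k, \<beta>) (n, \<alpha>) \<Longrightarrow>
   on_hom (presheaf_of X) (n, \<alpha>) (k, \<beta>) (\<theta>, a) = (\<lambda>x\<in>elems X n \<alpha>. on_hom X n k \<theta> x ! a)"
  by (simp add: presheaf_of_def)

context
  fixes U :: "'u set set" and X :: "'u simplicial_list"
  assumes X: "X \<in> Obj (sList_Op U)"
begin

text \<open>For an element of shape \<open>\<alpha>\<close>, a morphism into \<open>\<alpha>\<close>
  selects a position in one of its lists \<theta>* x, and the source of the morphism is forced to be
  the shape of the entry found there.\<close>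

lemma elems_vlen:
  assumes "(\<theta>, a) \<in> Hom rooted_simplex_cat (k, \<beta>) (n, \<alpha>)" "x \<in> elems X n \<alpha>"
  shows "\<theta> \<in> Hom Delta k n" "x \<in> on_ob X n" "\<alpha> = shape X n x" "a < vlen X n x (\<theta> k)"
    "\<beta> = shape X k (on_hom X n k \<theta> x ! a)"
proof -
  show *: "\<theta> \<in> Hom Delta k n" "x \<in> on_ob X n" "\<alpha> = shape X n x" using assms by (auto simp: elems_def rooted_simplex_cat_Hom)
  show a: "a < vlen X n x (\<theta> k)"
    using assms * shape_ob[OF X Delta_le[OF *(1) order_refl]] by (auto simp: elems_def rooted_simplex_cat_Hom)
  show "\<beta> = shape X k (on_hom X n k \<theta> x ! a)"
    using assms(1) face_shape[OF X *(1,2) a] by (simp add: rooted_simplex_cat_Hom *(3))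
qed

lemma act_elems:
  assumes "(\<theta>, a) \<in> Hom rooted_simplex_cat (k, \<beta>) (n, \<alpha>)" "x \<in> elems X n \<alpha>"
  shows "on_hom X n k \<theta> x ! a \<in> elems X k \<beta>"
proof -
  note * = elems_vlen[OF assms]
  have "on_hom X n k \<theta> x ! a \<in> set (on_hom X n k \<theta> x)"
    using *(4) by (simp add: length_act[OF X *(1,2)])
  then show ?thesis using act_in[OF X *(1,2)] *(5) by (auto simp: elems_def)
qed

lemma act_elems_compose:
  assumes \<theta>: "(\<theta>, a) \<in> Hom rooted_simplex_cat (k, \<beta>) (n, \<alpha>)"
    and \<eta>: "(\<eta>, b) \<in> Hom rooted_simplex_cat (l, \<gamma>) (k, \<beta>)" and x: "x \<in> elems X n \<alpha>"
  shows "on_hom X n l (compose {..l} \<theta> \<eta>) x ! face_incl k \<theta> \<alpha> a (\<eta> l) b =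
    on_hom X k l \<eta> (on_hom X n k \<theta> x ! a) ! b"
  using elems_vlen[OF \<theta> x] elems_vlen[OF \<eta> act_elems[OF \<theta> x]] act_compose_nth[OF X] by metis

lemma is_ftor_presheaf_of:
  assumes U: "set_universe U"
  shows "is_ftor (op_cat rooted_simplex_cat) (set_cat U) (presheaf_of X)"
  unfolding presheaf_of_def
proof (rule is_ftor_mk_ftor[OF category_op_cat[OF category_rooted_simplex_cat]]; clarsimp)
  fix n \<alpha>
  have "on_ob X n \<in> U"
    using X ftor_ob[of "op_cat Delta" "list_cat U" X n] by (simp add: sList_Op_simps)
  then show "elems X n \<alpha> \<in> U"
    by (rule set_universe_subset[OF U]) (auto simp: elems_def)
next
  fix n \<alpha> k \<beta> \<theta> a x assume "(\<theta>, a) \<in> Hom rooted_simplex_cat (k, \<beta>) (n, \<alpha>)" "x \<in> elems X n \<alpha>"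
  then show "on_hom X n k \<theta> x ! a \<in> elems X k \<beta>" by (rule act_elems)
next
  fix n \<alpha>
  show "(\<lambda>x\<in>elems X n \<alpha>. on_hom X n n (\<lambda>i\<in>{..n}. i) x ! 0) = (\<lambda>a\<in>elems X n \<alpha>. a)"
    by (rule restrict_ext) (simp add: elems_def act_Id[OF X])
next
  fix n \<alpha> k \<beta> l \<gamma> \<theta> a \<eta> b
  assume "(\<theta>, a) \<in> Hom rooted_simplex_cat (k, \<beta>) (n, \<alpha>)" "(\<eta>, b) \<in> Hom rooted_simplex_cat (l, \<gamma>) (k, \<beta>)"
  then show "(\<lambda>x\<in>elems X n \<alpha>. on_hom X n l (compose {..l} \<theta> \<eta>) x ! face_incl k \<theta> \<alpha> a (\<eta> l) b) =
    compose (elems X n \<alpha>) (\<lambda>x\<in>elems X k \<beta>. on_hom X k l \<eta> x ! b) (\<lambda>x\<in>elems X n \<alpha>. on_hom X n k \<theta> x ! a)"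
    by (auto simp: compose_def[of "elems X n \<alpha>"] act_elems act_elems_compose intro!: restrict_ext)
qed

end

section \<open>Morphisms of simplicial lists and preservation of shapes\<close>

context
  fixes U :: "'u set set" and X Y :: "'u simplicial_list"
  assumes X: "X \<in> Obj (sList_Op U)" and Y: "Y \<in> Obj (sList_Op U)"
begin

lemma hom_act:
  assumes \<sigma>: "\<sigma> \<in> Hom (sList_Op U) X Y" and \<theta>: "\<theta> \<in> Hom Delta k n" and x: "x \<in> on_ob X n"
  shows "on_hom Y n k \<theta> (hd (\<sigma> n x)) = map (\<lambda>y. hd (\<sigma> k y)) (on_hom X n k \<theta> x)"
proof -
  have "\<sigma> \<in> nat_trans (op_cat Delta) (list_cat U) X Y" using \<sigma> by (simp add: sList_Op_simps)
  from nat_trans_natural[OF this, of n k \<theta>]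
  have "concat (map (\<sigma> k) (on_hom X n k \<theta> x)) = concat (map (on_hom Y n k \<theta>) (\<sigma> n x))"
    using \<theta> x by (auto dest: fun_cong[of _ _ x])
  moreover have "map (\<sigma> k) (on_hom X n k \<theta> x) = map (\<lambda>y. [hd (\<sigma> k y)]) (on_hom X n k \<theta> x)"
    using act_in[OF X \<theta> x] by (intro map_cong refl sList_Op_hom_apply(1)[OF \<sigma>]) auto
  moreover have "concat (map (on_hom Y n k \<theta>) (\<sigma> n x)) = on_hom Y n k \<theta> (hd (\<sigma> n x))"
    by (subst sList_Op_hom_apply(1)[OF \<sigma> x]) simp
  ultimately show ?thesis by (simp only: concat_map_singleton)
qed

text \<open>A shape is built from lengths of lists alone, and a morphism replaces lists entry by
  entry, so it preserves all these lengths.\<close>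

lemma hom_shape:
  assumes \<sigma>: "\<sigma> \<in> Hom (sList_Op U) X Y" and x: "x \<in> on_ob X n"
  shows "shape Y n (hd (\<sigma> n x)) = shape X n x"
proof -
  \<comment> \<open>Quantified over dimension and element, because \<open>lens\<close> also applies
    it to the edges of \<open>x\<close>.\<close>
  have vlen: "vlen Y n (hd (\<sigma> n x)) i = vlen X n x i" if "i \<le> n" "x \<in> on_ob X n" for n i x
    using hom_act[OF \<sigma> vertex_Hom[OF that(1)] that(2)] by (simp add: vlen_def)
  have lens: "lens Y n (hd (\<sigma> n x)) i j = lens X n x i j" if ij: "i \<le> j" "j \<le> n" for i j
    unfolding lens_def hom_act[OF \<sigma> edge_Hom[OF ij] x] map_map
    using act_in[OF X edge_Hom[OF ij] x] vlen[of 0 1] by auto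
  show ?thesis
  proof (rule chain_eqI[OF shape_nerve[OF Y sList_Op_hom_apply(2)[OF \<sigma> x]] shape_nerve[OF X x]])
    fix i j p assume "i \<le> j" "j \<le> n" "p < on_ob (shape Y n (hd (\<sigma> n x))) i"
    then show "transition (shape Y n (hd (\<sigma> n x))) i j p = transition (shape X n x) i j p"
      by (simp add: shape_ob[OF X] shape_ob[OF Y] shape_transition[OF X] shape_transition[OF Y] vlen lens x)
  qed (simp add: shape_ob[OF X] shape_ob[OF Y] vlen x)
qed

text \<open>Converse to \<open>hom_act\<close>: once singletons are unwrapped, a morphism is a
  family of maps on elements that commutes with the lists entrywise.\<close>

lemma sList_Op_homI:
  assumes t: "\<And>n x. x \<in> on_ob X n \<Longrightarrow> t n x \<in> on_ob Y n"
    and act: "\<And>k n \<theta> x. \<theta> \<in> Hom Delta k n \<Longrightarrow> x \<in> on_ob X n \<Longrightarrow>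
      on_hom Y n k \<theta> (t n x) = map (t k) (on_hom X n k \<theta> x)"
  shows "(\<lambda>n. \<lambda>x\<in>on_ob X n. [t n x]) \<in> Hom (sList_Op U) X Y"
proof -
  have "(\<lambda>n\<in>Obj (op_cat Delta). \<lambda>x\<in>on_ob X n. [t n x]) \<in> nat_trans (op_cat Delta) (list_cat U) X Y"
  proof (rule restrict_nat_transI)
    fix n k \<theta> assume "\<theta> \<in> Hom (op_cat Delta) n k"
    then have \<theta>: "\<theta> \<in> Hom Delta k n" by simp
    have "map (\<lambda>x\<in>on_ob X k. [t k x]) (on_hom X n k \<theta> x) = map (\<lambda>y. [t k y]) (on_hom X n k \<theta> x)"
      if "x \<in> on_ob X n" for x
      using act_in[OF X \<theta> that] by auto
    then show "Comp (list_cat U) (on_ob X n) (on_ob X k) (on_ob Y k) (\<lambda>x\<in>on_ob X k. [t k x]) (on_hom X n k \<theta>) =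
      Comp (list_cat U) (on_ob X n) (on_ob Y n) (on_ob Y k) (on_hom Y n k \<theta>) (\<lambda>x\<in>on_ob X n. [t n x])"
      by (auto simp: act[OF \<theta>] concat_map_singleton simp del: map_eq_conv intro!: restrict_ext)
  qed (use t in auto)
  then show ?thesis by (simp add: sList_Op_simps is_function_def restrict_UNIV)
qed

end

definition presheaf_ftor ::
  "'u set set \<Rightarrow> ('u simplicial_list, nat \<Rightarrow> 'u \<Rightarrow> 'u list,
     (nat \<times> chain, (nat \<Rightarrow> nat) \<times> nat, 'u set, 'u \<Rightarrow> 'u) ftor, nat \<times> chain \<Rightarrow> 'u \<Rightarrow> 'u) ftor" where
  "presheaf_ftor U = mk_ftor (sList_Op U) presheaf_of
     (\<lambda>X Y \<sigma>. \<lambda>p\<in>rooted_simplices. \<lambda>x\<in>elems X (fst p) (snd p). hd (\<sigma> (fst p) x))"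

lemma hom_elems:
  assumes "X \<in> Obj (sList_Op U)" "Y \<in> Obj (sList_Op U)" "\<sigma> \<in> Hom (sList_Op U) X Y" "x \<in> elems X n \<alpha>"
  shows "hd (\<sigma> n x) \<in> elems Y n \<alpha>"
  using assms hom_shape[OF assms(1-3), of x n] sList_Op_hom_apply(2)[OF assms(3), of x n]
  by (simp add: elems_def)

lemma is_ftor_presheaf_ftor:
  assumes U: "set_universe U"
  shows "is_ftor (sList_Op U) (ftor_cat (op_cat rooted_simplex_cat) (set_cat U)) (presheaf_ftor U)"
  unfolding presheaf_ftor_def
proof (rule is_ftor_mk_ftor[OF category_sList_Op])
  fix X assume X: "X \<in> Obj (sList_Op U)"
  then show "presheaf_of X \<in> Obj (ftor_cat (op_cat rooted_simplex_cat) (set_cat U))"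
    by (simp add: is_ftor_presheaf_of[OF X U])
  show "(\<lambda>p\<in>rooted_simplices. \<lambda>x\<in>elems X (fst p) (snd p). hd (Id (sList_Op U) X (fst p) x)) =
      Id (ftor_cat (op_cat rooted_simplex_cat) (set_cat U)) (presheaf_of X)"
    by (auto simp: sList_Op_simps(3) elems_def intro!: restrict_ext)
next
  fix X Y \<sigma> assume X: "X \<in> Obj (sList_Op U)" and Y: "Y \<in> Obj (sList_Op U)" and \<sigma>: "\<sigma> \<in> Hom (sList_Op U) X Y"
  let ?\<tau> = "\<lambda>p. \<lambda>x\<in>elems X (fst p) (snd p). hd (\<sigma> (fst p) x)"
  have "(\<lambda>p\<in>Obj (op_cat rooted_simplex_cat). ?\<tau> p) \<in>
    nat_trans (op_cat rooted_simplex_cat) (set_cat U) (presheaf_of X) (presheaf_of Y)"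
  proof (rule restrict_nat_transI; clarsimp)
    show "hd (\<sigma> n x) \<in> elems Y n \<alpha>" if "x \<in> elems X n \<alpha>" for n \<alpha> x
      by (rule hom_elems[OF X Y \<sigma> that])
  next
    fix n \<alpha> k \<beta> \<theta> a assume f: "(\<theta>, a) \<in> Hom rooted_simplex_cat (k, \<beta>) (n, \<alpha>)"
    have "hd (\<sigma> k (on_hom X n k \<theta> x ! a)) = on_hom Y n k \<theta> (hd (\<sigma> n x)) ! a" if x: "x \<in> elems X n \<alpha>" for x
      using elems_vlen[OF X f x] by (simp add: hom_act[OF X Y \<sigma>] length_act[OF X])
    then show "compose (elems X n \<alpha>) (\<lambda>x\<in>elems X k \<beta>. hd (\<sigma> k x)) (\<lambda>x\<in>elems X n \<alpha>. on_hom X n k \<theta> x ! a) =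
      compose (elems X n \<alpha>) (\<lambda>x\<in>elems Y n \<alpha>. on_hom Y n k \<theta> x ! a) (\<lambda>x\<in>elems X n \<alpha>. hd (\<sigma> n x))"
      by (auto simp: compose_def act_elems[OF X f] hom_elems[OF X Y \<sigma>] intro!: restrict_ext)
  qed
  then show "(\<lambda>p\<in>rooted_simplices. ?\<tau> p) \<in>
    Hom (ftor_cat (op_cat rooted_simplex_cat) (set_cat U)) (presheaf_of X) (presheaf_of Y)" by simp
next
  fix X Y Z \<tau> \<sigma> assume X: "X \<in> Obj (sList_Op U)" and Y: "Y \<in> Obj (sList_Op U)"
    and \<tau>: "\<tau> \<in> Hom (sList_Op U) X Y"
  have "hd (Comp (sList_Op U) X Y Z \<sigma> \<tau> n x) = hd (\<sigma> n (hd (\<tau> n x)))" if x: "x \<in> on_ob X n" for n x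
  proof -
    obtain y where "\<tau> n x = [y]" using sList_Op_hom_apply(1)[OF \<tau> x] by metis
    then show ?thesis using x by (simp add: sList_Op_simps(4))
  qed
  then show "(\<lambda>p\<in>rooted_simplices. \<lambda>x\<in>elems X (fst p) (snd p). hd (Comp (sList_Op U) X Y Z \<sigma> \<tau> (fst p) x)) =
    Comp (ftor_cat (op_cat rooted_simplex_cat) (set_cat U)) (presheaf_of X) (presheaf_of Y) (presheaf_of Z)
      (\<lambda>p\<in>rooted_simplices. \<lambda>x\<in>elems Y (fst p) (snd p). hd (\<sigma> (fst p) x))
      (\<lambda>p\<in>rooted_simplices. \<lambda>x\<in>elems X (fst p) (snd p). hd (\<tau> (fst p) x))"
    using hom_elems[OF X Y \<tau>] by (auto simp: compose_def elems_def intro!: restrict_ext)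
qed

text \<open>Faithful, because every element occurs at its own shape. Full, because the components of
  a presheaf map can be glued over all shapes: as shapes are kept, both sides of the required
  equation of lists have the same length, and their entries agree by naturality at the morphisms
  (\<theta>, a).\<close>

lemma fully_faithful_presheaf_ftor:
  assumes U: "set_universe U"
  shows "fully_faithful (sList_Op U) (ftor_cat (op_cat rooted_simplex_cat) (set_cat U)) (presheaf_ftor U)"
proof (rule fully_faithfulI[OF is_ftor_presheaf_ftor[OF U]])
  fix X Y \<sigma> \<tau> assume X: "X \<in> Obj (sList_Op U)" and Y: "Y \<in> Obj (sList_Op U)"
    and \<sigma>: "\<sigma> \<in> Hom (sList_Op U) X Y" and \<tau>: "\<tau> \<in> Hom (sList_Op U) X Y"
    and "on_hom (presheaf_ftor U) X Y \<sigma> = on_hom (presheaf_ftor U) X Y \<tau>"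
  then have eq: "(\<lambda>p\<in>rooted_simplices. \<lambda>x\<in>elems X (fst p) (snd p). hd (\<sigma> (fst p) x)) =
    (\<lambda>p\<in>rooted_simplices. \<lambda>x\<in>elems X (fst p) (snd p). hd (\<tau> (fst p) x))"
    by (simp add: presheaf_ftor_def)
  have hd: "hd (\<sigma> n x) = hd (\<tau> n x)" if "x \<in> on_ob X n" for n x
    using fun_cong[OF fun_cong[OF eq, of "(n, shape X n x)"], of x] that shape_rooted[OF X that]
    by (simp add: elems_def)
  show "\<sigma> = \<tau>"
  proof (rule nat_trans_eqI)
    show \<sigma>': "\<sigma> \<in> nat_trans (op_cat Delta) (list_cat U) X Y" and \<tau>': "\<tau> \<in> nat_trans (op_cat Delta) (list_cat U) X Y"
      using \<sigma> \<tau> by (simp_all add: sList_Op_simps)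
    show "\<sigma> n = \<tau> n" for n
    proof (rule extensionalityI[of _ "on_ob X n"])
      show "\<sigma> n \<in> extensional (on_ob X n)" "\<tau> n \<in> extensional (on_ob X n)"
        using nat_trans_in[OF \<sigma>', of n] nat_trans_in[OF \<tau>', of n] by (auto simp: PiE_def)
      show "\<sigma> n x = \<tau> n x" if "x \<in> on_ob X n" for x
        using sList_Op_hom_apply(1)[OF \<sigma> that] sList_Op_hom_apply(1)[OF \<tau> that] hd[OF that] by metis
    qed
  qed
next
  fix X Y T assume X: "X \<in> Obj (sList_Op U)" and Y: "Y \<in> Obj (sList_Op U)"
    and "T \<in> Hom (ftor_cat (op_cat rooted_simplex_cat) (set_cat U)) (on_ob (presheaf_ftor U) X) (on_ob (presheaf_ftor U) Y)"
  then have T: "T \<in> nat_trans (op_cat rooted_simplex_cat) (set_cat U) (presheaf_of X) (presheaf_of Y)"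
    by (simp add: presheaf_ftor_def)
  have Tin: "T (n, \<alpha>) \<in> elems X n \<alpha> \<rightarrow>\<^sub>E elems Y n \<alpha>" if "(n, \<alpha>) \<in> rooted_simplices" for n \<alpha>
    using nat_trans_in[OF T, of "(n, \<alpha>)"] that by simp
  define t where "t n x = T (n, shape X n x) x" for n x
  have t: "t n x \<in> elems Y n (shape X n x)" if x: "x \<in> on_ob X n" for n x
    unfolding t_def using PiE_mem[OF Tin[OF shape_rooted[OF X x]], of x] x by (simp add: elems_def)
  have act: "on_hom Y n k \<theta> (t n x) = map (t k) (on_hom X n k \<theta> x)"
    if \<theta>: "\<theta> \<in> Hom Delta k n" and x: "x \<in> on_ob X n" for k n \<theta> x
  proof -
    have tx: "t n x \<in> on_ob Y n" "shape Y n (t n x) = shape X n x" using t[OF x] by (auto simp: elems_def)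
    have len: "vlen Y n (t n x) (\<theta> k) = vlen X n x (\<theta> k)"
      using arg_cong[OF tx(2), of "\<lambda>\<alpha>. on_ob \<alpha> (\<theta> k)"] Delta_le[OF \<theta>, of k]
      by (simp add: shape_ob[OF X] shape_ob[OF Y])
    show ?thesis
    proof (rule nth_equalityI)
      show "length (on_hom Y n k \<theta> (t n x)) = length (map (t k) (on_hom X n k \<theta> x))"
        by (simp add: length_act[OF X \<theta> x] length_act[OF Y \<theta> tx(1)] len)
    next
      fix a assume "a < length (on_hom Y n k \<theta> (t n x))"
      then have a: "a < vlen X n x (\<theta> k)" by (simp add: length_act[OF Y \<theta> tx(1)] len)
      let ?y = "on_hom X n k \<theta> x ! a"
      have f: "(\<theta>, a) \<in> Hom rooted_simplex_cat (k, shape X k ?y) (n, shape X n x)"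
        using \<theta> a Delta_le[OF \<theta>, of k] by (simp add: rooted_simplex_cat_Hom face_shape[OF X \<theta> x a] shape_ob[OF X])
      have y: "?y \<in> elems X k (shape X k ?y)"
        by (rule act_elems[OF X f]) (simp add: elems_def x)
      have r: "(k, shape X k ?y) \<in> rooted_simplices" "(n, shape X n x) \<in> rooted_simplices"
        using y x by (simp_all add: shape_rooted[OF X] elems_def)
      have "compose (elems X n (shape X n x)) (T (k, shape X k ?y)) (\<lambda>x\<in>elems X n (shape X n x). on_hom X n k \<theta> x ! a) =
        compose (elems X n (shape X n x)) (\<lambda>x\<in>elems Y n (shape X n x). on_hom Y n k \<theta> x ! a) (T (n, shape X n x))"
        using nat_trans_natural[OF T, of "(n, shape X n x)" "(k, shape X k ?y)" "(\<theta>, a)"] r f by simp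
      from fun_cong[OF this, of x] have "t k ?y = on_hom Y n k \<theta> (t n x) ! a"
        using t[OF x] x by (simp add: compose_def elems_def t_def)
      then show "on_hom Y n k \<theta> (t n x) ! a = map (t k) (on_hom X n k \<theta> x) ! a"
        using a by (simp add: length_act[OF X \<theta> x])
    qed
  qed
  let ?\<sigma> = "\<lambda>n. \<lambda>x\<in>on_ob X n. [t n x]"
  have \<sigma>: "?\<sigma> \<in> Hom (sList_Op U) X Y"
    by (rule sList_Op_homI[OF X Y _ act]) (use t in \<open>auto simp: elems_def\<close>)
  have "on_hom (presheaf_ftor U) X Y ?\<sigma> = T"
  proof (rule nat_trans_eqI)
    show "on_hom (presheaf_ftor U) X Y ?\<sigma> \<in> nat_trans (op_cat rooted_simplex_cat) (set_cat U) (presheaf_of X) (presheaf_of Y)"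
      using ftor_hom[OF is_ftor_presheaf_ftor[OF U] X Y \<sigma>] X Y by (simp add: presheaf_ftor_def)
    show "T \<in> nat_trans (op_cat rooted_simplex_cat) (set_cat U) (presheaf_of X) (presheaf_of Y)" by (rule T)
    fix p assume "p \<in> Obj (op_cat rooted_simplex_cat)"
    then obtain n \<alpha> where p: "p = (n, \<alpha>)" "(n, \<alpha>) \<in> rooted_simplices" by (cases p) auto
    show "on_hom (presheaf_ftor U) X Y ?\<sigma> p = T p"
      using X Y \<sigma> p PiE_arb[OF Tin[OF p(2)]] by (auto simp: presheaf_ftor_def elems_def t_def intro!: ext)
  qed
  then show "\<exists>\<sigma>\<in>Hom (sList_Op U) X Y. on_hom (presheaf_ftor U) X Y \<sigma> = T" using \<sigma> by blast
qed

text \<open>The closure condition on \<open>U\<close> speaks of index sets that belong to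
  \<open>U\<close>, so the countable index set is first coded as such a set.\<close>

lemma set_universe_Sigma:
  fixes U :: "'u set set" and A :: "'i \<Rightarrow> 'u set"
  assumes U: "set_universe U" and I: "countable I" and A: "\<And>i. i \<in> I \<Longrightarrow> A i \<in> U"
  obtains B c where "B \<in> U" "bij_betw c (Sigma I A) B"
proof -
  obtain e :: "'i \<Rightarrow> 'u" where e: "inj_on e I" "e ` I \<in> U" using set_universe_code[OF U I] by blast
  let ?A = "\<lambda>u. A (the_inv_into I e u)"
  have inv: "the_inv_into I e (e i) = i" if "i \<in> I" for i by (rule the_inv_into_f_f[OF e(1) that])
  have "\<forall>u\<in>e ` I. ?A u \<in> U" using A inv by auto
  moreover have "\<forall>I\<in>U. \<forall>A. (\<forall>i\<in>I. A i \<in> U) \<longrightarrow> (\<exists>B\<in>U. B \<approx> Sigma I A)"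
    using U by (simp add: set_universe_def)
  from bspec[OF this e(2), THEN spec, of ?A] calculation
  obtain B where B: "B \<in> U" "B \<approx> Sigma (e ` I) ?A" by blast
  have "bij_betw (map_prod e id) (Sigma I A) (Sigma (e ` I) ?A)"
    unfolding bij_betw_def
  proof
    show "inj_on (map_prod e id) (Sigma I A)" by (auto simp: inj_on_eq_iff[OF e(1)] intro!: inj_onI)
    show "map_prod e id ` Sigma I A = Sigma (e ` I) ?A"
    proof (intro equalityI subsetI)
      fix p assume "p \<in> Sigma (e ` I) ?A"
      then obtain i x where "p = map_prod e id (i, x)" "(i, x) \<in> Sigma I A" by (auto simp: inv)
      then show "p \<in> map_prod e id ` Sigma I A" by (rule image_eqI)
    qed (auto simp: inv)
  qed
  then have "Sigma I A \<approx> B" using B(2) by (meson eqpoll_def eqpoll_sym eqpoll_trans)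
  then show ?thesis using that B(1) by (auto simp: eqpoll_def)
qed

text \<open>The reconstruction is carried out for an arbitrary presheaf \<open>P\<close>.
  Functoriality of the result combines the composition law of \<open>P\<close> with
  \<open>concat_fibres\<close>. It then has to be shown that an element taken from the value of
  \<open>P\<close> at \<alpha> really acquires the shape \<alpha>; this is the purpose of
  \<open>block_fibre_sizes\<close>.\<close>

lemma ess_surj_presheaf_ftor:
  fixes U :: "'u set set"
  assumes U: "set_universe U"
  shows "ess_surj (sList_Op U) (ftor_cat (op_cat rooted_simplex_cat) (set_cat U)) (presheaf_ftor U)"
  unfolding ess_surj_def
proof
  fix P assume "P \<in> Obj (ftor_cat (op_cat rooted_simplex_cat) (set_cat U))"
  then have P: "is_ftor (op_cat rooted_simplex_cat) (set_cat U) P" by simp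
  define S where "S n = Sigma {\<alpha>. (n, \<alpha>) \<in> rooted_simplices} (\<lambda>\<alpha>. on_ob P (n, \<alpha>))" for n
  have "\<exists>B c. B \<in> U \<and> bij_betw c (S n) B" for n
  proof -
    have "countable {\<alpha>. (n, \<alpha>) \<in> rooted_simplices}"
      by (rule countable_subset[OF _ countable_nerve[of n]]) (auto simp: rooted_iff)
    from set_universe_Sigma[OF U this, of "\<lambda>\<alpha>. on_ob P (n, \<alpha>)"] show ?thesis
      unfolding S_def using ftor_ob[OF P] by (metis mem_Collect_eq op_cat_simps(1) rooted_simplex_cat_simps(1) set_cat_simps(1))
  qed
  \<comment> \<open>\<open>S n\<close> consists of pairs that contain a chain, so it is not a set of
    elements of \<open>'u\<close>; \<open>E n\<close> is a copy of it inside the universe, with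
    \<open>c n\<close> as coding.\<close>
  then obtain E c where E: "\<And>n. E n \<in> U" and c: "\<And>n. bij_betw (c n) (S n) (E n)" by metis
  define d where "d n = the_inv_into (S n) (c n)" for n
  have d [simp]: "d n (c n p) = p" if "p \<in> S n" for n p
    unfolding d_def by (rule the_inv_into_f_f[OF bij_betw_imp_inj_on[OF c] that])
  have cE [simp]: "c n p \<in> E n" if "p \<in> S n" for n p using bij_betw_apply[OF c that] .
  have Ec: "\<exists>\<alpha> x. u = c n (\<alpha>, x) \<and> (\<alpha>, x) \<in> S n" if "u \<in> E n" for n u
    using that bij_betw_imp_surj_on[OF c[of n]] by (metis imageE surj_pair)
  have S_iff: "(\<alpha>, x) \<in> S n \<longleftrightarrow> (n, \<alpha>) \<in> rooted_simplices \<and> x \<in> on_ob P (n, \<alpha>)" for \<alpha> x n by (simp add: S_def)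
  have Phom: "on_hom P (n, \<alpha>) (k, \<beta>) (\<theta>, a) x \<in> on_ob P (k, \<beta>)"
    if "(n, \<alpha>) \<in> rooted_simplices" "(k, \<beta>) \<in> rooted_simplices"
      "(\<theta>, a) \<in> Hom rooted_simplex_cat (k, \<beta>) (n, \<alpha>)" "x \<in> on_ob P (n, \<alpha>)" for n \<alpha> k \<beta> \<theta> a x
    using ftor_hom[OF P, of "(n, \<alpha>)" "(k, \<beta>)" "(\<theta>, a)"] that by auto
  have PId: "on_hom P (n, \<alpha>) (n, \<alpha>) ((\<lambda>i\<in>{..n}. i), 0) x = x"
    if "(n, \<alpha>) \<in> rooted_simplices" "x \<in> on_ob P (n, \<alpha>)" for n \<alpha> x
    using ftor_Id[OF P, of "(n, \<alpha>)"] that by simp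
  have PComp: "on_hom P (n, \<alpha>) (l, \<gamma>) (compose {..l} \<theta> \<eta>, face_incl k \<theta> \<alpha> a (\<eta> l) b) x =
      on_hom P (k, \<beta>) (l, \<gamma>) (\<eta>, b) (on_hom P (n, \<alpha>) (k, \<beta>) (\<theta>, a) x)"
    if "(n, \<alpha>) \<in> rooted_simplices" "(k, \<beta>) \<in> rooted_simplices" "(l, \<gamma>) \<in> rooted_simplices"
      "(\<theta>, a) \<in> Hom rooted_simplex_cat (k, \<beta>) (n, \<alpha>)" "(\<eta>, b) \<in> Hom rooted_simplex_cat (l, \<gamma>) (k, \<beta>)"
      "x \<in> on_ob P (n, \<alpha>)" for n \<alpha> k \<beta> l \<gamma> \<theta> a \<eta> b x
    using ftor_Comp[OF P, of "(n, \<alpha>)" "(k, \<beta>)" "(l, \<gamma>)" "(\<theta>, a)" "(\<eta>, b)"] that by (simp add: compose_def)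
  \<comment> \<open>The entry number \<open>a\<close> of \<theta>* (\<alpha>, x) before coding: the
    face of the shape together with the restriction of \<open>x\<close> to it.\<close>
  define f where "f n k \<theta> \<alpha> x a = (face k \<theta> \<alpha> a, on_hom P (n, \<alpha>) (k, face k \<theta> \<alpha> a) (\<theta>, a) x)"
    for n k \<theta> \<alpha> x a
  have f_in: "f n k \<theta> \<alpha> x a \<in> S k"
    if "(\<alpha>, x) \<in> S n" "\<theta> \<in> Hom Delta k n" "a < on_ob \<alpha> (\<theta> k)" for n k \<theta> \<alpha> x a
  proof -
    have "(k, face k \<theta> \<alpha> a) \<in> rooted_simplices"
      using that by (intro face_rooted[of _ n]) (simp_all add: S_iff rooted_iff)
    then show ?thesis using that Phom by (simp add: f_def S_iff rooted_simplex_cat_Hom)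
  qed
  define act where "act n k \<theta> u = (case d n u of (\<alpha>, x) \<Rightarrow>
    map (\<lambda>a. c k (f n k \<theta> \<alpha> x a)) [0..<on_ob \<alpha> (\<theta> k)])" for n k \<theta> u
  have act_c: "act n k \<theta> (c n (\<alpha>, x)) = map (\<lambda>a. c k (f n k \<theta> \<alpha> x a)) [0..<on_ob \<alpha> (\<theta> k)]"
    if "(\<alpha>, x) \<in> S n" for n k \<theta> \<alpha> x
    using that by (simp add: act_def)
  define X where "X = mk_ftor (op_cat Delta) E (\<lambda>n k \<theta>. \<lambda>u\<in>E n. act n k \<theta> u)"
  have Xob [simp]: "on_ob X n = E n" for n by (simp add: X_def)
  have Xhom: "on_hom X n k \<theta> u = act n k \<theta> u" if "\<theta> \<in> Hom Delta k n" "u \<in> E n" for n k \<theta> u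
    using that by (simp add: X_def)
  have "is_ftor (op_cat Delta) (list_cat U) X"
    unfolding X_def
  proof (rule is_ftor_mk_ftor[OF category_op_cat[OF category_Delta]])
    show "E n \<in> Obj (list_cat U)" for n by (simp add: E)
  next
    fix n k \<theta> assume "\<theta> \<in> Hom (op_cat Delta) n k"
    then have \<theta>: "\<theta> \<in> Hom Delta k n" by simp
    have "act n k \<theta> u \<in> lists (E k)" if "u \<in> E n" for u
      using Ec[OF that] \<theta> by (auto simp: act_c f_in)
    then show "(\<lambda>u\<in>E n. act n k \<theta> u) \<in> Hom (list_cat U) (E n) (E k)" by simp
  next
    fix n
    have "act n n (\<lambda>i\<in>{..n}. i) u = [u]" if uE: "u \<in> E n" for u
    proof -
      obtain \<alpha> x where u: "u = c n (\<alpha>, x)" "(\<alpha>, x) \<in> S n" using Ec[OF uE] by blast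
      then have "(n, \<alpha>) \<in> rooted_simplices" "x \<in> on_ob P (n, \<alpha>)" "on_ob \<alpha> n = 1"
        by (simp_all add: S_iff rooted_iff)
      then show ?thesis using u by (simp add: act_c f_def face_Id PId)
    qed
    then show "(\<lambda>u\<in>E n. act n n (Id (op_cat Delta) n) u) = Id (list_cat U) (E n)" by (auto intro!: restrict_ext)
  next
    fix n k l \<theta> \<eta> assume "\<theta> \<in> Hom (op_cat Delta) n k" "\<eta> \<in> Hom (op_cat Delta) k l"
    then have \<theta>: "\<theta> \<in> Hom Delta k n" and \<eta>: "\<eta> \<in> Hom Delta l k" by simp_all
    have "act n l (compose {..l} \<theta> \<eta>) u = concat (map (\<lambda>v\<in>E k. act k l \<eta> v) (act n k \<theta> u))" if uE: "u \<in> E n" for u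
    proof -
      obtain \<alpha> x where u: "u = c n (\<alpha>, x)" "(\<alpha>, x) \<in> S n" using Ec[OF uE] by blast
      then have \<alpha>: "(n, \<alpha>) \<in> rooted_simplices" "\<alpha> \<in> nerve_Delta_plus n" "x \<in> on_ob P (n, \<alpha>)"
        by (simp_all add: S_iff rooted_iff)
      let ?h = "\<lambda>a'. c l (f n l (compose {..l} \<theta> \<eta>) \<alpha> x a')"
      have le: "\<theta> (\<eta> l) \<le> \<theta> k" "\<theta> k \<le> n" "\<eta> l \<le> k"
        using Delta_mono[OF \<theta>] Delta_le[OF \<theta>] Delta_le[OF \<eta>] by auto
      \<comment> \<open>By \<open>face_compose\<close> and the composition law of \<open>P\<close>,
        the entries obtained by restricting entry \<open>a\<close> along \<open>\<eta>\<close> are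
        entries for the composite map, numbered by the inclusion of the face, that is, by the fibre
        over \<open>a\<close> in increasing order.\<close>
      have inner: "act k l \<eta> (c k (f n k \<theta> \<alpha> x a)) =
          map ?h (sorted_list_of_set {p. p < on_ob \<alpha> (\<theta> (\<eta> l)) \<and> transition \<alpha> (\<theta> (\<eta> l)) (\<theta> k) p = a})"
        if a: "a < on_ob \<alpha> (\<theta> k)" for a
      proof -
        let ?F = "face k \<theta> \<alpha> a" and ?x = "on_hom P (n, \<alpha>) (k, face k \<theta> \<alpha> a) (\<theta>, a) x"
        have F: "(k, ?F) \<in> rooted_simplices" "(\<theta>, a) \<in> Hom rooted_simplex_cat (k, ?F) (n, \<alpha>)"
          using face_rooted[OF \<alpha>(2) \<theta> a] \<theta> a by (simp_all add: rooted_simplex_cat_Hom)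
        have "f k l \<eta> ?F ?x b = f n l (compose {..l} \<theta> \<eta>) \<alpha> x (face_incl k \<theta> \<alpha> a (\<eta> l) b)"
          if b: "b < on_ob ?F (\<eta> l)" for b
        proof -
          have "(l, face l \<eta> ?F b) \<in> rooted_simplices" "(\<eta>, b) \<in> Hom rooted_simplex_cat (l, face l \<eta> ?F b) (k, ?F)"
            using face_rooted[OF face_nerve[OF \<alpha>(2) \<theta>] \<eta> b] \<eta> b by (simp_all add: rooted_simplex_cat_Hom)
          then show ?thesis
            using PComp[OF \<alpha>(1) F(1) _ F(2) _ \<alpha>(3)] by (simp add: f_def face_compose[OF \<alpha>(2) \<theta> \<eta> b])
        qed
        then have "map (\<lambda>b. c l (f k l \<eta> ?F ?x b)) [0..<on_ob ?F (\<eta> l)] =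
            map ?h (map (face_incl k \<theta> \<alpha> a (\<eta> l)) [0..<on_ob ?F (\<eta> l)])"
          by (simp del: restrict_chain_ob)
        also have "map (face_incl k \<theta> \<alpha> a (\<eta> l)) [0..<on_ob ?F (\<eta> l)] =
            sorted_list_of_set {p. p < on_ob \<alpha> (\<theta> (\<eta> l)) \<and> transition \<alpha> (\<theta> (\<eta> l)) (\<theta> k) p = a}"
          using fibre_incl_list[of k "pull_chain k \<theta> \<alpha>" a "\<eta> l"] le by (simp add: fibre_pull_chain)
        finally show ?thesis using f_in[OF u(2) \<theta> a] act_c[of ?F ?x k] by (simp add: f_def)
      qed
      have "concat (map (\<lambda>v\<in>E k. act k l \<eta> v) (act n k \<theta> u)) =
          concat (map (\<lambda>a. map ?h (sorted_list_of_set {p. p < on_ob \<alpha> (\<theta> (\<eta> l)) \<and> transition \<alpha> (\<theta> (\<eta> l)) (\<theta> k) p = a}))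
            [0..<on_ob \<alpha> (\<theta> k)])"
        using u by (auto simp: act_c f_in[OF u(2) \<theta>] inner intro!: arg_cong[of _ _ concat])
      also have "\<dots> = map ?h (concat (map (\<lambda>a. sorted_list_of_set
          {p. p < on_ob \<alpha> (\<theta> (\<eta> l)) \<and> transition \<alpha> (\<theta> (\<eta> l)) (\<theta> k) p = a}) [0..<on_ob \<alpha> (\<theta> k)]))"
        by (simp add: map_concat o_def)
      \<comment> \<open>The fibres of the transition from level \<open>\<theta> (\<eta> l)\<close>
        to level \<open>\<theta> k\<close> concatenate to the whole source level.\<close>
      also have "\<dots> = map ?h [0..<on_ob \<alpha> (\<theta> (\<eta> l))]"
        by (subst concat_fibres) (use nerve_mono[OF \<alpha>(2) le(1,2)] nerve_less[OF \<alpha>(2) le(1,2)] in auto)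
      finally show ?thesis using u by (simp add: act_c)
    qed
    then show "(\<lambda>u\<in>E n. act n l (Comp (op_cat Delta) n k l \<eta> \<theta>) u) =
      Comp (list_cat U) (E n) (E k) (E l) (\<lambda>u\<in>E k. act k l \<eta> u) (\<lambda>u\<in>E n. act n k \<theta> u)"
      by (auto intro!: restrict_ext)
  qed
  \<comment> \<open>Rootedness enters here: if \<theta> k = n, the entries are numbered by the last
    level of the shape, a single point.\<close>
  moreover have "operadic X"
    unfolding operadic_def is_function_def
  proof (intro allI ballI impI)
    fix k n \<theta> u assume \<theta>: "\<theta> \<in> Hom Delta k n" "\<theta> k = n" and "u \<in> on_ob X n"
    then obtain \<alpha> x where u: "u = c n (\<alpha>, x)" "(\<alpha>, x) \<in> S n" "u \<in> E n" using Ec[of u n] by auto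
    then show "length (on_hom X n k \<theta> u) = 1"
      using \<theta> by (simp add: Xhom act_c S_iff rooted_iff)
  qed
  ultimately have X: "X \<in> Obj (sList_Op U)" by (simp add: sList_Op_simps)
  have shape_c: "shape X n (c n (\<alpha>, x)) = \<alpha>" if S: "(\<alpha>, x) \<in> S n" for n \<alpha> x
  proof -
    have \<alpha>: "\<alpha> \<in> nerve_Delta_plus n" using S by (simp add: S_iff rooted_iff)
    \<comment> \<open>Stated for all dimensions and shapes, since the computation of
      \<open>lens\<close> uses it for edges, whose shapes are faces of \<alpha>.\<close>
    have vlen: "vlen X n (c n (\<alpha>, x)) i = on_ob \<alpha> i" if "i \<le> n" "(\<alpha>, x) \<in> S n" for n i \<alpha> x
      using that by (simp add: vlen_def Xhom vertex_Hom act_c)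
    have lens: "lens X n (c n (\<alpha>, x)) i j = map (\<lambda>a. card {p. p < on_ob \<alpha> i \<and> transition \<alpha> i j p = a}) [0..<on_ob \<alpha> j]"
      if ij: "i \<le> j" "j \<le> n" for i j
    proof -
      \<comment> \<open>The edge number \<open>a\<close> has as its shape the face of \<alpha> along
        \<open>edge i j\<close> over \<open>a\<close>, and level 0 of this face is the fibre of the
        transition over \<open>a\<close>.\<close>
      have "vlen X 1 (c 1 (f n 1 (edge i j) \<alpha> x a)) 0 = card {p. p < on_ob \<alpha> i \<and> transition \<alpha> i j p = a}"
        if "a < on_ob \<alpha> j" for a
        using f_in[OF S edge_Hom[OF ij], of a] that vlen[of 0 1] by (simp add: f_def fibre_pull_chain)
      then show ?thesis using S by (simp add: lens_def Xhom edge_Hom[OF ij, simplified] act_c)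
    qed
    show ?thesis
    proof (rule chain_eqI[OF shape_nerve[OF X] \<alpha>])
      show "c n (\<alpha>, x) \<in> on_ob X n" using S by simp
      fix i j p assume *: "i \<le> j" "j \<le> n" "p < on_ob (shape X n (c n (\<alpha>, x))) i"
      then have p: "p < on_ob \<alpha> i" by (simp add: shape_ob[OF X] vlen S)
      \<comment> \<open>The brackets have the fibre sizes of the transition of \<alpha>, and a
        monotone map is the \<open>block\<close> map of its fibre sizes.\<close>
      then show "transition (shape X n (c n (\<alpha>, x))) i j p = transition \<alpha> i j p"
        using * block_fibre_sizes[of "on_ob \<alpha> i" "transition \<alpha> i j" p "on_ob \<alpha> j"]
          nerve_mono[OF \<alpha> *(1,2)] nerve_less[OF \<alpha> *(1,2) p]
        by (simp add: shape_transition[OF X] vlen S lens)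
    qed (simp add: shape_ob[OF X] vlen S)
  qed
  have elems: "elems X n \<alpha> = (\<lambda>x. c n (\<alpha>, x)) ` on_ob P (n, \<alpha>)" if "(n, \<alpha>) \<in> rooted_simplices" for n \<alpha>
  proof (intro equalityI subsetI)
    fix u assume u: "u \<in> elems X n \<alpha>"
    then obtain \<beta> x where "u = c n (\<beta>, x)" "(\<beta>, x) \<in> S n" using Ec[of u n] by (auto simp: elems_def)
    then show "u \<in> (\<lambda>x. c n (\<alpha>, x)) ` on_ob P (n, \<alpha>)" using u by (auto simp: elems_def shape_c S_iff)
  qed (use that in \<open>auto simp: elems_def shape_c S_iff\<close>)
  have "isomorphic_in (ftor_cat (op_cat rooted_simplex_cat) (set_cat U)) (presheaf_of X) P"
  proof (rule isomorphic_in_ftor_cat[OF category_set_cat is_ftor_presheaf_of[OF X U] P])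
    \<comment> \<open>Among the elements of one shape, the first component of the decoded pair is
      constant, so dropping it is a bijection onto the value of \<open>P\<close>, with
      \<open>?\<sigma>\<close> restoring it.\<close>
    let ?\<tau> = "\<lambda>p. \<lambda>u\<in>elems X (fst p) (snd p). snd (d (fst p) u)"
    let ?\<sigma> = "\<lambda>p. \<lambda>x\<in>on_ob P p. c (fst p) (snd p, x)"
    show "(\<lambda>p\<in>Obj (op_cat rooted_simplex_cat). ?\<tau> p) \<in> nat_trans (op_cat rooted_simplex_cat) (set_cat U) (presheaf_of X) P"
    proof (rule restrict_nat_transI; clarsimp)
      show "snd (d n u) \<in> on_ob P (n, \<alpha>)" if "(n, \<alpha>) \<in> rooted_simplices" "u \<in> elems X n \<alpha>" for n \<alpha> u
        using that by (auto simp: elems S_iff)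
    next
      fix n \<alpha> k \<beta> \<theta> a assume r: "(n, \<alpha>) \<in> rooted_simplices" "(k, \<beta>) \<in> rooted_simplices"
        and h: "(\<theta>, a) \<in> Hom rooted_simplex_cat (k, \<beta>) (n, \<alpha>)"
      then have \<theta>: "\<theta> \<in> Hom Delta k n" "a < on_ob \<alpha> (\<theta> k)" "\<beta> = face k \<theta> \<alpha> a" by (auto simp: rooted_simplex_cat_Hom)
      have "on_hom X n k \<theta> u ! a \<in> elems X k \<beta> \<and>
          snd (d k (on_hom X n k \<theta> u ! a)) = on_hom P (n, \<alpha>) (k, \<beta>) (\<theta>, a) (snd (d n u))"
        if u: "u \<in> elems X n \<alpha>" for u
      proof -
        obtain x where x: "u = c n (\<alpha>, x)" "(\<alpha>, x) \<in> S n" using u r by (auto simp: elems S_iff)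
        have "on_hom X n k \<theta> u ! a = c k (f n k \<theta> \<alpha> x a)"
          using x \<theta> by (simp add: Xhom act_c)
        then show ?thesis using act_elems[OF X h u] x f_in[OF x(2) \<theta>(1,2)] by (simp add: f_def \<theta>(3))
      qed
      then show "compose (elems X n \<alpha>) (\<lambda>u\<in>elems X k \<beta>. snd (d k u)) (\<lambda>u\<in>elems X n \<alpha>. on_hom X n k \<theta> u ! a) =
        compose (elems X n \<alpha>) (on_hom P (n, \<alpha>) (k, \<beta>) (\<theta>, a)) (\<lambda>u\<in>elems X n \<alpha>. snd (d n u))"
        by (auto simp: compose_def intro!: restrict_ext)
    qed
    fix p assume "p \<in> Obj (op_cat rooted_simplex_cat)"
    then obtain n \<alpha> where p: "p = (n, \<alpha>)" "(n, \<alpha>) \<in> rooted_simplices" by (cases p) auto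
    show "?\<sigma> p \<in> Hom (set_cat U) (on_ob P p) (on_ob (presheaf_of X) p)"
      using p by (auto simp: elems)
    show "Comp (set_cat U) (on_ob (presheaf_of X) p) (on_ob P p) (on_ob (presheaf_of X) p) (?\<sigma> p)
        ((\<lambda>p\<in>Obj (op_cat rooted_simplex_cat). ?\<tau> p) p) = Id (set_cat U) (on_ob (presheaf_of X) p)"
      using p by (auto simp: elems compose_def S_iff intro!: restrict_ext)
    show "Comp (set_cat U) (on_ob P p) (on_ob (presheaf_of X) p) (on_ob P p)
        ((\<lambda>p\<in>Obj (op_cat rooted_simplex_cat). ?\<tau> p) p) (?\<sigma> p) = Id (set_cat U) (on_ob P p)"
      using p by (auto simp: elems compose_def S_iff intro!: restrict_ext)
  qed
  then show "\<exists>X\<in>Obj (sList_Op U). isomorphic_in (ftor_cat (op_cat rooted_simplex_cat) (set_cat U))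
      (on_ob (presheaf_ftor U) X) P"
    using X by (intro bexI[of _ X]) (simp_all add: presheaf_ftor_def)
qed

text \<open>\<open>S\<close> is the set of objects of the subcategory. These are simplicial lists
  and not simplices, which is why the description by rooted simplices takes the form of an
  isomorphism of categories.\<close>

theorem theorem1p4:
  fixes U :: "'u set set"
  assumes "set_universe U"
  shows "\<exists>S \<subseteq> Obj (sList_Op U).
           equivalent_cats (sList_Op U)
             (ftor_cat (op_cat (full_subcat (sList_Op U) S)) (set_cat U)) \<and>
           isomorphic_cats (full_subcat (sList_Op U) S) rooted_simplex_cat"
proof -
  obtain code where code: "coded_cat rooted_simplex_cat U code" by (rule coded_cat_rooted_simplex_cat[OF assms])
  have skel: "a = b" if "a \<in> Obj rooted_simplex_cat" "b \<in> Obj rooted_simplex_cat"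
    "isomorphic_in rooted_simplex_cat a b" for a b
    using that rooted_simplex_cat_skeletal by simp
  show ?thesis
    by (rule presheaf_category_via_subcat[OF category_sList_Op code fully_faithful_presheaf_ftor[OF assms]
          ess_surj_presheaf_ftor[OF assms] skel])
qed

end
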